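(* Let $\mu=\mathcal{GW}(\{q_k\},\lambda)$ be a Galton-Watson measure on $\mathcal{L}^{|}$ with $q_1=0$ and $\lambda>0$, with progeny generating function $Q$. Let $\varphi:\mathcal{L}\to\mathbb{R}_+$ be a monotone nondecreasing function, let $\mathcal{S}_t(T)=\mathcal{S}_t(\varphi,T)$ be the associated generalized dynamical pruning, and let $T$ be a random tree with distribution $\mu$, where $\mathsf{P}(\mathcal{S}_t(T)\ne\phi)>0$ for all $t\ge0$. (i) Suppose that $\mu$ is critical and that the limit $\lim_{x\to1-}\frac{Q(x)-x}{(1-x)(1-Q'(x))}$ exists. Then $$\lim_{t\to\infty}\mathsf{P}\big(\mathrm{shape}(\mathcal{S}_t(T))=\tau\,\big|\,\mathcal{S}_t(T)\ne\phi\big)=\mu^*(\tau)\qquad\text{for all }\tau\in\mathcal{T}^{|},$$ where $\mu^*$ is the invariant Galton-Watson measure $\mathcal{IGW}(q)$ with $q=\frac{1}{2-L}$ and $L=\lim_{x\to1-}\frac{\ln g(x)}{-\ln(1-x)}$. (ii) Suppose that $\mu$ is subcritical. Then the distribution $\mathsf{P}\big(\mathrm{shape}(\mathcal{S}_t(T))=\cdot\,\big|\,\mathcal{S}_t(T)\ne\phi\big)$ converges, as $t\to\infty$, to the point mass measure $\mathcal{GW}(q_0=1)$.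
   Context: Trees. A rooted tree is reduced if it has no vertices of degree 2 except possibly the root, and planted if its root has degree one (the edge at the root is the stem). $\mathcal{T}$ is the space of finite unlabeled rooted reduced trees without planar embedding, including the empty tree $\phi$ (a root and no edges); $\mathcal{T}^{|}$ consists of the planted trees in $\mathcal{T}$ together with $\phi$. $\mathcal{L}$, $\mathcal{L}^{|}$ are the corresponding spaces of trees with positive edge lengths, regarded as metric spaces with the path metric $d$. $\mathrm{shape}(T)$ is the combinatorial tree underlying $T\in\mathcal{L}$. Galton-Watson measures. For a p.m.f. $\{q_k\}_{k\ge 0}$ with $q_1=0$ and $\sum_k kq_k\le1$, $\mathcal{GW}(\{q_k\})$ is the law on $\mathcal{T}^{|}$ of the tree of the Galton-Watson process started from a progenitor (the root) with exactly one offspring, after which each individual independently has $k$ offspring with probability $q_k$. It is critical if $\sum_k kq_k=1$ and subcritical if $\sum_k kq_k<1$. $\mathcal{GW}(\{q_k\},\lambda)$ is the law on $\mathcal{L}^{|}$ of a tree whose shape has law $\mathcal{GW}(\{q_k\})$ and whose edge lengths, conditioned on the shape, are i.i.d. exponential with parameter $\lambda$. $Q(z)=\sum_k q_kz^k$. For $q\in[1/2,1)$, $\mathcal{IGW}(q)$ is $\mathcal{GW}$ with progeny generating function $z+q(1-z)^{1/q}$; if $q=1$ occurs, the formula is read as the generating function $z+(1-z)=1$, i.e. $\mathcal{GW}(q_0=1)$. The function $g$ is $g(x)=\sum_{m=0}^\infty\sum_{k=m+1}^\infty(k-m-1)q_k\,x^m$, so that in the critical case $Q(x)-x=(1-x)^2g(x)$.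 In the critical case, when the limit $\lim_{x\to1-}\frac{Q(x)-x}{(1-x)(1-Q'(x))}$ exists, the limit $L$ is known to exist. Pruning. For $T\in\mathcal{L}$ and a point $x\in T$, $\Delta_{x,T}$ is the descendant tree of $x$: all points of $T$ descendant to $x$, including $x$, rooted at $x$. For $T_1,T_2\in\mathcal{L}$, $T_1$ with root $\rho_1$, write $T_1\preceq T_2$ if there is a distance-preserving map $f:T_1\to T_2$ with image contained in $\Delta_{f(\rho_1),T_2}$. $\varphi$ is monotone nondecreasing if $\varphi(T_1)\le\varphi(T_2)$ whenever $T_1\preceq T_2$. For $t\ge0$, $$\mathcal{S}_t(\varphi,T)=\{\rho\}\cup\{x\in T\setminus\rho:\ \varphi(\Delta_{x,T})\ge t\},$$ where $\rho$ is the root of $T$, regarded as an element of $\mathcal{L}$ (with non-root degree-two vertices removed by merging adjacent edges). It is implicit that $\varphi$ is such that $\mathcal{S}_t(\varphi,\cdot)$ is measurable, so that the probabilities make sense. *)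

theory Defs
  imports "HOL-Probability.Probability"
begin

section \<open>Trees without planar embedding\<close>

text \<open>
  A finite rooted tree is the multiset of the edges at its root, each edge being given by its label
  and the tree hanging from its lower end.  Multisets make equality the same as isomorphism
  of rooted, edge-labelled trees.  Metric trees are trees labelled by edge lengths, with equality being
  root-preserving isometry (for reduced trees); combinatorial trees carry the trivial label.
\<close>

datatype 'a tree = Node (root_edges: "('a \<times> 'a tree) multiset")

type_synonym comb_tree = "unit tree"
type_synonym metric_tree = "real tree"

definition empty_tree :: "'a tree" where
  "empty_tree = Node {#}"

definition planted :: "'a tree \<Rightarrow> bool" where
  "planted T \<longleftrightarrow> size (root_edges T) = 1"

text \<open>A non-root vertex has degree two iff exactly one edge leads down from it.\<close>

inductive reduced :: "'a tree \<Rightarrow> bool" where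
  "(\<And>l S. (l, S) \<in># E \<Longrightarrow> size (root_edges S) \<noteq> 1 \<and> reduced S) \<Longrightarrow> reduced (Node E)"

definition comb_trees :: "comb_tree set" where
  "comb_trees = {\<tau>. reduced \<tau>}"

definition planted_comb_trees :: "comb_tree set" where
  "planted_comb_trees = {\<tau> \<in> comb_trees. planted \<tau> \<or> \<tau> = empty_tree}"

definition metric_trees :: "metric_tree set" where
  "metric_trees = {T. reduced T \<and> (\<forall>l \<in> set_tree T. 0 < l)}"

definition shape :: "metric_tree \<Rightarrow> comb_tree" where
  "shape = map_tree (\<lambda>_. ())"


section \<open>Points of a metric tree\<close>

text \<open>
  To speak about the individual points of a tree one fixes an ordering of the edges at each vertex.
  Everything defined through such an ordering below is independent of its choice.
\<close>

datatype 'a plane_tree = PNode (root_edge_list: "('a \<times> 'a plane_tree) list")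

primrec forget :: "'a plane_tree \<Rightarrow> 'a tree" where
  "forget (PNode es) = Node (mset (map (map_prod id forget) es))"

abbreviation edge_length :: "real plane_tree \<Rightarrow> nat \<Rightarrow> real" where
  "edge_length P i \<equiv> fst (root_edge_list P ! i)"

abbreviation branch :: "'a plane_tree \<Rightarrow> nat \<Rightarrow> 'a plane_tree" where
  "branch P i \<equiv> snd (root_edge_list P ! i)"

text \<open>
  \<open>OnEdge i s\<close> is the interior point of the \<open>i\<close>-th edge at the root at distance \<open>s\<close> from the root;
  \<open>Beyond i x\<close> is the point \<open>x\<close> of the \<open>i\<close>-th branch, so that \<open>Beyond i AtRoot\<close> is the lower end
  of the \<open>i\<close>-th edge.
\<close>

datatype point = AtRoot | OnEdge nat real | Beyond nat point

primrec is_point :: "point \<Rightarrow> real plane_tree \<Rightarrow> bool" where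
  "is_point AtRoot P \<longleftrightarrow> True"
| "is_point (OnEdge i s) P \<longleftrightarrow> i < length (root_edge_list P) \<and> 0 < s \<and> s < edge_length P i"
| "is_point (Beyond i x) P \<longleftrightarrow> i < length (root_edge_list P) \<and> is_point x (branch P i)"

definition points :: "real plane_tree \<Rightarrow> point set" where
  "points P = {x. is_point x P}"

primrec height :: "point \<Rightarrow> real plane_tree \<Rightarrow> real" where
  "height AtRoot P = 0"
| "height (OnEdge i s) P = s"
| "height (Beyond i x) P = edge_length P i + height x (branch P i)"

text \<open>The length of the common part of the paths from the root to \<open>x\<close> and to \<open>y\<close>.\<close>

primrec common_length :: "point \<Rightarrow> point \<Rightarrow> real plane_tree \<Rightarrow> real" where
  "common_length AtRoot y P = 0"
| "common_length (OnEdge i s) y P =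
     (case y of
        AtRoot \<Rightarrow> 0
      | OnEdge j r \<Rightarrow> (if i = j then min s r else 0)
      | Beyond j z \<Rightarrow> (if i = j then s else 0))"
| "common_length (Beyond i x) y P =
     (case y of
        AtRoot \<Rightarrow> 0
      | OnEdge j r \<Rightarrow> (if i = j then r else 0)
      | Beyond j z \<Rightarrow> (if i = j then edge_length P i + common_length x z (branch P i) else 0))"

definition path_dist :: "real plane_tree \<Rightarrow> point \<Rightarrow> point \<Rightarrow> real" where
  "path_dist P x y = height x P + height y P - 2 * common_length x y P"

text \<open>The points \<open>y\<close> such that \<open>x\<close> lies on the path from the root to \<open>y\<close>.\<close>

definition descendants :: "real plane_tree \<Rightarrow> point \<Rightarrow> point set" where
  "descendants P x =
     {y \<in> points P. path_dist P AtRoot y = path_dist P AtRoot x + path_dist P x y}"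

text \<open>The set of descendants of \<open>x\<close> as a tree rooted at \<open>x\<close>.\<close>

primrec descendant_tree :: "point \<Rightarrow> real plane_tree \<Rightarrow> real plane_tree" where
  "descendant_tree AtRoot P = P"
| "descendant_tree (OnEdge i s) P = PNode [(edge_length P i - s, branch P i)]"
| "descendant_tree (Beyond i x) P = descendant_tree x (branch P i)"

definition embeds :: "metric_tree \<Rightarrow> metric_tree \<Rightarrow> bool" (infix \<open>\<preceq>\<close> 50) where
  "T\<^sub>1 \<preceq> T\<^sub>2 \<longleftrightarrow>
     (\<exists>P\<^sub>1 P\<^sub>2 f. forget P\<^sub>1 = T\<^sub>1 \<and> forget P\<^sub>2 = T\<^sub>2 \<and>
        f ` points P\<^sub>1 \<subseteq> points P\<^sub>2 \<and>
        (\<forall>x \<in> points P\<^sub>1. \<forall>y \<in> points P\<^sub>1. path_dist P\<^sub>2 (f x) (f y) = path_dist P\<^sub>1 x y) \<and>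
        f ` points P\<^sub>1 \<subseteq> descendants P\<^sub>2 (f AtRoot))"

definition monotone_nondecreasing :: "(metric_tree \<Rightarrow> real) \<Rightarrow> bool" where
  "monotone_nondecreasing \<phi> \<longleftrightarrow>
     (\<forall>T\<^sub>1 \<in> metric_trees. \<forall>T\<^sub>2 \<in> metric_trees. T\<^sub>1 \<preceq> T\<^sub>2 \<longrightarrow> \<phi> T\<^sub>1 \<le> \<phi> T\<^sub>2)"


section \<open>Generalized dynamical pruning\<close>

definition kept_points :: "(metric_tree \<Rightarrow> real) \<Rightarrow> real \<Rightarrow> real plane_tree \<Rightarrow> point set" where
  "kept_points \<phi> t P =
     {AtRoot} \<union> {x \<in> points P - {AtRoot}. t \<le> \<phi> (forget (descendant_tree x P))}"

lemma size_branch [termination_simp]: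
  fixes es :: "('a \<times> 'a plane_tree) list"
  assumes "i < length es"
  shows "size (snd (es ! i)) < Suc (size_list (\<lambda>e. Suc (size (snd e))) es)"
proof -
  have "Suc (size (snd (es ! i))) \<le> size_list (\<lambda>e. Suc (size (snd e))) es"
    by (rule size_list_estimation'[of "es ! i"]) (use assms in auto)
  then show ?thesis by simp
qed

text \<open>
  \<open>subtree A P\<close> is the subtree of \<open>P\<close> with point set \<open>A\<close>, where \<open>A\<close> contains with each point the
  whole path from the root to it (as \<open>kept_points\<close> does for monotone \<open>\<phi>\<close>).  An edge that is only
  partly covered is cut at the supremum of the covered positions, i.e. the closure of \<open>A\<close> is taken.
  The result may have vertices of degree two.
\<close>

fun subtree :: "point set \<Rightarrow> real plane_tree \<Rightarrow> real plane_tree" where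
  "subtree A (PNode es) = PNode (concat (map (\<lambda>i.
     if \<exists>x. Beyond i x \<in> A then [(fst (es ! i), subtree {x. Beyond i x \<in> A} (snd (es ! i)))]
     else if \<exists>s. OnEdge i s \<in> A then [(Sup {s. OnEdge i s \<in> A}, PNode [])]
     else []) [0..<length es]))"

text \<open>Removal of the non-root vertices of degree two, adding up the lengths of the merged edges.\<close>

fun merge_edges :: "real plane_tree \<Rightarrow> real plane_tree" where
  "merge_edges (PNode es) = PNode (map (\<lambda>e.
     case root_edge_list (merge_edges (snd e)) of
       [(m, R)] \<Rightarrow> (fst e + m, R)
     | _ \<Rightarrow> (fst e, merge_edges (snd e))) es)"

definition prune :: "(metric_tree \<Rightarrow> real) \<Rightarrow> real \<Rightarrow> metric_tree \<Rightarrow> metric_tree" where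
  "prune \<phi> t T =
     (let P = (SOME P. forget P = T) in forget (merge_edges (subtree (kept_points \<phi> t P) P)))"


section \<open>Galton-Watson measures\<close>

text \<open>
  Individuals below the progenitor are addressed by lists over \<open>nat\<close>: \<open>[]\<close> is the only child of the
  progenitor, and \<open>u @ [i]\<close> is the \<open>i\<close>-th child of \<open>u\<close>.  The individual \<open>u\<close> has \<open>c u\<close> children, and
  the edge from its parent to \<open>u\<close> has label \<open>l u\<close>.  \<open>genealogy c l u S\<close> states that
  the tree of descendants of \<open>u\<close> is finite and equal to \<open>S\<close>.
\<close>

inductive genealogy :: "(nat list \<Rightarrow> nat) \<Rightarrow> (nat list \<Rightarrow> 'a) \<Rightarrow> nat list \<Rightarrow> 'a tree \<Rightarrow> bool"
  for c l where
  "(\<And>i. i < c u \<Longrightarrow> genealogy c l (u @ [i]) (S i)) \<Longrightarrow>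
     genealogy c l u (Node (mset (map (\<lambda>i. (l (u @ [i]), S i)) [0..<c u])))"

text \<open>The value on infinite genealogies is irrelevant in the critical and subcritical cases.\<close>

definition galton_watson_tree :: "(nat list \<Rightarrow> nat) \<Rightarrow> (nat list \<Rightarrow> 'a) \<Rightarrow> 'a tree" where
  "galton_watson_tree c l =
     (if \<exists>S. genealogy c l [] S then Node {#(l [], THE S. genealogy c l [] S)#} else empty_tree)"

definition GW :: "nat pmf \<Rightarrow> comb_tree measure" where
  "GW q = distr (\<Pi>\<^sub>M u\<in>UNIV. measure_pmf q) (count_space UNIV)
            (\<lambda>c. galton_watson_tree c (\<lambda>_. ()))"

text \<open>
  The Borel \<open>\<sigma>\<close>-algebra on the space of metric trees: a set of trees is measurable iff, for every
  plane combinatorial tree (given by its numbers of children \<open>c\<close>), the set of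
  assignments of edge lengths that lead to a tree in the set is Borel.
\<close>

definition metric_tree_space :: "metric_tree measure" where
  "metric_tree_space = sigma metric_trees
     {A. A \<subseteq> metric_trees \<and>
         (\<forall>c. {l. \<exists>S \<in> A. genealogy c l [] S} \<in> sets (\<Pi>\<^sub>M u\<in>(UNIV :: nat list set). (borel :: real measure)))}"

text \<open>
  The edge lengths are i.i.d. exponential and independent of the numbers of children.  Outcomes that
  do not give an element of \<open>metric_trees\<close> form a null set if \<open>pmf q 1 = 0\<close> and \<open>q\<close> is critical or
  subcritical.
\<close>

definition GW_metric :: "nat pmf \<Rightarrow> real \<Rightarrow> metric_tree measure" where
  "GW_metric q lam =
     distr ((\<Pi>\<^sub>M u\<in>UNIV. measure_pmf q) \<Otimes>\<^sub>M
            (\<Pi>\<^sub>M u\<in>UNIV. density lborel (exponential_density lam)))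
       metric_tree_space
       (\<lambda>(c, l). let T = galton_watson_tree c l in if T \<in> metric_trees then T else empty_tree)"

definition critical :: "nat pmf \<Rightarrow> bool" where
  "critical q \<longleftrightarrow> (\<lambda>k. real k * pmf q k) sums 1"

definition subcritical :: "nat pmf \<Rightarrow> bool" where
  "subcritical q \<longleftrightarrow> (\<exists>m<1. (\<lambda>k. real k * pmf q k) sums m)"

definition pgf :: "nat pmf \<Rightarrow> real \<Rightarrow> real" where
  "pgf q z = (\<Sum>k. pmf q k * z ^ k)"

definition g_fun :: "nat pmf \<Rightarrow> real \<Rightarrow> real" where
  "g_fun q x =
     (\<Sum>m. (\<Sum>k. if k \<ge> m + 1 then (real k - real m - 1) * pmf q k else 0) * x ^ m)"

text \<open>
  For \<open>1 / 2 \<le> r \<le> 1\<close> there is exactly one such offspring distribution.  For \<open>r = 1\<close> it is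
  concentrated at \<open>0\<close>, and the \<open>powr\<close> convention \<open>0 powr a = 0\<close> gives the right value at \<open>z = 1\<close>.
\<close>

definition IGW_offspring :: "real \<Rightarrow> nat pmf" where
  "IGW_offspring r = (THE p. \<forall>z\<in>{0..1}. pgf p z = z + r * (1 - z) powr (1 / r))"

definition IGW :: "real \<Rightarrow> comb_tree measure" where
  "IGW r = GW (IGW_offspring r)"

end

theory Submission
  imports Defs
begin

text \<open>
  By monotonicity of \<open>\<phi>\<close> the shape of the pruned tree depends only on which of the planted
  subtrees of \<open>T\<close> survive the pruning, and a planted subtree survives as soon as one of its children
  does.  The children of a vertex survive independently of each other with probability
  \<open>p = p(t)\<close>, so after merging at the vertices with a single surviving child the shape is, conditionally
  on being nonempty, a Galton-Watson tree with offspring generating function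
  \<open>z + S(p (1 - z)) / (p S'(p))\<close>, where \<open>S(y) = Q(1 - y) - (1 - y)\<close> in the critical case.
  The edge lengths and \<open>\<phi>\<close> enter only through \<open>p\<close>, and \<open>p \<rightarrow> 0\<close> because \<open>\<phi>\<close> is finite.

  If \<open>S(y) / (y S'(y)) \<rightarrow> l\<close>, then \<open>S\<close> is regularly varying at \<open>0\<close> with index \<open>1 / l\<close>, so the
  generating function tends to \<open>z + l (1 - z)^(1 / l)\<close>, and with it every offspring probability and the
  probability of every finite tree; l'Hospital's rule gives \<open>L = 2 - 1 / l\<close>.
  In the subcritical case the probability of having no offspring tends to \<open>1\<close>.
\<close>

section \<open>Shapes of pruned trees\<close>

text \<open>Whether a planted subtree survives although none of its children does depends on the
  edge length and on \<phi> in an uncontrolled way. That probability is never computed directly: as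
  a surviving child forces its parent to survive, it equals \<open>p\<close> minus the probability
  that some child survives, and the latter involves only \<open>q\<close> and \<open>p\<close>. The
  denominator \<open>S'(p) = 1 - Q'(1 - p)\<close> comes from merging: a vertex with exactly one
  surviving child hands the shape of that child on unchanged, so the corresponding term, with weight
  \<open>Q'(1 - p)\<close>, contains the unknown again and moves to the other side of the recursion.
  For the children to be independent, the fate of a child must be read off its own stem and its own
  descendants; hence the recursion is written for planted subtrees, on a space of families indexed
  by addresses. The limiting coefficients are not presupposed to form a distribution: their signs
  come from the laws at positive \<open>p\<close>, and their total mass from Abel continuity at
  1.\<close>

lemma forget_surj: "\<exists>P. forget P = T"
proof (induction T)
  case (Node E)
  obtain es where es: "mset es = E" using ex_mset by blast
  have "\<exists>P. forget P = S" if "(l, S) \<in># E" for l S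
    using Node that by fastforce
  then have p: "forget (SOME P. forget P = S) = S" if "(l, S) \<in># E" for l S
    using that by (metis (mono_tags, lifting) someI_ex)
  define p :: "'a tree \<Rightarrow> 'a plane_tree" where "p S = (SOME P. forget P = S)" for S
  have "map_prod id forget (map_prod id p e) = e" if "e \<in> set es" for e
    using p[of "fst e" "snd e"] es that by (cases e) (auto simp: p_def)
  then have "forget (PNode (map (map_prod id p) es)) = Node E"
    using es by (simp add: comp_def map_idI)
  then show ?case by blast
qed

lemma forget_edge:
  assumes "e \<in> set es"
  shows "(fst e, forget (snd e)) \<in># mset (map (map_prod id forget) es)"
proof -
  have "map_prod id forget e \<in> set (map (map_prod id forget) es)"
    using assms by simp
  then show ?thesis by (simp add: map_prod_def case_prod_beta)
qed

section \<open>Elementary comparisons in the order on metric trees\<close>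

lemma embeds_stem:
  assumes "0 < a"
  shows "B \<preceq> Node {#(a, B)#}"
proof -
  obtain P where P: "forget P = B" using forget_surj by blast
  show ?thesis
    unfolding embeds_def
    by (rule exI[of _ P], rule exI[of _ "PNode [(a, P)]"], rule exI[of _ "Beyond 0"])
       (use P in \<open>auto simp: points_def path_dist_def descendants_def\<close>)
qed

text \<open>The part of the tree below the interior point at height \<open>l - a\<close> of the edge
  sits isometrically in the whole tree, with its root at that point and everything else descending
  from it.\<close>

lemma embeds_cut:
  assumes "0 < a" "a < l" "(l, B) \<in># E"
  shows "Node {#(a, B)#} \<preceq> Node E"
proof -
  obtain P where P: "forget P = B" using forget_surj by blast
  obtain E' where E': "E = add_mset (l, B) E'" using assms(3) by (meson multi_member_split)
  obtain Q where Q: "forget Q = Node E'" using forget_surj by blast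
  \<comment> \<open>Since edges form a multiset, the edge to be cut may be listed first, and all
    image points have index \<open>0\<close>.\<close>
  define P2 where "P2 = PNode ((l, P) # root_edge_list Q)"
  have P2: "forget P2 = Node E"
    using P Q E' by (cases Q) (auto simp: P2_def)
  define f where "f x = (case x of AtRoot \<Rightarrow> OnEdge 0 (l - a) | OnEdge i s \<Rightarrow> OnEdge 0 (l - a + s)
     | Beyond i y \<Rightarrow> Beyond 0 y)" for x
  have pts: "f x \<in> points P2" if "x \<in> points (PNode [(a, P)])" for x
    using that assms by (cases x) (auto simp: f_def points_def P2_def)
  have dst: "path_dist P2 (f x) (f y) = path_dist (PNode [(a, P)]) x y"
    if "x \<in> points (PNode [(a, P)])" "y \<in> points (PNode [(a, P)])" for x y
    using that assms by (cases x; cases y) (auto simp: f_def points_def P2_def path_dist_def min_def)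
  have "f x \<in> descendants P2 (f AtRoot)" if "x \<in> points (PNode [(a, P)])" for x
    using that assms pts[OF that]
    by (cases x) (auto simp: f_def points_def P2_def path_dist_def descendants_def)
  then show ?thesis
    unfolding embeds_def
    by (intro exI[of _ "PNode [(a, P)]"] exI[of _ P2] exI[of _ f]) (use P P2 pts dst in auto)
qed

lemma metric_trees_Node:
  "Node E \<in> metric_trees \<longleftrightarrow>
     (\<forall>(l, S) \<in># E. 0 < l \<and> size (root_edges S) \<noteq> 1 \<and> S \<in> metric_trees)"
  unfolding metric_trees_def by (subst reduced.simps) fastforce

lemma metric_trees_stem:
  "Node {#(l, S)#} \<in> metric_trees \<longleftrightarrow> 0 < l \<and> size (root_edges S) \<noteq> 1 \<and> S \<in> metric_trees"
  by (simp add: metric_trees_Node)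

text \<open>Whether pruning leaves something of the planted tree consisting of the edge \<open>e\<close>
  and the tree below it.\<close>

definition retained :: "(metric_tree \<Rightarrow> real) \<Rightarrow> real \<Rightarrow> real \<times> metric_tree \<Rightarrow> bool" where
  "retained \<phi> t e \<longleftrightarrow> (\<exists>s. 0 < s \<and> s < fst e \<and> t \<le> \<phi> (Node {#(fst e - s, snd e)#}))"

text \<open>Merging seen from the stem: a vertex with a single edge below it disappears, and the
  tree at the lower end of that edge takes its place. One level is enough where this is used,
  because the trees hanging in \<open>F\<close> have been collapsed before.\<close>

definition collapse :: "('a \<times> 'a tree) multiset \<Rightarrow> 'a tree" where
  "collapse F = (if size F = 1 then snd (the_elem (set_mset F)) else Node F)"

text \<open>The shape of what pruning leaves below the upper end of the stem, once the vertices of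
  degree two are removed.\<close>

primrec core_shape :: "(metric_tree \<Rightarrow> real) \<Rightarrow> real \<Rightarrow> metric_tree \<Rightarrow> comb_tree" where
  "core_shape \<phi> t (Node E) = collapse (image_mset (\<lambda>(l, S, R). ((), R))
     (filter_mset (\<lambda>(l, S, R). retained \<phi> t (l, S))
       (image_mset (map_prod id (\<lambda>S. (S, core_shape \<phi> t S))) E)))"

text \<open>The multiset inside \<open>core_shape\<close> in plain form. Primitive recursion reaches
  the subtrees only by mapping over \<open>E\<close>; hence the triples there, which keep
  \<open>S\<close> beside its shape until the filter has inspected it.\<close>

definition retained_shapes :: "(metric_tree \<Rightarrow> real) \<Rightarrow> real \<Rightarrow> (real \<times> metric_tree) multiset
    \<Rightarrow> (unit \<times> comb_tree) multiset" where
  "retained_shapes \<phi> t E =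
     image_mset (\<lambda>e. ((), core_shape \<phi> t (snd e))) (filter_mset (retained \<phi> t) E)"

lemma core_shape_Node: "core_shape \<phi> t (Node E) = collapse (retained_shapes \<phi> t E)"
proof -
  have "image_mset (\<lambda>(l, S, R). ((), R)) (filter_mset (\<lambda>(l, S, R). retained \<phi> t (l, S))
       (image_mset (map_prod id (\<lambda>S. (S, core_shape \<phi> t S))) E)) = retained_shapes \<phi> t E"
    unfolding retained_shapes_def by (induction E) auto
  then show ?thesis by simp
qed

declare core_shape.simps [simp del]

context
  fixes \<phi> :: "metric_tree \<Rightarrow> real" and t :: real
  assumes mono: "monotone_nondecreasing \<phi>"
begin

lemma le_stem:
  assumes "Node {#(a, B)#} \<in> metric_trees"
  shows "\<phi> B \<le> \<phi> (Node {#(a, B)#})"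
proof -
  have "B \<preceq> Node {#(a, B)#}"
    using assms by (intro embeds_stem) (simp add: metric_trees_stem)
  moreover have "B \<in> metric_trees"
    using assms by (simp add: metric_trees_stem)
  ultimately show ?thesis
    using mono assms unfolding monotone_nondecreasing_def by blast
qed

lemma cut_le:
  assumes "Node E \<in> metric_trees" "(l, B) \<in># E" "0 < a" "a < l"
  shows "\<phi> (Node {#(a, B)#}) \<le> \<phi> (Node E)"
proof -
  have "Node {#(a, B)#} \<in> metric_trees"
    using assms unfolding metric_trees_stem by (auto simp: metric_trees_Node)
  then show ?thesis
    using mono embeds_cut[OF assms(3,4,2)] assms(1) unfolding monotone_nondecreasing_def by blast
qed

lemma branch_le:
  assumes "Node E \<in> metric_trees" "(l, B) \<in># E"
  shows "\<phi> B \<le> \<phi> (Node E)"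
proof -
  have l: "0 < l" and B: "size (root_edges B) \<noteq> 1" "B \<in> metric_trees"
    using assms by (auto simp: metric_trees_Node)
  \<comment> \<open>\<open>embeds_cut\<close> asks for an interior cut, so the comparison passes
    through the lower half of the edge.\<close>
  have "\<phi> B \<le> \<phi> (Node {#(l / 2, B)#})"
    by (rule le_stem) (use l B in \<open>auto simp: metric_trees_stem\<close>)
  also have "\<dots> \<le> \<phi> (Node E)"
    by (rule cut_le[OF assms]) (use l in auto)
  finally show ?thesis .
qed

text \<open>With \<open>retained_stemI\<close> this gives the upward propagation of survival: a
  retained edge lifts \<phi> at its upper vertex to at least \<open>t\<close>, and this in turn
  makes the edge above that vertex retained.\<close>

lemma retained_le:
  assumes "Node E \<in> metric_trees" "e \<in># E" "retained \<phi> t e"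
  shows "t \<le> \<phi> (Node E)"
proof -
  obtain s where s: "0 < s" "s < fst e" "t \<le> \<phi> (Node {#(fst e - s, snd e)#})"
    using assms(3) by (auto simp: retained_def)
  have "\<phi> (Node {#(fst e - s, snd e)#}) \<le> \<phi> (Node E)"
    by (rule cut_le[OF assms(1), of "fst e"]) (use s assms(2) in auto)
  then show ?thesis using s by simp
qed

lemma retained_stemI:
  assumes "Node {#(l, S)#} \<in> metric_trees" "t \<le> \<phi> S"
  shows "retained \<phi> t (l, S)"
  unfolding retained_def
proof (intro exI conjI)
  have l: "0 < l" "size (root_edges S) \<noteq> 1" "S \<in> metric_trees"
    using assms(1) by (auto simp: metric_trees_stem)
  then show "0 < l / 2" "l / 2 < fst (l, S)" by auto
  have "\<phi> S \<le> \<phi> (Node {#(l / 2, S)#})"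
    by (rule le_stem) (use l in \<open>auto simp: metric_trees_stem\<close>)
  then show "t \<le> \<phi> (Node {#(fst (l, S) - l / 2, snd (l, S))#})"
    using assms(2) by simp
qed

section \<open>Kept points and the shape they leave\<close>

lemma descendant_le:
  assumes "is_point x P" "forget P \<in> metric_trees"
  shows "\<phi> (forget (descendant_tree x P)) \<le> \<phi> (forget P)"
  using assms
proof (induction x arbitrary: P)
  case (OnEdge i s)
  obtain es where P: "P = PNode es" by (cases P)
  have i: "es ! i \<in> set es" using OnEdge P by auto
  then have "(fst (es ! i), forget (snd (es ! i))) \<in># mset (map (map_prod id forget) es)"
    by (rule forget_edge)
  then have "\<phi> (Node {#(fst (es ! i) - s, forget (snd (es ! i)))#})
      \<le> \<phi> (Node (mset (map (map_prod id forget) es)))"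
    using OnEdge P by (intro cut_le) auto
  then show ?case using P by simp
next
  case (Beyond i x)
  obtain es where P: "P = PNode es" by (cases P)
  have i: "es ! i \<in> set es" using Beyond P by auto
  then have e: "(fst (es ! i), forget (snd (es ! i))) \<in># mset (map (map_prod id forget) es)"
    by (rule forget_edge)
  have m: "Node (mset (map (map_prod id forget) es)) \<in> metric_trees"
    using Beyond P by simp
  have "\<phi> (forget (descendant_tree x (snd (es ! i)))) \<le> \<phi> (forget (snd (es ! i)))"
    by (rule Beyond.IH) (use Beyond P e m in \<open>auto simp: metric_trees_Node\<close>)
  also have "\<dots> \<le> \<phi> (forget P)"
    using branch_le[OF m e] P by simp
  finally show ?case using P by simp
qed simp

text \<open>As \<phi> does not increase on the way down, a kept point at or beyond the lower end of
  an edge makes that lower end kept. The second part is conditional because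
  \<open>kept_points\<close> of the branch contains the root of the branch in any case.\<close>

lemma kept_Beyond:
  assumes "forget (PNode es) \<in> metric_trees" "i < length es"
  shows "(\<exists>x. Beyond i x \<in> kept_points \<phi> t (PNode es)) \<longleftrightarrow> t \<le> \<phi> (forget (snd (es ! i)))" (is ?A)
    and "t \<le> \<phi> (forget (snd (es ! i))) \<Longrightarrow>
      {x. Beyond i x \<in> kept_points \<phi> t (PNode es)} = kept_points \<phi> t (snd (es ! i))" (is "_ \<Longrightarrow> ?B")
proof -
  have "(fst (es ! i), forget (snd (es ! i))) \<in># mset (map (map_prod id forget) es)"
    using assms(2) by (intro forget_edge nth_mem)
  then have m: "forget (snd (es ! i)) \<in> metric_trees"
    using assms(1) by (auto simp: metric_trees_Node)
  have iff: "Beyond i x \<in> kept_points \<phi> t (PNode es) \<longleftrightarrow>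
      is_point x (snd (es ! i)) \<and> t \<le> \<phi> (forget (descendant_tree x (snd (es ! i))))" for x
    using assms(2) by (auto simp: kept_points_def points_def)
  show ?A
  proof
    assume "\<exists>x. Beyond i x \<in> kept_points \<phi> t (PNode es)"
    then obtain x where "is_point x (snd (es ! i))"
        "t \<le> \<phi> (forget (descendant_tree x (snd (es ! i))))"
      using iff by blast
    then show "t \<le> \<phi> (forget (snd (es ! i)))"
      using descendant_le[OF _ m] by fastforce
  next
    assume "t \<le> \<phi> (forget (snd (es ! i)))"
    then have "Beyond i AtRoot \<in> kept_points \<phi> t (PNode es)"
      by (simp add: iff)
    then show "\<exists>x. Beyond i x \<in> kept_points \<phi> t (PNode es)" ..
  qed
  assume "t \<le> \<phi> (forget (snd (es ! i)))"
  then show ?B unfolding iff by (auto simp: kept_points_def points_def)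
qed

lemma kept_OnEdge:
  assumes "i < length es"
  shows "OnEdge i s \<in> kept_points \<phi> t (PNode es) \<longleftrightarrow> 0 < s \<and> s < fst (es ! i) \<and>
    t \<le> \<phi> (Node {#(fst (es ! i) - s, forget (snd (es ! i)))#})"
  using assms by (auto simp: kept_points_def points_def)

text \<open>Shapes do not see the added lengths, and the case distinction of
  \<open>merge_edges\<close> between one lower edge and any other number is the one made by
  \<open>collapse\<close>.\<close>

lemma shape_forget_merge_edges:
  "shape (forget (merge_edges (PNode es))) =
     Node (mset (map (\<lambda>e. ((), collapse (root_edges (shape (forget (merge_edges (snd e))))))) es))"
proof -
  have *: "map_prod (\<lambda>_. ()) (shape \<circ> forget) (case root_edge_list (merge_edges (snd e)) of
       [(m, R)] \<Rightarrow> (fst e + m, R) | _ \<Rightarrow> (fst e, merge_edges (snd e)))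
     = ((), collapse (root_edges (shape (forget (merge_edges (snd e))))))" for e
  proof (cases "merge_edges (snd e)")
    case (PNode fs)
    consider "fs = []" | m R where "fs = [(m, R)]" | a b gs where "fs = a # b # gs"
      by (metis list.exhaust surj_pair)
    then show ?thesis
      using PNode by cases (auto simp: collapse_def shape_def)
  qed
  show ?thesis
    unfolding merge_edges.simps forget.simps shape_def tree.map
    using *[unfolded shape_def]
    by (simp add: multiset.map_comp comp_def prod.map_comp flip: mset_map)
qed

text \<open>An edge leaves one of three things, listed in \<open>G\<close>: the full edge with the
  pruned branch, a truncated edge ending in a leaf, or nothing. In the second case the lower end is
  not kept, so by \<open>retained_le\<close> no edge below it is retained and
  \<open>core_shape\<close> is a leaf as well.\<close>

lemma shape_pruned:
  assumes "forget P \<in> metric_trees"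
  shows "shape (forget (merge_edges (subtree (kept_points \<phi> t P) P))) =
    Node (retained_shapes \<phi> t (root_edges (forget P)))"
  using assms
proof (induction P)
  case (PNode es)
  define A where "A = kept_points \<phi> t (PNode es)"
  define G where "G e = (if t \<le> \<phi> (forget (snd e))
      then [(fst e, subtree (kept_points \<phi> t (snd e)) (snd e))]
      else if retained \<phi> t (fst e, forget (snd e))
      then [(Sup {s. 0 < s \<and> s < fst e \<and> t \<le> \<phi> (Node {#(fst e - s, forget (snd e))#})}, PNode [])]
      else [])" for e
  define H where "H e = ((), collapse (root_edges (shape (forget (merge_edges (snd e))))))"
    for e :: "real \<times> real plane_tree"
  have G: "(if \<exists>x. Beyond i x \<in> A then [(fst (es ! i), subtree {x. Beyond i x \<in> A} (snd (es ! i)))]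
     else if \<exists>s. OnEdge i s \<in> A then [(Sup {s. OnEdge i s \<in> A}, PNode [])]
     else []) = G (es ! i)" if "i < length es" for i
    using kept_Beyond[OF PNode.prems that]
    by (auto simp: A_def G_def kept_OnEdge[OF that] retained_def)
  have "map (\<lambda>i. if \<exists>x. Beyond i x \<in> A
       then [(fst (es ! i), subtree {x. Beyond i x \<in> A} (snd (es ! i)))]
       else if \<exists>s. OnEdge i s \<in> A then [(Sup {s. OnEdge i s \<in> A}, PNode [])]
       else []) [0..<length es] = map (\<lambda>i. G (es ! i)) [0..<length es]"
    by (rule map_cong[OF refl], rule G) simp
  also have "\<dots> = map G es"
    by (rule nth_equalityI) auto
  finally have sub: "subtree A (PNode es) = PNode (concat (map G es))"
    by simp
  have GH: "map H (G e) = (if retained \<phi> t (fst e, forget (snd e))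
      then [((), core_shape \<phi> t (forget (snd e)))] else [])" if e: "e \<in> set es" for e
  proof -
    have e': "(fst e, forget (snd e)) \<in># mset (map (map_prod id forget) es)"
      using e by (rule forget_edge)
    then have m: "Node {#(fst e, forget (snd e))#} \<in> metric_trees"
      using PNode.prems by (auto simp: metric_trees_Node)
    then have m': "forget (snd e) \<in> metric_trees"
      by (auto simp: metric_trees_Node)
    obtain E where E: "forget (snd e) = Node E" by (cases "forget (snd e)")
    show ?thesis
    proof (cases "t \<le> \<phi> (forget (snd e))")
      case True
      have "shape (forget (merge_edges (subtree (kept_points \<phi> t (snd e)) (snd e)))) =
          Node (retained_shapes \<phi> t E)"
        using PNode.IH[of e "snd e"] e m' E by (auto simp: snds.simps)
      then show ?thesis
        using True retained_stemI[OF m True] E by (simp add: G_def H_def core_shape_Node)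
    next
      case False
      then have "\<not> retained \<phi> t e" if "e \<in># E" for e
        using retained_le[of E e] m' that E by auto
      then have "retained_shapes \<phi> t E = {#}"
        by (auto simp: retained_shapes_def filter_mset_eq_conv)
      then show ?thesis
        using False E by (simp add: G_def H_def core_shape_Node collapse_def shape_def)
    qed
  qed
  \<comment> \<open>Stated for sublists so that the induction can run while \<open>GH\<close> stays
    tied to the edges of \<open>es\<close>.\<close>
  have "mset (map H (concat (map G fs))) =
      retained_shapes \<phi> t (mset (map (map_prod id forget) fs))" if "set fs \<subseteq> set es" for fs
    using that by (induction fs) (auto simp: GH retained_shapes_def map_prod_def)
  then show ?case
    using sub unfolding A_def[symmetric] shape_forget_merge_edges[folded H_def] sub
    by simp
qed

text \<open>\<open>shape_pruned\<close> has the same right-hand side for every plane representative,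
  so the arbitrary choice made by \<open>prune\<close> does no harm.\<close>

lemma shape_prune:
  assumes "Node E \<in> metric_trees"
  shows "shape (prune \<phi> t (Node E)) = Node (retained_shapes \<phi> t E)"
proof -
  have "forget (SOME P. forget P = Node E) = Node E"
    by (rule someI_ex) (rule forget_surj)
  then show ?thesis
    using shape_pruned[of "SOME P. forget P = Node E"] assms by (simp add: prune_def Let_def)
qed

lemma shape_prune_stem:
  assumes "Node {#(l, S)#} \<in> metric_trees"
  shows "shape (prune \<phi> t (Node {#(l, S)#})) =
    (if retained \<phi> t (l, S) then Node {#((), core_shape \<phi> t S)#} else empty_tree)"
  using shape_prune[OF assms] by (simp add: retained_shapes_def empty_tree_def)

end

lemma shape_eq_empty_tree_iff: "shape T = empty_tree \<longleftrightarrow> T = empty_tree"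
  by (cases T) (simp add: shape_def empty_tree_def)

section \<open>Genealogies and measurability\<close>

lemma genealogy_iff:
  "genealogy c l u S \<longleftrightarrow> (\<exists>Sf. (\<forall>i<c u. genealogy c l (u @ [i]) (Sf i)) \<and>
     S = Node (mset (map (\<lambda>i. (l (u @ [i]), Sf i)) [0..<c u])))"
  by (subst genealogy.simps) blast

lemma genealogy_unique:
  assumes "genealogy c l u S" "genealogy c l u S'"
  shows "S = S'"
  using assms
proof (induction arbitrary: S' rule: genealogy.induct)
  case (1 u S)
  from 1(3) obtain Sf where "\<forall>i<c u. genealogy c l (u @ [i]) (Sf i)"
      "S' = Node (mset (map (\<lambda>i. (l (u @ [i]), Sf i)) [0..<c u]))"
    using genealogy_iff[of c l u S'] by blast
  then show ?case
    using 1(2) by (auto intro!: image_mset_cong)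
qed

lemma genealogy_relabel:
  assumes "genealogy c l u S"
  shows "\<exists>S'. genealogy c l' u S'"
  using assms
proof induction
  case (1 u S)
  then obtain Sf where "\<forall>i<c u. genealogy c l' (u @ [i]) (Sf i)" by metis
  then show ?case using genealogy.intros by blast
qed

lemma genealogy_map_tree:
  assumes "genealogy c (\<lambda>v. v) u A"
  shows "genealogy c l u (map_tree l A)"
  using assms
proof induction
  case (1 u A)
  have "genealogy c l u (Node (mset (map (\<lambda>i. (l (u @ [i]), map_tree l (A i))) [0..<c u])))"
    by (rule genealogy.intros) (use 1 in auto)
  then show ?case by (simp add: multiset.map_comp comp_def flip: mset_map)
qed

text \<open>Labelling each edge by the address of its lower end separates the two sources of
  randomness: \<open>A\<close> depends on the numbers of children alone, and the edge labels enter
  afterwards through \<open>map_tree\<close>.\<close>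

lemma genealogy_iff_addresses:
  "genealogy c l u S \<longleftrightarrow> (\<exists>A. genealogy c (\<lambda>v. v) u A \<and> S = map_tree l A)"
  using genealogy_map_tree genealogy_relabel genealogy_unique by metis

lemma genealogy_append:
  "genealogy c l (u @ v) S \<longleftrightarrow> genealogy (\<lambda>w. c (u @ w)) (\<lambda>w. l (u @ w)) v S"
proof
  show "genealogy (\<lambda>w. c (u @ w)) (\<lambda>w. l (u @ w)) v S" if "genealogy c l (u @ v) S"
    using that
  proof (induction "u @ v" S arbitrary: v)
    case (1 S)
    show ?case
      using genealogy.intros[of "\<lambda>w. c (u @ w)" v "\<lambda>w. l (u @ w)" S] 1 by simp
  qed
  show "genealogy c l (u @ v) S" if "genealogy (\<lambda>w. c (u @ w)) (\<lambda>w. l (u @ w)) v S"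
    using that
  proof (induction rule: genealogy.induct)
    case (1 v S)
    show ?case
      using genealogy.intros[of c "u @ v" l S] 1 by simp
  qed
qed

lemma genealogy_Nil:
  "genealogy c l [] S \<longleftrightarrow>
     (\<exists>Sf. (\<forall>i<c []. genealogy (\<lambda>v. c (i # v)) (\<lambda>v. l (i # v)) [] (Sf i)) \<and>
       S = Node (mset (map (\<lambda>i. (l [i], Sf i)) [0..<c []])))"
  using genealogy_append[of c l "[i]" "[]" for i] by (subst genealogy_iff) simp

text \<open>A finite tree inspects the offspring numbers at finitely many addresses only. They are
  recorded with their values in \<open>xs\<close>, so the event of seeing a given tree is a union of
  finite-dimensional conditions.\<close>

lemma genealogy_profile:
  assumes "genealogy c l u S"
  shows "\<exists>xs. (\<forall>(v, k) \<in> set xs. c v = k) \<and>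
    (\<forall>c'. (\<forall>(v, k) \<in> set xs. c' v = k) \<longrightarrow> genealogy c' l u S)"
  using assms
proof induction
  case (1 u S)
  then obtain xs where xs: "\<And>i. i < c u \<Longrightarrow> (\<forall>(v, k) \<in> set (xs i). c v = k) \<and>
    (\<forall>c'. (\<forall>(v, k) \<in> set (xs i). c' v = k) \<longrightarrow> genealogy c' l (u @ [i]) (S i))"
    by metis
  define ys where "ys = (u, c u) # concat (map xs [0..<c u])"
  have "\<forall>(v, k) \<in> set ys. c v = k"
    using xs by (auto simp: ys_def)
  moreover have "genealogy c' l u (Node (mset (map (\<lambda>i. (l (u @ [i]), S i)) [0..<c u])))"
    if c': "\<forall>(v, k) \<in> set ys. c' v = k" for c'
  proof -
    have u: "c' u = c u" using c' by (simp add: ys_def)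
    have "genealogy c' l (u @ [i]) (S i)" if "i < c' u" for i
      using xs[of i] that u c' by (auto simp: ys_def)
    then have "genealogy c' l u (Node (mset (map (\<lambda>i. (l (u @ [i]), S i)) [0..<c' u])))"
      by (rule genealogy.intros)
    then show ?thesis by (simp add: u)
  qed
  ultimately show ?case by blast
qed

section \<open>Countably many address trees carry all measurability questions\<close>

definition address_trees :: "nat list tree set" where
  "address_trees = {A. \<exists>c. genealogy c (\<lambda>v. v) [] A}"

text \<open>The constraint list of a tree determines it: some \<open>c\<close> satisfies the list,
  and every such \<open>c\<close> produces that tree. Finite lists of this type are
  countable.\<close>

lemma countable_address_trees: "countable address_trees"
proof -
  have "\<forall>A \<in> address_trees. \<exists>xs. (\<exists>c. \<forall>(v, k) \<in> set xs. c v = k) \<and>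
    (\<forall>c. (\<forall>(v, k) \<in> set xs. c v = k) \<longrightarrow> genealogy c (\<lambda>v. v) [] A)"
    unfolding address_trees_def using genealogy_profile by blast
  then obtain f where f: "\<And>A. A \<in> address_trees \<Longrightarrow> (\<exists>c. \<forall>(v, k) \<in> set (f A). c v = k) \<and>
    (\<forall>c. (\<forall>(v, k) \<in> set (f A). c v = k) \<longrightarrow> genealogy c (\<lambda>v. v) [] A)"
    by metis
  have "inj_on f address_trees"
    by (rule inj_onI) (metis f genealogy_unique)
  then show ?thesis
    by (rule countableI')
qed

lemma sets_genealogy_address:
  assumes "\<And>u. (\<lambda>\<omega>. C \<omega> u) \<in> measurable M (count_space (UNIV :: nat set))"
  shows "{\<omega> \<in> space M. genealogy (C \<omega>) (\<lambda>v. v) [] A} \<in> sets M"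
proof -
  define X where "X = {xs. \<forall>c'. (\<forall>(v, k) \<in> set xs. c' v = k) \<longrightarrow> genealogy c' (\<lambda>v. v) [] A}"
  have "{\<omega> \<in> space M. genealogy (C \<omega>) (\<lambda>v. v) [] A} =
    (\<Union>xs\<in>X. {\<omega> \<in> space M. \<forall>e \<in> set xs. C \<omega> (fst e) = snd e})"
  proof (intro set_eqI iffI)
    fix \<omega> assume \<omega>: "\<omega> \<in> {\<omega> \<in> space M. genealogy (C \<omega>) (\<lambda>v. v) [] A}"
    then obtain xs where "xs \<in> X" "\<forall>(v, k) \<in> set xs. C \<omega> v = k"
      using genealogy_profile[of "C \<omega>" "\<lambda>v. v" "[]" A] unfolding X_def by blast
    then show "\<omega> \<in> (\<Union>xs\<in>X. {\<omega> \<in> space M. \<forall>e \<in> set xs. C \<omega> (fst e) = snd e})"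
      using \<omega> by (intro UN_I[of xs]) auto
  next
    fix \<omega> assume "\<omega> \<in> (\<Union>xs\<in>X. {\<omega> \<in> space M. \<forall>e \<in> set xs. C \<omega> (fst e) = snd e})"
    then obtain xs where xs: "xs \<in> X" "\<omega> \<in> space M" "\<forall>e \<in> set xs. C \<omega> (fst e) = snd e"
      by blast
    then have "\<forall>(v, k) \<in> set xs. C \<omega> v = k" by auto
    then show "\<omega> \<in> {\<omega> \<in> space M. genealogy (C \<omega>) (\<lambda>v. v) [] A}"
      using xs(1,2) by (simp add: X_def)
  qed
  moreover have "{\<omega> \<in> space M. \<forall>e \<in> set xs. C \<omega> (fst e) = snd e} \<in> sets M" for xs
  proof (rule sets.sets_Collect_countable_Ball)
    fix e :: "nat list \<times> nat"
    show "{\<omega> \<in> space M. C \<omega> (fst e) = snd e} \<in> sets M"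
      using measurable_sets[OF assms[of "fst e"], of "{snd e}"]
      by (simp add: vimage_def Int_def conj_commute)
  qed
  ultimately show ?thesis
    by (auto intro!: sets.countable_UN')
qed

text \<open>Metric trees are uncountable, but the existential can be moved to the countable set of
  address trees, with the random labels substituted into each of them.\<close>

lemma sets_ex_genealogy:
  assumes C: "\<And>u. (\<lambda>\<omega>. C \<omega> u) \<in> measurable M (count_space (UNIV :: nat set))"
    and P: "\<And>A. A \<in> address_trees \<Longrightarrow> {\<omega> \<in> space M. P \<omega> (map_tree (L \<omega>) A)} \<in> sets M"
  shows "{\<omega> \<in> space M. \<exists>S. genealogy (C \<omega>) (L \<omega>) [] S \<and> P \<omega> S} \<in> sets M"
proof -
  have "{\<omega> \<in> space M. \<exists>S. genealogy (C \<omega>) (L \<omega>) [] S \<and> P \<omega> S} =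
    (\<Union>A\<in>address_trees. {\<omega> \<in> space M. genealogy (C \<omega>) (\<lambda>v. v) [] A} \<inter>
       {\<omega> \<in> space M. P \<omega> (map_tree (L \<omega>) A)})"
    unfolding address_trees_def by (subst genealogy_iff_addresses) blast
  also have "\<dots> \<in> sets M"
    by (intro sets.countable_UN' countable_address_trees)
       (auto intro!: sets.Int sets_genealogy_address C P)
  finally show ?thesis .
qed

lemma reduced_map_tree: "reduced (map_tree f A) \<longleftrightarrow> reduced A"
proof (induction A)
  case (Node E)
  have "size (root_edges (map_tree f S)) = size (root_edges S)" for S
    by (cases S) simp
  moreover have "reduced (map_tree f S) \<longleftrightarrow> reduced S" if "(l, S) \<in># E" for l S
    using Node that by fastforce
  ultimately show ?case
    by (subst (1 2) reduced.simps) fastforce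
qed

lemma shape_map_tree: "shape (map_tree f A) = map_tree (\<lambda>_. ()) A"
  by (simp add: shape_def tree.map_comp comp_def)

section \<open>Measurability of the Galton-Watson tree with edge lengths\<close>

definition metric_tree_generators :: "metric_tree set set" where
  "metric_tree_generators = {A. A \<subseteq> metric_trees \<and>
     (\<forall>c. {l. \<exists>S \<in> A. genealogy c l [] S} \<in> sets (\<Pi>\<^sub>M u\<in>(UNIV :: nat list set). (borel :: real measure)))}"

lemma metric_tree_space_eq: "metric_tree_space = sigma metric_trees metric_tree_generators"
  by (simp add: metric_tree_space_def metric_tree_generators_def)

lemma generators_Pow: "metric_tree_generators \<subseteq> Pow metric_trees"
  by (auto simp: metric_tree_generators_def)

lemma space_metric_tree_space [simp]: "space metric_tree_space = metric_trees"
  by (simp add: metric_tree_space_eq space_measure_of[OF generators_Pow])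

text \<open>For fixed \<open>c\<close> there is at most one address tree, so the shape is already
  decided, and what remains of the condition on \<open>l\<close> is positivity at the addresses in
  that tree.\<close>

lemma shape_generators: "{T \<in> metric_trees. shape T \<in> B} \<in> metric_tree_generators"
proof -
  have "{l. \<exists>S \<in> {T \<in> metric_trees. shape T \<in> B}. genealogy c l [] S}
      \<in> sets (\<Pi>\<^sub>M u\<in>UNIV. borel)" (is "?L \<in> _") for c :: "nat list \<Rightarrow> nat"
  proof (cases "\<exists>A. genealogy c (\<lambda>v. v) [] A \<and> reduced A \<and> map_tree (\<lambda>_. ()) A \<in> B")
    case False
    then have "?L = {}"
      by (subst genealogy_iff_addresses) (auto simp: shape_map_tree metric_trees_def reduced_map_tree)
    then show ?thesis by simp
  next
    case True
    then obtain A where A: "genealogy c (\<lambda>v. v) [] A" "reduced A" "map_tree (\<lambda>_. ()) A \<in> B"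
      by blast
    have "?L = {l \<in> space (\<Pi>\<^sub>M u\<in>UNIV. borel). \<forall>u \<in> set_tree A. 0 < l u}"
    proof (intro set_eqI iffI)
      fix l assume "l \<in> ?L"
      then obtain A' where A': "genealogy c (\<lambda>v. v) [] A'" "map_tree l A' \<in> metric_trees"
        using genealogy_iff_addresses[of c l "[]"] by auto
      then have "A' = A" using A(1) genealogy_unique by blast
      then show "l \<in> {l \<in> space (\<Pi>\<^sub>M u\<in>UNIV. borel). \<forall>u \<in> set_tree A. 0 < l u}"
        using A' by (auto simp: metric_trees_def tree.set_map space_PiM)
    next
      fix l :: "nat list \<Rightarrow> real"
      assume "l \<in> {l \<in> space (\<Pi>\<^sub>M u\<in>UNIV. borel). \<forall>u \<in> set_tree A. 0 < l u}"
      then have "map_tree l A \<in> {T \<in> metric_trees. shape T \<in> B}"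
        using A by (auto simp: metric_trees_def tree.set_map shape_map_tree reduced_map_tree)
      then show "l \<in> ?L" using genealogy_map_tree[OF A(1)] by blast
    qed
    also have "\<dots> \<in> sets (\<Pi>\<^sub>M u\<in>UNIV. borel)"
      by (rule sets.sets_Collect_countable_Ball) auto
    finally show ?thesis .
  qed
  then show ?thesis
    by (auto simp: metric_tree_generators_def)
qed

lemma sets_shape: "{T \<in> metric_trees. shape T \<in> B} \<in> sets metric_tree_space"
  using shape_generators by (simp add: metric_tree_space_eq sets_measure_of[OF generators_Pow])

lemma metric_trees_generators: "metric_trees \<in> metric_tree_generators"
  using shape_generators[of UNIV] by simp

definition metric_gw_tree :: "(nat list \<Rightarrow> nat) \<Rightarrow> (nat list \<Rightarrow> real) \<Rightarrow> metric_tree" where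
  "metric_gw_tree c l =
     (let T = galton_watson_tree c l in if T \<in> metric_trees then T else empty_tree)"

lemma galton_watson_tree_eq:
  assumes "genealogy c l [] S"
  shows "galton_watson_tree c l = Node {#(l [], S)#}"
proof -
  have "(THE S. genealogy c l [] S) = S"
    using assms genealogy_unique by (intro the_equality) blast+
  then show ?thesis using assms by (auto simp: galton_watson_tree_def)
qed

lemma empty_tree_metric: "empty_tree \<in> metric_trees"
  unfolding empty_tree_def metric_trees_def by (subst reduced.simps) simp

text \<open>Resolves the two default values, both \<open>empty_tree\<close>, into an existential
  statement of the kind treated by \<open>sets_ex_genealogy\<close> and the negation of one.\<close>

lemma metric_gw_tree_iff:
  "metric_gw_tree c l \<in> X \<longleftrightarrow>
     (\<exists>S. genealogy c l [] S \<and> Node {#(l [], S)#} \<in> X \<inter> metric_trees) \<or>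
     empty_tree \<in> X \<and> \<not> (\<exists>S. genealogy c l [] S \<and> Node {#(l [], S)#} \<in> metric_trees)"
proof (cases "\<exists>S. genealogy c l [] S")
  case True
  then obtain S where S: "genealogy c l [] S" by blast
  then have ex: "(\<exists>S'. genealogy c l [] S' \<and> P S') \<longleftrightarrow> P S" for P
    using genealogy_unique by blast
  show ?thesis
    unfolding ex metric_gw_tree_def galton_watson_tree_eq[OF S] Let_def
    by auto
next
  case False
  then show ?thesis
    by (simp add: metric_gw_tree_def galton_watson_tree_def Let_def)
qed

lemma sets_metric_gw_tree_generators:
  assumes C: "\<And>u. (\<lambda>\<omega>. C \<omega> u) \<in> measurable M (count_space (UNIV :: nat set))"
    and L: "\<And>u. (\<lambda>\<omega>. L \<omega> u) \<in> borel_measurable M"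
    and X: "X \<in> metric_tree_generators"
  shows "{\<omega> \<in> space M. \<exists>S. genealogy (C \<omega>) (L \<omega>) [] S \<and> Node {#(L \<omega> [], S)#} \<in> X} \<in> sets M"
proof (rule sets_ex_genealogy[OF C])
  fix A assume "A \<in> address_trees"
  then obtain c where c: "genealogy c (\<lambda>v. v) [] A" by (auto simp: address_trees_def)
  \<comment> \<open>The generators test the tree below an individual, without its stem. An
    additional ancestor with a single child turns the stem into an ordinary edge; the label
    \<open>0\<close> is a filler at the address of that ancestor.\<close>
  define c' where "c' = case_list (1 :: nat) (\<lambda>_. c)"
  define l' where "l' \<omega> = case_list 0 (\<lambda>(_ :: nat). L \<omega>)" for \<omega>
  have gen: "genealogy c' (l' \<omega>) [] S \<longleftrightarrow> S = Node {#(L \<omega> [], map_tree (L \<omega>) A)#}" for S \<omega>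
  proof -
    have "genealogy c (L \<omega>) [] S' \<longleftrightarrow> S' = map_tree (L \<omega>) A" for S'
      using genealogy_map_tree[OF c, of "L \<omega>"] genealogy_unique by blast
    then show ?thesis
      by (subst genealogy_Nil) (auto simp: c'_def l'_def)
  qed
  have l': "l' \<in> measurable M (\<Pi>\<^sub>M u\<in>UNIV. borel)"
  proof (rule measurable_PiM_single')
    show "(\<lambda>\<omega>. l' \<omega> u) \<in> borel_measurable M" for u
      using L by (cases u) (auto simp: l'_def)
  qed auto
  have "{l. \<exists>S \<in> X. genealogy c' l [] S} \<in> sets (\<Pi>\<^sub>M u\<in>UNIV. borel)"
    using X by (auto simp: metric_tree_generators_def)
  from measurable_sets[OF l' this]
  show "{\<omega> \<in> space M. Node {#(L \<omega> [], map_tree (L \<omega>) A)#} \<in> X} \<in> sets M"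
    by (simp add: gen vimage_def Int_def conj_commute)
qed

lemma measurable_metric_gw_tree:
  assumes C: "\<And>u. (\<lambda>\<omega>. C \<omega> u) \<in> measurable M (count_space (UNIV :: nat set))"
    and L: "\<And>u. (\<lambda>\<omega>. L \<omega> u) \<in> borel_measurable M"
  shows "(\<lambda>\<omega>. metric_gw_tree (C \<omega>) (L \<omega>)) \<in> measurable M metric_tree_space"
  unfolding metric_tree_space_eq
proof (rule measurable_measure_of[OF generators_Pow])
  show "(\<lambda>\<omega>. metric_gw_tree (C \<omega>) (L \<omega>)) \<in> space M \<rightarrow> metric_trees"
    using empty_tree_metric by (auto simp: metric_gw_tree_def Let_def)
  fix X assume X: "X \<in> metric_tree_generators"
  then have "X \<subseteq> metric_trees" by (auto simp: metric_tree_generators_def)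
  then have "X \<inter> metric_trees = X" by auto
  then have "(\<lambda>\<omega>. metric_gw_tree (C \<omega>) (L \<omega>)) -` X \<inter> space M =
    {\<omega> \<in> space M. \<exists>S. genealogy (C \<omega>) (L \<omega>) [] S \<and> Node {#(L \<omega> [], S)#} \<in> X} \<union>
    (if empty_tree \<in> X then space M -
       {\<omega> \<in> space M. \<exists>S. genealogy (C \<omega>) (L \<omega>) [] S \<and> Node {#(L \<omega> [], S)#} \<in> metric_trees} else {})"
    by (auto simp: metric_gw_tree_iff[of _ _ X])
  also have "\<dots> \<in> sets M"
    using sets_metric_gw_tree_generators[OF C L] X metric_trees_generators by auto
  finally show "(\<lambda>\<omega>. metric_gw_tree (C \<omega>) (L \<omega>)) -` X \<inter> space M \<in> sets M" .
qed

section \<open>Independence of the subtrees of a Galton-Watson tree\<close>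

lemma indep_vars_PiM_coordinates:
  fixes N :: "'a measure"
  assumes N: "prob_space N"
  shows "prob_space.indep_vars (\<Pi>\<^sub>M u\<in>(UNIV :: 'i set). N) (\<lambda>_. N) (\<lambda>u w. w u) UNIV"
proof -
  interpret P: prob_space "\<Pi>\<^sub>M u\<in>(UNIV :: 'i set). N"
    by (intro prob_space_PiM N)
  have "distr (\<Pi>\<^sub>M u\<in>(UNIV :: 'i set). N) N (\<lambda>w. w u) = N" for u
    using distr_PiM_component[of UNIV "\<lambda>_. N" u] N by simp
  then show ?thesis
    by (subst P.indep_vars_iff_distr_eq_PiM) (auto simp: restrict_def)
qed

text \<open>\<open>GW_metric\<close> draws offspring numbers and lengths from two separate products,
  while the branching argument wants one independent pair per individual. The two descriptions agree
  on cylinders: for given \<open>c\<close> the coordinates of \<open>l\<close> factorize, and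
  integration over \<open>c\<close> factorizes next.\<close>

lemma PiM_pair_eq_distr:
  fixes A :: "'a measure" and B :: "'b measure"
  assumes A: "prob_space A" and B: "prob_space B"
  shows "(\<Pi>\<^sub>M u\<in>(UNIV :: 'i set). A \<Otimes>\<^sub>M B) =
    distr ((\<Pi>\<^sub>M u\<in>UNIV. A) \<Otimes>\<^sub>M (\<Pi>\<^sub>M u\<in>UNIV. B)) (\<Pi>\<^sub>M u\<in>UNIV. A \<Otimes>\<^sub>M B)
      (\<lambda>(c, l) u. (c u, l u))"
proof (rule measure_eqI_PiM_infinite[OF refl])
  interpret A: prob_space A by fact
  interpret B: prob_space B by fact
  interpret AB: pair_prob_space A B ..
  interpret PA: prob_space "\<Pi>\<^sub>M u\<in>(UNIV :: 'i set). A" by (intro prob_space_PiM A)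
  interpret PB: prob_space "\<Pi>\<^sub>M u\<in>(UNIV :: 'i set). B" by (intro prob_space_PiM B)
  interpret PAB: prob_space "\<Pi>\<^sub>M u\<in>(UNIV :: 'i set). A \<Otimes>\<^sub>M B"
    by (intro prob_space_PiM) unfold_locales
  show "finite_measure (\<Pi>\<^sub>M u\<in>(UNIV :: 'i set). A \<Otimes>\<^sub>M B)" by unfold_locales
  fix D :: "'i \<Rightarrow> ('a \<times> 'b) set" and J
  assume J: "finite J" and D: "\<And>u. u \<in> J \<Longrightarrow> D u \<in> sets (A \<Otimes>\<^sub>M B)"
  let ?Z = "\<lambda>(c :: 'i \<Rightarrow> 'a, l :: 'i \<Rightarrow> 'b) u. (c u, l u)"
  let ?E = "prod_emb UNIV (\<lambda>_. A \<Otimes>\<^sub>M B) J (Pi\<^sub>E J D)"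
  have Z: "?Z \<in> measurable ((\<Pi>\<^sub>M u\<in>UNIV. A) \<Otimes>\<^sub>M (\<Pi>\<^sub>M u\<in>UNIV. B)) (\<Pi>\<^sub>M u\<in>UNIV. A \<Otimes>\<^sub>M B)"
    by (rule measurable_PiM_single') (auto simp: split_beta' space_pair_measure space_PiM PiE_iff)
  have E: "?E \<in> sets (\<Pi>\<^sub>M u\<in>UNIV. A \<Otimes>\<^sub>M B)"
    using J D by (intro sets_PiM_I) auto
  have h: "(\<lambda>x. emeasure B (Pair x -` D u)) \<in> borel_measurable A" if "u \<in> J" for u
    using D[OF that] by (rule B.measurable_emeasure_Pair)
  have inner: "emeasure (\<Pi>\<^sub>M u\<in>UNIV. B) (Pair c -` (?Z -` ?E \<inter> space ((\<Pi>\<^sub>M u\<in>UNIV. A) \<Otimes>\<^sub>M (\<Pi>\<^sub>M u\<in>UNIV. B))))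
      = (\<Prod>u\<in>J. emeasure B (Pair (c u) -` D u))" if c: "c \<in> space (\<Pi>\<^sub>M u\<in>UNIV. A)" for c
  proof -
    have "Pair c -` (?Z -` ?E \<inter> space ((\<Pi>\<^sub>M u\<in>UNIV. A) \<Otimes>\<^sub>M (\<Pi>\<^sub>M u\<in>UNIV. B))) =
        prod_emb UNIV (\<lambda>_. B) J (\<Pi>\<^sub>E u\<in>J. Pair (c u) -` D u)"
      using c by (auto simp: prod_emb_def space_pair_measure space_PiM PiE_iff)
    also have "emeasure (\<Pi>\<^sub>M u\<in>UNIV. B) \<dots> = (\<Prod>u\<in>J. emeasure B (Pair (c u) -` D u))"
      using J D by (intro emeasure_PiM_emb B) (auto intro: sets_Pair1)
    finally show ?thesis .
  qed
  have ind: "PA.indep_vars (\<lambda>_. borel) (\<lambda>u c. emeasure B (Pair (c u) -` D u)) J"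
    using PA.indep_vars_subset[OF indep_vars_PiM_coordinates[OF A], of J] h
    by (intro PA.indep_vars_compose2[where Y = "\<lambda>u x. emeasure B (Pair x -` D u)"]) auto
  have "emeasure (distr ((\<Pi>\<^sub>M u\<in>UNIV. A) \<Otimes>\<^sub>M (\<Pi>\<^sub>M u\<in>UNIV. B)) (\<Pi>\<^sub>M u\<in>UNIV. A \<Otimes>\<^sub>M B) ?Z) ?E =
      (\<integral>\<^sup>+c. (\<Prod>u\<in>J. emeasure B (Pair (c u) -` D u)) \<partial>(\<Pi>\<^sub>M u\<in>UNIV. A))"
    unfolding emeasure_distr[OF Z E]
    by (subst PB.emeasure_pair_measure_alt[OF measurable_sets[OF Z E]])
       (intro nn_integral_cong inner)
  also have "\<dots> = (\<Prod>u\<in>J. \<integral>\<^sup>+c. emeasure B (Pair (c u) -` D u) \<partial>(\<Pi>\<^sub>M u\<in>UNIV. A))"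
    by (rule PA.indep_vars_nn_integral[OF J ind]) simp
  also have "\<dots> = (\<Prod>u\<in>J. emeasure (A \<Otimes>\<^sub>M B) (D u))"
  proof (rule prod.cong[OF refl])
    fix u assume u: "u \<in> J"
    have "(\<integral>\<^sup>+c. emeasure B (Pair (c u) -` D u) \<partial>(\<Pi>\<^sub>M u\<in>UNIV. A)) =
        (\<integral>\<^sup>+x. emeasure B (Pair x -` D u) \<partial>(distr (\<Pi>\<^sub>M u\<in>UNIV. A) A (\<lambda>c. c u)))"
      using h[OF u] by (subst nn_integral_distr) auto
    also have "\<dots> = emeasure (A \<Otimes>\<^sub>M B) (D u)"
      using D[OF u] A by (subst distr_PiM_component) (auto simp: B.emeasure_pair_measure_alt)
    finally show "(\<integral>\<^sup>+c. emeasure B (Pair (c u) -` D u) \<partial>(\<Pi>\<^sub>M u\<in>UNIV. A)) =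
        emeasure (A \<Otimes>\<^sub>M B) (D u)" .
  qed
  also have "\<dots> = emeasure (\<Pi>\<^sub>M u\<in>UNIV. A \<Otimes>\<^sub>M B) ?E"
    using J D by (intro emeasure_PiM_emb[symmetric]) (auto intro: AB.prob_space_axioms)
  finally show "emeasure (\<Pi>\<^sub>M u\<in>UNIV. A \<Otimes>\<^sub>M B) ?E =
    emeasure (distr ((\<Pi>\<^sub>M u\<in>UNIV. A) \<Otimes>\<^sub>M (\<Pi>\<^sub>M u\<in>UNIV. B)) (\<Pi>\<^sub>M u\<in>UNIV. A \<Otimes>\<^sub>M B) ?Z) ?E" ..
qed simp

text \<open>The data seen from child \<open>i\<close>. Since \<open>shift i w [] = w [i]\<close>, a
  child takes along the edge above it.\<close>

definition shift :: "nat \<Rightarrow> (nat list \<Rightarrow> 'a) \<Rightarrow> nat list \<Rightarrow> 'a" where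
  "shift i w v = w (i # v)"

text \<open>The probability that exactly \<open>j\<close> children are not lost if each child is lost
  independently with probability \<open>x\<close>, divided by \<open>(1 - x) ^ j\<close>.\<close>

definition thinned :: "nat pmf \<Rightarrow> nat \<Rightarrow> real \<Rightarrow> real" where
  "thinned q j x = (\<Sum>k. pmf q k * real (k choose j) * x ^ (k - j))"

lemma binomial_term_le:
  assumes "0 \<le> x" "x \<le> 1"
  shows "real (k choose j) * x ^ (k - j) * (1 - x) ^ j \<le> 1"
proof (cases "j \<le> k")
  case True
  have "real (k choose j) * (1 - x) ^ j * x ^ (k - j) \<le>
      (\<Sum>i\<le>k. real (k choose i) * (1 - x) ^ i * x ^ (k - i))"
    using assms True by (intro member_le_sum) auto
  also have "\<dots> = 1"
    by (subst binomial_ring[symmetric]) simp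
  finally show ?thesis by (simp add: mult_ac)
qed (simp add: binomial_eq_0)

lemma sums_pmf_nat: "pmf q sums (1 :: real)" for q :: "nat pmf"
proof -
  have "(\<lambda>i. measure q {i}) sums measure q (\<Union>i. {i})"
    by (rule measure_pmf.finite_measure_UNION) (auto simp: disjoint_family_on_def)
  then show ?thesis by (simp add: pmf.rep_eq UNION_singleton_eq_range)
qed

lemma summable_thinned:
  assumes "0 \<le> x" "x < 1"
  shows "summable (\<lambda>k. pmf q k * real (k choose j) * x ^ (k - j))"
proof (rule summable_comparison_test')
  show "summable (\<lambda>k. pmf q k * (1 / (1 - x) ^ j))"
    using sums_pmf_nat by (intro summable_mult2) (auto simp: sums_iff)
  fix k
  have "real (k choose j) * x ^ (k - j) \<le> 1 / (1 - x) ^ j"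
    using binomial_term_le[of x k j] assms by (simp add: field_simps)
  then have "pmf q k * (real (k choose j) * x ^ (k - j)) \<le> pmf q k * (1 / (1 - x) ^ j)"
    by (intro mult_left_mono) auto
  then show "norm (pmf q k * real (k choose j) * x ^ (k - j)) \<le> pmf q k * (1 / (1 - x) ^ j)"
    using assms by (simp add: abs_mult mult_ac)
qed

text \<open>\<open>N\<close> is the law of the data of one individual, from which \<kappa> reads the
  number of children. The locale serves both \<open>GW\<close>, with \<open>measure_pmf q\<close>
  and \<open>id\<close>, and the metric tree, with pairs of a number and a length.\<close>

locale branching = prob_space N for N :: "'a measure" +
  fixes \<kappa> :: "'a \<Rightarrow> nat" and q :: "nat pmf"
  assumes space_N [simp]: "space N = UNIV"
    and \<kappa> [measurable]: "\<kappa> \<in> measurable N (count_space UNIV)"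
    and prob_\<kappa>: "prob {x. \<kappa> x = k} = pmf q k"
begin

abbreviation W :: "(nat list \<Rightarrow> 'a) measure" where
  "W \<equiv> \<Pi>\<^sub>M u\<in>UNIV. N"

sublocale W: prob_space W
  by (intro prob_space_PiM prob_space_axioms)

lemma space_W [simp]: "space W = UNIV"
  by (simp add: space_PiM)

lemma measurable_shift [measurable]: "shift i \<in> measurable W W"
  by (rule measurable_PiM_single') (auto simp: shift_def)

lemma measurable_coordinate: "(\<lambda>w. w u) \<in> measurable W N"
  by simp

text \<open>Prefixing \<open>i\<close> is injective on addresses, and reading an i.i.d. family along
  an injection preserves its law.\<close>

lemma distr_shift: "distr W W (shift i) = W"
  using distr_PiM_reindex[of UNIV "\<lambda>_. N" "(#) i" UNIV] prob_space_axioms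
  by (simp add: shift_def[abs_def] restrict_def)

lemma AE_shift:
  assumes "AE w in W. P w"
  shows "AE w in W. \<forall>i. P (shift i w)"
  unfolding AE_all_countable
proof
  fix i
  have "AE w in distr W W (shift i). P w"
    using assms unfolding distr_shift .
  then show "AE w in W. P (shift i w)"
    by (rule AE_distrD[OF measurable_shift])
qed

lemma sets_shift: "D \<in> sets W \<Longrightarrow> {w. shift i w \<in> D} \<in> sets W"
  using measurable_sets[OF measurable_shift, of D i] by (simp add: vimage_def)

lemma prob_shift: "D \<in> sets W \<Longrightarrow> W.prob {w. shift i w \<in> D} = W.prob D"
  by (subst (2) distr_shift[symmetric, of i]) (simp add: measure_distr vimage_def)

lemma sets_root: "A \<in> sets N \<Longrightarrow> {w. w [] \<in> A} \<in> sets W"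
  using measurable_sets[OF measurable_coordinate, of A "[]"] by (simp add: vimage_def)

lemma prob_root:
  assumes "A \<in> sets N"
  shows "W.prob {w. w [] \<in> A} = prob A"
proof -
  have "distr W N (\<lambda>w. w []) = N"
    by (rule distr_PiM_component) (auto intro: prob_space_axioms)
  then have "prob A = measure (distr W N (\<lambda>w. w [])) A" by simp
  also have "\<dots> = W.prob {w. w [] \<in> A}"
    by (subst measure_distr[OF measurable_coordinate assms]) (simp add: vimage_def)
  finally show ?thesis ..
qed

lemma prob_branching:
  assumes A: "A \<in> sets N" and D: "\<And>i. i \<in> I \<Longrightarrow> D i \<in> sets W" and I: "finite I"
  shows "W.prob {w. w [] \<in> A \<and> (\<forall>i\<in>I. shift i w \<in> D i)} = prob A * (\<Prod>i\<in>I. W.prob (D i))"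
proof -
  \<comment> \<open>The addresses split into disjoint blocks, \<open>None\<close> for the individual
    itself and \<open>Some i\<close> for the line of child \<open>i\<close>; restrictions to
    disjoint blocks are independent.\<close>
  define K where "K = (\<lambda>j. case j of None \<Rightarrow> {[] :: nat list} | Some i \<Rightarrow> range ((#) i))"
  define J where "J = insert None (Some ` I)"
  define E where "E = (\<lambda>j. case j of
      None \<Rightarrow> {r \<in> space (PiM (K None) (\<lambda>_. N)). r [] \<in> A}
    | Some i \<Rightarrow> {r \<in> space (PiM (K (Some i)) (\<lambda>_. N)). (\<lambda>v. r (i # v)) \<in> D i})"
  define Y where "Y = (\<lambda>j (w :: nat list \<Rightarrow> 'a). restrict w (K j))"
  have "W.indep_vars (\<lambda>j. PiM (K j) (\<lambda>_. N)) (\<lambda>j w. restrict (\<lambda>u. w u) (K j)) UNIV"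
    by (rule W.indep_vars_restrict[OF indep_vars_PiM_coordinates[OF prob_space_axioms]])
       (auto simp: disjoint_family_on_def K_def split: option.splits)
  then have ind: "W.indep_vars (\<lambda>j. PiM (K j) (\<lambda>_. N)) Y J"
    unfolding Y_def by (rule W.indep_vars_subset) simp
  have E: "E j \<in> sets (PiM (K j) (\<lambda>_. N))" if "j \<in> J" for j
  proof (cases j)
    case None
    have "(\<lambda>r. r []) \<in> measurable (PiM (K None) (\<lambda>_. N)) N"
      by (rule measurable_component_singleton) (simp add: K_def)
    from measurable_sets[OF this A] show ?thesis
      by (simp add: None E_def vimage_def Int_def conj_commute)
  next
    case (Some i)
    then have i: "i \<in> I" using that by (auto simp: J_def)
    have "(\<lambda>r v. r (i # v)) \<in> measurable (PiM (K (Some i)) (\<lambda>_. N)) W"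
      by (rule measurable_PiM_single') (auto simp: K_def intro!: measurable_component_singleton)
    from measurable_sets[OF this D[OF i]] show ?thesis
      by (simp add: Some E_def vimage_def Int_def conj_commute)
  qed
  have None: "Y None -` E None \<inter> space W = {w. w [] \<in> A}"
    by (auto simp: Y_def E_def K_def space_PiM)
  have Some: "Y (Some i) -` E (Some i) \<inter> space W = {w. shift i w \<in> D i}" for i
    by (auto simp: Y_def E_def K_def space_PiM shift_def[abs_def])
  have "{w. w [] \<in> A \<and> (\<forall>i\<in>I. shift i w \<in> D i)} = (\<Inter>j\<in>J. Y j -` E j \<inter> space W)"
    unfolding J_def INT_insert None INT_simps(10) Some by auto
  also have "W.prob \<dots> = (\<Prod>j\<in>J. W.prob (Y j -` E j \<inter> space W))"
    by (rule W.indep_varsD_finite[OF ind]) (use I E in \<open>auto simp: J_def\<close>)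
  also have "\<dots> = W.prob {w. w [] \<in> A} * (\<Prod>i\<in>I. W.prob {w. shift i w \<in> D i})"
    unfolding J_def using I
    by (subst prod.insert) (auto simp: None Some prod.reindex simp del: space_W)
  also have "\<dots> = prob A * (\<Prod>i\<in>I. W.prob (D i))"
    using A D by (simp add: prob_root prob_shift)
  finally show ?thesis .
qed

section \<open>Counting the surviving children\<close>

lemma prob_offspring:
  assumes D: "\<And>i. i \<in> I \<Longrightarrow> D i \<in> sets W" and I: "finite I"
  shows "W.prob {w. \<kappa> (w []) = k \<and> (\<forall>i\<in>I. shift i w \<in> D i)} = pmf q k * (\<Prod>i\<in>I. W.prob (D i))"
    and "{w. \<kappa> (w []) = k \<and> (\<forall>i\<in>I. shift i w \<in> D i)} \<in> sets W"
proof -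
  have k: "{x. \<kappa> x = k} \<in> sets N"
    using measurable_sets[OF \<kappa>, of "{k}"] by (simp add: vimage_def)
  show "W.prob {w. \<kappa> (w []) = k \<and> (\<forall>i\<in>I. shift i w \<in> D i)} = pmf q k * (\<Prod>i\<in>I. W.prob (D i))"
    using prob_branching[OF k D I] by (simp add: prob_\<kappa>)
  \<comment> \<open>Measurability of \<open>D i\<close> is known only for indices in
    \<open>I\<close>; the disjunct makes the condition trivial elsewhere.\<close>
  have "{w. shift i w \<in> D i \<or> i \<notin> I} \<in> sets W" for i
    using sets_shift[OF D, of i i] by (cases "i \<in> I") (auto simp flip: space_W)
  then have "{w \<in> space W. \<forall>i\<in>I. shift i w \<in> D i \<or> i \<notin> I} \<in> sets W"
    using I by (intro sets.sets_Collect_countable_Ball) (auto simp: countable_finite)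
  then have "{w. w [] \<in> {x. \<kappa> x = k}} \<inter> {w \<in> space W. \<forall>i\<in>I. shift i w \<in> D i \<or> i \<notin> I} \<in> sets W"
    by (intro sets.Int sets_root k)
  also have "{w. w [] \<in> {x. \<kappa> x = k}} \<inter> {w \<in> space W. \<forall>i\<in>I. shift i w \<in> D i \<or> i \<notin> I} =
      {w. \<kappa> (w []) = k \<and> (\<forall>i\<in>I. shift i w \<in> D i)}"
    by auto
  finally show "{w. \<kappa> (w []) = k \<and> (\<forall>i\<in>I. shift i w \<in> D i)} \<in> sets W" .
qed

text \<open>\<open>X\<close> is \<open>None\<close> on a lost child and otherwise the value that is
  left of it. Birth order is kept, so that exact lists describe disjoint events; multisets arise
  later by summing over orderings.\<close>

definition surviving :: "((nat list \<Rightarrow> 'a) \<Rightarrow> 'b option) \<Rightarrow> nat \<Rightarrow> (nat list \<Rightarrow> 'a) \<Rightarrow> 'b list" where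
  "surviving X n w = List.map_filter (\<lambda>i. X (shift i w)) [0..<n]"

context
  fixes X :: "(nat list \<Rightarrow> 'a) \<Rightarrow> 'b option"
  assumes X: "\<And>y. {w. X w = y} \<in> sets W"
begin

lemma surviving_Suc:
  "surviving X (Suc n) w = surviving X n w @ (case X (shift n w) of None \<Rightarrow> [] | Some y \<Rightarrow> [y])"
  by (simp add: surviving_def List.map_filter_def split: option.split)

text \<open>The events \<open>D\<close> on the children not yet scanned carry independence through
  the induction: the step turns the condition on child \<open>n\<close> into one more such event. At
  \<open>n = m\<close> they are used up.\<close>

lemma surviving_event:
  assumes D: "\<And>i. i \<in> {n..<m} \<Longrightarrow> D i \<in> sets W"
    and "n \<le> m"
  shows "{w. \<kappa> (w []) = k \<and> surviving X n w = ys \<and> (\<forall>i\<in>{n..<m}. shift i w \<in> D i)} \<in> sets W \<and>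
    W.prob {w. \<kappa> (w []) = k \<and> surviving X n w = ys \<and> (\<forall>i\<in>{n..<m}. shift i w \<in> D i)} =
    pmf q k * (real (n choose length ys) * W.prob {w. X w = None} ^ (n - length ys) *
      prod_list (map (\<lambda>y. W.prob {w. X w = Some y}) ys)) * (\<Prod>i\<in>{n..<m}. W.prob (D i))"
  using assms
proof (induction n arbitrary: ys D)
  case 0
  show ?case
  proof (cases ys)
    case Nil
    then show ?thesis
      using prob_offspring[of "{0..<m}" D k] 0 by (simp add: surviving_def List.map_filter_def)
  next
    case (Cons y ys')
    then have "{w. \<kappa> (w []) = k \<and> surviving X 0 w = ys \<and> (\<forall>i\<in>{0..<m}. shift i w \<in> D i)} = {}"
      by (simp add: surviving_def List.map_filter_def)
    then show ?thesis by (simp only:) (simp add: Cons)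
  qed
next
  case (Suc n)
  define f where "f y = W.prob {w. X w = y}" for y
  define D' where "D' y = D(n := {w. X w = y})" for y
  define G where "G ys y = {w. \<kappa> (w []) = k \<and> surviving X n w = ys \<and>
    (\<forall>i\<in>{n..<m}. shift i w \<in> D' y i)}" for ys y
  have nm: "{n..<m} = insert n {Suc n..<m}" using Suc.prems by auto
  have D': "D' y i \<in> sets W" if "i \<in> {n..<m}" for i y
    using that Suc.prems X nm by (auto simp: D'_def)
  have Gs: "G ys y \<in> sets W" and Gp: "W.prob (G ys y) =
      pmf q k * (real (n choose length ys) * f None ^ (n - length ys) *
        prod_list (map (\<lambda>y. f (Some y)) ys)) * (f y * (\<Prod>i\<in>{Suc n..<m}. W.prob (D i)))" for ys y
  proof -
    have "(\<Prod>i\<in>{n..<m}. W.prob (D' y i)) = f y * (\<Prod>i\<in>{Suc n..<m}. W.prob (D i))"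
      unfolding nm by (subst prod.insert) (auto simp: D'_def f_def intro!: prod.cong)
    then show "G ys y \<in> sets W" "W.prob (G ys y) =
      pmf q k * (real (n choose length ys) * f None ^ (n - length ys) *
        prod_list (map (\<lambda>y. f (Some y)) ys)) * (f y * (\<Prod>i\<in>{Suc n..<m}. W.prob (D i)))"
      using Suc.IH[of "D' y" ys] D' Suc.prems unfolding G_def f_def by auto
  qed
  have mem: "w \<in> G zs y \<longleftrightarrow> \<kappa> (w []) = k \<and> surviving X n w = zs \<and> X (shift n w) = y \<and>
      (\<forall>i\<in>{Suc n..<m}. shift i w \<in> D i)" for w zs y
    unfolding G_def nm by (auto simp: D'_def)
  show ?case
  proof (cases ys rule: rev_cases)
    case Nil
    have "{w. \<kappa> (w []) = k \<and> surviving X (Suc n) w = ys \<and> (\<forall>i\<in>{Suc n..<m}. shift i w \<in> D i)} =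
        G [] None"
      by (rule set_eqI) (auto simp: mem surviving_Suc Nil split: option.splits)
    then show ?thesis
      using Gs[of "[]" None] Gp[of "[]" None] by (simp add: Nil f_def)
  next
    \<comment> \<open>Either child \<open>n\<close> is lost and the list was complete before, or
      child \<open>n\<close> contributes the last entry \<open>z\<close>. The two weights add up by
      Pascal's rule.\<close>
    case (snoc zs z)
    have eq: "{w. \<kappa> (w []) = k \<and> surviving X (Suc n) w = ys \<and> (\<forall>i\<in>{Suc n..<m}. shift i w \<in> D i)} =
        G ys None \<union> G zs (Some z)"
      by (rule set_eqI) (auto simp: mem surviving_Suc snoc split: option.splits)
    have "G ys None \<inter> G zs (Some z) = {}"
      by (auto simp: mem)
    then have "W.prob (G ys None \<union> G zs (Some z)) = W.prob (G ys None) + W.prob (G zs (Some z))"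
      by (intro W.finite_measure_Union Gs)
    also have "\<dots> = pmf q k * (real (Suc n choose length ys) * f None ^ (Suc n - length ys) *
        prod_list (map (\<lambda>y. f (Some y)) ys)) * (\<Prod>i\<in>{Suc n..<m}. W.prob (D i))"
    proof (cases "length ys \<le> n")
      case True
      then have "Suc n - length ys = Suc (n - length ys)" "n - length zs = Suc (n - length ys)"
        by (auto simp: snoc)
      then show ?thesis
        unfolding Gp by (simp add: snoc algebra_simps)
    next
      case False
      then show ?thesis
        unfolding Gp by (simp add: snoc algebra_simps binomial_eq_0)
    qed
    finally show ?thesis
      unfolding eq f_def using Gs by auto
  qed
qed

lemma surviving_eq:
  assumes "W.prob {w. X w = None} < 1"
  shows "{w. surviving X (\<kappa> (w [])) w = ys} \<in> sets W"
    and "W.prob {w. surviving X (\<kappa> (w [])) w = ys} =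
      thinned q (length ys) (W.prob {w. X w = None}) *
        prod_list (map (\<lambda>y. W.prob {w. X w = Some y}) ys)"
proof -
  define x where "x = W.prob {w. X w = None}"
  define c where "c = prod_list (map (\<lambda>y. W.prob {w. X w = Some y}) ys)"
  define G where "G k = {w. \<kappa> (w []) = k \<and> surviving X k w = ys}" for k
  have G: "G k \<in> sets W" "W.prob (G k) = pmf q k * real (k choose length ys) * x ^ (k - length ys) * c" for k
    using surviving_event[of k k "\<lambda>_. UNIV" k ys] by (auto simp: G_def x_def c_def mult_ac)
  have eq: "{w. surviving X (\<kappa> (w [])) w = ys} = (\<Union>k. G k)"
    by (auto simp: G_def)
  then show "{w. surviving X (\<kappa> (w [])) w = ys} \<in> sets W"
    using G(1) by auto
  have "(\<lambda>k. W.prob (G k)) sums W.prob (\<Union>k. G k)"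
    by (rule W.finite_measure_UNION) (use G in \<open>auto simp: disjoint_family_on_def G_def\<close>)
  moreover have "(\<lambda>k. W.prob (G k)) sums (thinned q (length ys) x * c)"
    unfolding G thinned_def
    by (intro sums_mult2 summable_sums summable_thinned) (use assms in \<open>auto simp: x_def\<close>)
  ultimately show "W.prob {w. surviving X (\<kappa> (w [])) w = ys} =
      thinned q (length ys) (W.prob {w. X w = None}) *
        prod_list (map (\<lambda>y. W.prob {w. X w = Some y}) ys)"
    unfolding eq x_def c_def using sums_unique2 by blast
qed

lemma surviving_mset_eq:
  assumes "W.prob {w. X w = None} < 1"
  shows "{w. mset (surviving X (\<kappa> (w [])) w) = F} \<in> sets W"
    and "W.prob {w. mset (surviving X (\<kappa> (w [])) w) = F} =
      thinned q (size F) (W.prob {w. X w = None}) *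
        (\<Sum>ys | mset ys = F. prod_list (map (\<lambda>y. W.prob {w. X w = Some y}) ys))"
proof -
  have fin: "finite {ys. mset ys = F}"
    by (rule finite_subset[OF _ finite_lists_length_le[of "set_mset F" "size F"]]) auto
  have eq: "{w. mset (surviving X (\<kappa> (w [])) w) = F} =
      (\<Union>ys\<in>{ys. mset ys = F}. {w. surviving X (\<kappa> (w [])) w = ys})"
    by auto
  show "{w. mset (surviving X (\<kappa> (w [])) w) = F} \<in> sets W"
    unfolding eq using fin surviving_eq(1)[OF assms] by (intro sets.finite_UN) auto
  have "W.prob {w. mset (surviving X (\<kappa> (w [])) w) = F} =
      (\<Sum>ys | mset ys = F. W.prob {w. surviving X (\<kappa> (w [])) w = ys})"
    unfolding eq using fin surviving_eq(1)[OF assms]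
    by (intro W.finite_measure_finite_Union) (auto simp: disjoint_family_on_def)
  also have "\<dots> = (\<Sum>ys | mset ys = F. thinned q (size F) (W.prob {w. X w = None}) *
        prod_list (map (\<lambda>y. W.prob {w. X w = Some y}) ys))"
    by (intro sum.cong) (auto simp: surviving_eq(2)[OF assms])
  finally show "W.prob {w. mset (surviving X (\<kappa> (w [])) w) = F} =
      thinned q (size F) (W.prob {w. X w = None}) *
        (\<Sum>ys | mset ys = F. prod_list (map (\<lambda>y. W.prob {w. X w = Some y}) ys))"
    by (simp add: sum_distrib_left)
qed

end

lemma prob_all_children:
  assumes D: "D \<in> sets W"
  shows "W.prob {w. \<forall>i<\<kappa> (w []). shift i w \<in> D} = pgf q (W.prob D)"
proof -
  define G where "G k = {w. \<kappa> (w []) = k \<and> (\<forall>i\<in>{..<k}. shift i w \<in> D)}" for k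
  have G: "G k \<in> sets W" "W.prob (G k) = pmf q k * W.prob D ^ k" for k
    using prob_offspring[of "{..<k}" "\<lambda>_. D" k] D by (auto simp: G_def)
  have "{w. \<forall>i<\<kappa> (w []). shift i w \<in> D} = (\<Union>k. G k)"
    by (auto simp: G_def)
  moreover have "(\<lambda>k. W.prob (G k)) sums W.prob (\<Union>k. G k)"
    by (rule W.finite_measure_UNION) (use G in \<open>auto simp: disjoint_family_on_def G_def\<close>)
  ultimately show ?thesis
    unfolding G pgf_def by (simp add: sums_iff)
qed

end

section \<open>The law of the pruned tree\<close>

lemma Node_unit_edges_iff:
  "Node (mset (map (Pair ()) ys)) = Node F \<longleftrightarrow> mset ys = image_mset snd F"
proof -
  have 1: "F = image_mset (Pair ()) (image_mset snd F)"
    by (induction F) auto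
  have 2: "mset ys = image_mset snd (image_mset (Pair ()) (mset ys))"
    by (simp add: multiset.map_comp comp_def)
  show ?thesis
    using 1 2 by (metis mset_map tree.inject)
qed

context branching
begin

lemma UNIV_in_W: "UNIV \<in> sets W"
  using sets.top[of W] by simp

lemma Compl_in_W: "D \<in> sets W \<Longrightarrow> - D \<in> sets W"
  using sets.compl_sets[of D W] by (simp add: Compl_eq_Diff_UNIV)

text \<open>Exactly one surviving child contributes \<open>thinned q 1 (1 - p)\<close> times the
  same unknown value of \<open>f\<close>; moving this term over produces the factor on the left of
  both equations.\<close>

lemma recursion_of_core:
  fixes X :: "(nat list \<Rightarrow> 'a) \<Rightarrow> comb_tree option"
  assumes X: "\<And>y. {w. X w = y} \<in> sets W"
    and rec: "AE w in W. (case surviving X (\<kappa> (w [])) w of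
        [] \<Rightarrow> X w = None \<or> X w = Some (Node {#})
      | [y] \<Rightarrow> X w = Some y
      | ys \<Rightarrow> X w = Some (Node (mset (map (Pair ()) ys))))"
    and less: "W.prob {w. X w = None} < 1"
  defines "p \<equiv> W.prob {w. X w \<noteq> None}"
    and "f \<equiv> \<lambda>y. W.prob {w. X w = Some y}"
  shows "f (Node {#}) * (1 - thinned q 1 (1 - p)) = p - 1 + thinned q 0 (1 - p)"
    and "2 \<le> size F \<Longrightarrow> f (Node F) * (1 - thinned q 1 (1 - p)) =
      thinned q (size F) (1 - p) * (\<Sum>ys | mset ys = image_mset snd F. prod_list (map f ys))"
proof -
  define Y where "Y w = surviving X (\<kappa> (w [])) w" for w
  have None: "W.prob {w. X w = None} = 1 - p"
    using W.prob_compl[OF X[of None]] by (simp add: p_def Compl_eq_Diff_UNIV[symmetric] Collect_neg_eq[symmetric])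
  note sets = surviving_eq(1)[OF X less, folded Y_def]
  note prob = surviving_eq(2)[OF X less, folded Y_def f_def, unfolded None]
  have neq: "{w. X w \<noteq> None} \<in> sets W"
    using sets.compl_sets[OF X[of None]] by (simp add: Compl_eq_Diff_UNIV[symmetric] Collect_neg_eq[symmetric])
  have one: "W.prob {w. Y w = [y]} = thinned q 1 (1 - p) * f y" for y
    by (simp add: prob)
  {
    have "f (Node {#}) = W.prob ({w. Y w = [Node {#}]} \<union> ({w. X w \<noteq> None} - {w. Y w \<noteq> []}))"
      unfolding f_def
    proof (rule W.finite_measure_eq_AE)
      show "AE w in W. w \<in> {w. X w = Some (Node {#})} \<longleftrightarrow>
          w \<in> {w. Y w = [Node {#}]} \<union> ({w. X w \<noteq> None} - {w. Y w \<noteq> []})"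
        using rec by eventually_elim (auto simp: Y_def split: list.splits)
    qed (use X sets neq in \<open>auto simp: Collect_neg_eq intro: Compl_in_W\<close>)
    also have "\<dots> = W.prob {w. Y w = [Node {#}]} + W.prob ({w. X w \<noteq> None} - {w. Y w \<noteq> []})"
      by (rule W.finite_measure_Union) (use sets neq in \<open>auto simp: Collect_neg_eq intro: Compl_in_W\<close>)
    \<comment> \<open>Survival without surviving children is evaluated as a difference of
      probabilities, because \<open>rec\<close> makes \<open>X\<close> survive almost surely
      whenever some child does.\<close>
    also have "W.prob ({w. X w \<noteq> None} - {w. Y w \<noteq> []}) =
        W.prob ({w. X w \<noteq> None} \<union> {w. Y w \<noteq> []}) - W.prob {w. Y w \<noteq> []}"
    proof -
      have s: "{w. Y w \<noteq> []} \<in> sets W" using sets by (auto simp: Collect_neg_eq intro: Compl_in_W)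
      have "W.prob (({w. X w \<noteq> None} \<union> {w. Y w \<noteq> []}) - {w. Y w \<noteq> []}) =
          W.prob ({w. X w \<noteq> None} \<union> {w. Y w \<noteq> []}) - W.prob {w. Y w \<noteq> []}"
        by (rule W.finite_measure_Diff) (use s neq in auto)
      then show ?thesis by (simp add: Un_Diff)
    qed
    also have "W.prob ({w. X w \<noteq> None} \<union> {w. Y w \<noteq> []}) = p"
      unfolding p_def
    proof (rule W.finite_measure_eq_AE)
      show "AE w in W. w \<in> {w. X w \<noteq> None} \<union> {w. Y w \<noteq> []} \<longleftrightarrow> w \<in> {w. X w \<noteq> None}"
        using rec by eventually_elim (auto simp: Y_def split: list.splits)
    qed (use sets neq in \<open>auto simp: Collect_neg_eq intro: Compl_in_W\<close>)
    also have "W.prob {w. Y w \<noteq> []} = 1 - thinned q 0 (1 - p)"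
      using W.prob_compl[OF sets[of "[]"]] prob[of "[]"]
      by (simp add: Compl_eq_Diff_UNIV[symmetric] Collect_neg_eq[symmetric])
    finally show "f (Node {#}) * (1 - thinned q 1 (1 - p)) = p - 1 + thinned q 0 (1 - p)"
      by (simp add: one algebra_simps)
  }
  assume F: "2 \<le> size F"
  define G where "G = image_mset snd F"
  have FG: "Node (mset (map (Pair ()) ys)) = Node F \<longleftrightarrow> mset ys = G" for ys
    unfolding G_def by (rule Node_unit_edges_iff)
  have G: "2 \<le> size G" using F by (simp add: G_def)
  note msets = surviving_mset_eq(1)[OF X less, folded Y_def]
  have "f (Node F) = W.prob ({w. Y w = [Node F]} \<union> {w. mset (Y w) = G})"
    unfolding f_def
  proof (rule W.finite_measure_eq_AE)
    show "AE w in W. w \<in> {w. X w = Some (Node F)} \<longleftrightarrow>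
        w \<in> {w. Y w = [Node F]} \<union> {w. mset (Y w) = G}"
      using rec
    proof eventually_elim
      case (elim w)
      consider "Y w = []" | y where "Y w = [y]" | a b ys where "Y w = a # b # ys"
        by (metis list.exhaust)
      then show ?case
      proof cases
        case 1
        then show ?thesis using elim F G by (auto simp: Y_def)
      next
        case 2
        then show ?thesis using elim G by (auto simp: Y_def)
      next
        case 3
        then show ?thesis using elim FG[of "Y w"] by (auto simp: Y_def)
      qed
    qed
  qed (use X sets msets in auto)
  also have "\<dots> = W.prob {w. Y w = [Node F]} + W.prob {w. mset (Y w) = G}"
  proof (rule W.finite_measure_Union)
    show "{w. Y w = [Node F]} \<inter> {w. mset (Y w) = G} = {}" using G by auto
  qed (use sets msets in auto)
  also have "W.prob {w. mset (Y w) = G} =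
      thinned q (size F) (1 - p) * (\<Sum>ys | mset ys = G. prod_list (map f ys))"
    using surviving_mset_eq(2)[OF X less, folded Y_def f_def, unfolded None]
    by (simp add: G_def)
  finally show "f (Node F) * (1 - thinned q 1 (1 - p)) =
      thinned q (size F) (1 - p) * (\<Sum>ys | mset ys = image_mset snd F. prod_list (map f ys))"
    by (simp add: one G_def algebra_simps)
qed

section \<open>Extinction, and the Galton-Watson measure on shapes\<close>

definition extinct :: "(nat list \<Rightarrow> 'a) \<Rightarrow> bool" where
  "extinct w \<longleftrightarrow> (\<exists>S. genealogy (\<lambda>u. \<kappa> (w u)) (\<lambda>_. ()) [] S)"

lemma extinct_iff: "extinct w \<longleftrightarrow> (\<forall>i<\<kappa> (w []). extinct (shift i w))"
  unfolding extinct_def shift_def genealogy_Nil[of "\<lambda>u. \<kappa> (w u)"] by (simp, metis)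

lemma measurable_\<kappa>_coordinate: "(\<lambda>w. \<kappa> (w u)) \<in> measurable W (count_space UNIV)"
  by measurable

lemma sets_extinct: "{w. extinct w} \<in> sets W"
  using sets_ex_genealogy[of "\<lambda>w u. \<kappa> (w u)" W "\<lambda>_ _. True" "\<lambda>_ _. ()"] measurable_\<kappa>_coordinate
  by (simp add: extinct_def UNIV_in_W)

text \<open>A genealogy is finite exactly when those of all children are, and these are independent
  copies of it; hence a fixed point of the generating function.\<close>

lemma pgf_extinct: "pgf q (W.prob {w. extinct w}) = W.prob {w. extinct w}"
  using prob_all_children[OF sets_extinct] by (simp flip: extinct_iff)

lemma AE_extinct:
  assumes "\<And>e. 0 \<le> e \<Longrightarrow> e \<le> 1 \<Longrightarrow> pgf q e = e \<Longrightarrow> e = 1"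
  shows "AE w in W. extinct w"
proof -
  have "W.prob {w. extinct w} = 1"
    by (rule assms) (auto intro: pgf_extinct)
  then show ?thesis
    using W.AE_in_set_eq_1[OF sets_extinct] by simp
qed

end

lemma thinned_0: "thinned q j 0 = pmf q j"
proof -
  have "thinned q j 0 = (\<Sum>k\<in>{j}. pmf q k * real (k choose j) * 0 ^ (k - j))"
    unfolding thinned_def
  proof (rule suminf_finite)
    fix k assume "k \<notin> {j}"
    then show "pmf q k * real (k choose j) * 0 ^ (k - j) = 0"
      by (cases "k < j") (auto simp: binomial_eq_0)
  qed simp
  then show ?thesis by simp
qed

text \<open>The Galton-Watson tree is treated as the case in which no child is lost:
  \<open>X\<close> is almost surely different from \<open>None\<close>, so \<open>thinned\<close> is
  evaluated at 0, where it is \<open>pmf q\<close>. The recursion thereby gets the same form as that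
  of the pruned tree.\<close>

lemma
  assumes ext: "\<And>e. 0 \<le> e \<Longrightarrow> e \<le> 1 \<Longrightarrow> pgf q e = e \<Longrightarrow> e = 1"
  shows GW_empty_tree: "measure (GW q) {empty_tree} = 0"
    and GW_stem: "measure (GW q) {Node {#((), Node F)#}} =
      pmf q (size F) * (\<Sum>ys | mset ys = image_mset snd F.
        prod_list (map (\<lambda>y. measure (GW q) {Node {#((), y)#}}) ys))"
    and prob_space_GW: "prob_space (GW q)"
proof -
  interpret branching "measure_pmf q" id q
    by unfold_locales (auto simp: pmf.rep_eq)
  have ext_iff: "extinct c \<longleftrightarrow> (\<exists>S. genealogy c (\<lambda>_. ()) [] S)" for c
    by (simp add: extinct_def)
  have AE: "AE c in W. extinct c" by (rule AE_extinct) (rule ext)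
  define H where "H c = (THE S. genealogy c (\<lambda>_. ()) [] S)" for c
  define X where "X c = (if extinct c then Some (H c) else None)" for c
  have H: "genealogy c (\<lambda>_. ()) [] S \<longleftrightarrow> S = H c" if "extinct c" for c S
    unfolding H_def using that genealogy_unique unfolding ext_iff by (metis the_equality)
  have X_Some: "X c = Some y \<longleftrightarrow> (\<exists>S. genealogy c (\<lambda>_. ()) [] S \<and> S = y)" for c y
    using H ext_iff by (auto simp: X_def)
  have tree: "galton_watson_tree c (\<lambda>_. ()) = (case X c of None \<Rightarrow> empty_tree | Some S \<Rightarrow> Node {#((), S)#})" for c
    using H[of c] galton_watson_tree_eq[of c "\<lambda>_. ()"]
    by (auto simp: X_def ext_iff galton_watson_tree_def)
  have coord: "(\<lambda>c. c u) \<in> measurable W (count_space UNIV)" for u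
    using measurable_\<kappa>_coordinate[of u] by simp
  have ex: "{c. \<exists>S. genealogy c (\<lambda>_. ()) [] S \<and> P S} \<in> sets W" for P
    using sets_ex_genealogy[of "\<lambda>c. c" W "\<lambda>_. P" "\<lambda>_ _. ()"] coord
    by (simp add: UNIV_in_W)
  have X: "{c. X c = y} \<in> sets W" for y
  proof (cases y)
    case None
    then show ?thesis
      using sets.compl_sets[OF sets_extinct]
      by (simp add: X_def Compl_eq_Diff_UNIV[symmetric] Collect_neg_eq[symmetric])
  next
    case (Some z)
    then show ?thesis using ex[of "\<lambda>S. S = z"] by (simp add: X_Some)
  qed
  have meas: "(\<lambda>c. galton_watson_tree c (\<lambda>_. ())) \<in> measurable W (count_space UNIV)"
  proof (rule measurableI)
    fix B :: "comb_tree set"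
    have "(\<lambda>c. galton_watson_tree c (\<lambda>_. ())) -` B \<inter> space W =
        {c. \<exists>S. genealogy c (\<lambda>_. ()) [] S \<and> Node {#((), S)#} \<in> B} \<union>
        (if empty_tree \<in> B then {c. X c = None} else {})"
      using X_Some by (auto simp: tree simp flip: X_Some[simplified] split: option.splits)
    also have "\<dots> \<in> sets W" using ex X by auto
    finally show "(\<lambda>c. galton_watson_tree c (\<lambda>_. ())) -` B \<inter> space W \<in> sets W" .
  qed simp
  have GW: "measure (GW q) B = W.prob {c. galton_watson_tree c (\<lambda>_. ()) \<in> B}" for B
    unfolding GW_def by (subst measure_distr[OF meas]) (auto simp: vimage_def)
  have None: "W.prob {c. X c = None} = 0"
    using AE X[of None] by (subst W.prob_eq_0) (auto simp: X_def)
  have Some_eq: "measure (GW q) {Node {#((), y)#}} = W.prob {c. X c = Some y}" for y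
    unfolding GW by (rule arg_cong[where f = W.prob])
      (auto simp: tree empty_tree_def split: option.splits)
  show "measure (GW q) {empty_tree} = 0"
  proof -
    have "{c. galton_watson_tree c (\<lambda>_. ()) \<in> {empty_tree}} = {c. X c = None}"
      by (auto simp: tree empty_tree_def split: option.splits)
    then show ?thesis unfolding GW by (simp add: None)
  qed
  show "prob_space (GW q)"
    unfolding GW_def by (rule W.prob_space_distr[OF meas])
  have "W.prob {c. X c = Some (Node F)} = W.prob {c. mset (surviving X (id (c [])) c) = image_mset snd F}"
  proof (rule W.finite_measure_eq_AE)
    show "AE c in W. c \<in> {c. X c = Some (Node F)} \<longleftrightarrow>
        c \<in> {c. mset (surviving X (id (c [])) c) = image_mset snd F}"
      using AE AE_shift[OF AE]
    proof eventually_elim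
      case (elim c)
      have "shift i c = (\<lambda>v. c (i # v))" for i
        by (simp add: fun_eq_iff shift_def)
      then have sh: "genealogy (\<lambda>v. c (i # v)) (\<lambda>_. ()) [] (H (shift i c))" for i
        using elim H[of "shift i c" "H (shift i c)"] by metis
      have "H c = Node (mset (map (\<lambda>i. ((), H (shift i c))) [0..<c []]))"
      proof -
        have "genealogy c (\<lambda>_. ()) [] (Node (mset (map (\<lambda>i. ((), H (shift i c))) [0..<c []])))"
          by (subst genealogy_Nil) (intro exI[of _ "\<lambda>i. H (shift i c)"] conjI refl allI impI sh)
        then show ?thesis using H[OF elim(1)] by simp
      qed
      moreover have "surviving X (c []) c = map (\<lambda>i. H (shift i c)) [0..<c []]"
        using elim by (simp add: surviving_def X_def List.map_filter_def)
      ultimately have "H c = Node (mset (map (Pair ()) (surviving X (c []) c)))"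
        by (simp add: comp_def)
      then show ?case
        using elim Node_unit_edges_iff[of _ F] by (simp add: X_def)
    qed
  qed (use X surviving_mset_eq(1)[OF X] None in auto)
  also have "\<dots> = pmf q (size F) * (\<Sum>ys | mset ys = image_mset snd F.
        prod_list (map (\<lambda>y. W.prob {c. X c = Some y}) ys))"
    by (subst surviving_mset_eq(2)[OF X]) (auto simp: None thinned_0)
  finally show "measure (GW q) {Node {#((), Node F)#}} =
      pmf q (size F) * (\<Sum>ys | mset ys = image_mset snd F.
        prod_list (map (\<lambda>y. measure (GW q) {Node {#((), y)#}}) ys))"
    unfolding Some_eq .
qed

section \<open>The random tree as a function of independent data at the individuals\<close>

lemma genealogy_metric:
  assumes "genealogy c l u S" "\<And>u. 0 < l u" "\<And>u. c u \<noteq> 1"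
  shows "S \<in> metric_trees \<and> size (root_edges S) \<noteq> 1"
  using assms(1)
proof induction
  case (1 u S)
  then show ?case
    using assms(2,3) by (auto simp: metric_trees_Node)
qed

definition stem_core :: "comb_tree \<Rightarrow> comb_tree option" where
  "stem_core \<tau> = (if \<exists>y. \<tau> = Node {#((), y)#} then Some (THE y. \<tau> = Node {#((), y)#}) else None)"

lemma stem_core_stem [simp]: "stem_core (Node {#((), y)#}) = Some y"
  by (simp add: stem_core_def)

lemma stem_core_empty [simp]: "stem_core empty_tree = None"
  by (simp add: stem_core_def empty_tree_def)

text \<open>\<open>ext\<close> stands in for the assumption on the mean: both the critical and the
  subcritical regime supply it, and it makes the tree finite almost surely.\<close>

locale pruned_gw =
  fixes q :: "nat pmf" and lam :: real and \<phi> :: "metric_tree \<Rightarrow> real"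
    and M :: "'w measure" and T :: "'w \<Rightarrow> metric_tree"
  assumes q1: "pmf q 1 = 0"
    and lam: "0 < lam"
    and mono: "monotone_nondecreasing \<phi>"
    and meas: "\<And>t. 0 \<le> t \<Longrightarrow> prune \<phi> t \<in> measurable metric_tree_space metric_tree_space"
    and M: "prob_space M"
    and T: "T \<in> measurable M metric_tree_space"
    and law: "distr M metric_tree_space T = GW_metric q lam"
    and pos: "\<And>t. 0 \<le> t \<Longrightarrow> \<P>(\<omega> in M. prune \<phi> t (T \<omega>) \<noteq> empty_tree) > 0"
    and ext: "\<And>e. 0 \<le> e \<Longrightarrow> e \<le> 1 \<Longrightarrow> pgf q e = e \<Longrightarrow> e = 1"
begin

abbreviation exp_measure :: "real measure" where
  "exp_measure \<equiv> density lborel (exponential_density lam)"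

abbreviation node :: "(nat \<times> real) measure" where
  "node \<equiv> measure_pmf q \<Otimes>\<^sub>M exp_measure"

lemma prob_space_exp: "prob_space exp_measure"
  using prob_space_exponential_density[OF lam] .

lemma prob_space_node: "prob_space node"
proof -
  interpret E: prob_space exp_measure by (rule prob_space_exp)
  interpret pair_prob_space "measure_pmf q" exp_measure ..
  show ?thesis by (rule prob_space_axioms)
qed

lemma distr_fst_node: "distr node (count_space UNIV) fst = measure_pmf q"
proof -
  interpret E: prob_space exp_measure by (rule prob_space_exp)
  have "distr node (measure_pmf q) fst = measure_pmf q"
    by (rule E.distr_pair_fst)
  moreover have "distr node (count_space UNIV) fst = distr node (measure_pmf q) fst"
    by (rule distr_cong) auto
  ultimately show ?thesis by simp
qed

sublocale branching node fst q
proof -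
  interpret prob_space node by (rule prob_space_node)
  show "branching node fst q"
  proof
    show "space node = UNIV" by (simp add: space_pair_measure)
    show "fst \<in> measurable node (count_space UNIV)"
      using measurable_fst[of "measure_pmf q" exp_measure] by simp
    show "prob {x. fst x = k} = pmf q k" for k
    proof -
      have "pmf q k = measure (distr node (count_space UNIV) fst) {k}"
        by (simp add: distr_fst_node pmf.rep_eq)
      also have "\<dots> = prob {x. fst x = k}"
        using measurable_fst[of "measure_pmf q" exp_measure]
        by (subst measure_distr) (auto simp: vimage_def space_pair_measure)
      finally show ?thesis ..
    qed
  qed
qed

definition tree_of :: "(nat list \<Rightarrow> nat \<times> real) \<Rightarrow> metric_tree" where
  "tree_of w = metric_gw_tree (\<lambda>u. fst (w u)) (\<lambda>u. snd (w u))"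

lemma measurable_label: "(\<lambda>w. snd (w u)) \<in> borel_measurable W"
  using measurable_compose[OF measurable_coordinate[of u] measurable_snd[of "measure_pmf q" exp_measure]]
  by simp

lemma measurable_tree_of: "tree_of \<in> measurable W metric_tree_space"
  unfolding tree_of_def using measurable_\<kappa>_coordinate measurable_label
  by (rule measurable_metric_gw_tree)

lemma distr_tree_of: "distr W metric_tree_space tree_of = GW_metric q lam"
proof -
  let ?P = "(\<Pi>\<^sub>M u\<in>(UNIV :: nat list set). measure_pmf q) \<Otimes>\<^sub>M (\<Pi>\<^sub>M u\<in>UNIV. exp_measure)"
  let ?Z = "\<lambda>(c :: nat list \<Rightarrow> nat, l :: nat list \<Rightarrow> real) u. (c u, l u)"
  have W: "W = distr ?P W ?Z"
    by (rule PiM_pair_eq_distr) (auto intro: prob_space_exp measure_pmf.prob_space_axioms)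
  have Z: "?Z \<in> measurable ?P W"
    by (rule measurable_PiM_single') (auto simp: split_beta' space_pair_measure space_PiM PiE_iff)
  have "distr W metric_tree_space tree_of = distr ?P metric_tree_space (tree_of \<circ> ?Z)"
    by (subst W) (rule distr_distr[OF measurable_tree_of Z])
  also have "tree_of \<circ> ?Z = (\<lambda>(c, l). let T = galton_watson_tree c l in if T \<in> metric_trees then T else empty_tree)"
    by (auto simp: fun_eq_iff tree_of_def metric_gw_tree_def)
  finally show ?thesis by (simp add: GW_metric_def)
qed

definition good :: "(nat list \<Rightarrow> nat \<times> real) \<Rightarrow> metric_tree \<Rightarrow> bool" where
  "good w S \<longleftrightarrow> genealogy (\<lambda>u. fst (w u)) (\<lambda>u. snd (w u)) [] S \<and>
     Node {#(snd (w []), S)#} \<in> metric_trees"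

text \<open>Three almost sure properties combine: no individual has exactly one child, all lengths
  are positive, and the genealogy is finite. The first makes the tree reduced.\<close>

lemma AE_good: "AE w in W. \<exists>S. good w S"
proof -
  have "AE x in node. fst x \<noteq> 1"
  proof -
    have "AE x in distr node (count_space UNIV) fst. x \<noteq> 1"
      unfolding distr_fst_node AE_measure_pmf_iff using q1 by (auto simp: set_pmf_iff)
    then show ?thesis
      by (subst (asm) AE_distr_iff) (use \<kappa> in auto)
  qed
  then have 1: "AE w in W. \<forall>u. fst (w u) \<noteq> 1"
    unfolding AE_all_countable
    by (intro allI AE_PiM_component[where P = "\<lambda>x. fst x \<noteq> 1"]) (auto intro: prob_space_node)
  have "AE x in node. 0 < snd x"
  proof -
    interpret E: prob_space exp_measure by (rule prob_space_exp)
    interpret pair_prob_space "measure_pmf q" exp_measure ..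
    have "AE x in exp_measure. 0 < x"
    proof -
      have "AE x in lborel. x \<noteq> (0 :: real)" by (rule AE_lborel_singleton)
      then show ?thesis
        by (subst AE_density) (auto simp: exponential_density_def erlang_density_def elim!: eventually_mono)
    qed
    moreover have "{x \<in> space node. 0 < snd x} \<in> sets node"
      using measurable_sets[OF measurable_snd[of "measure_pmf q" exp_measure], of "{0<..}"]
      by (simp add: vimage_def Int_def conj_commute)
    ultimately show ?thesis
      by (intro AE_pair_measure) auto
  qed
  then have 2: "AE w in W. \<forall>u. 0 < snd (w u)"
    unfolding AE_all_countable
    by (intro allI AE_PiM_component[where P = "\<lambda>x. 0 < snd x"]) (auto intro: prob_space_node)
  have "AE w in W. extinct w"
    by (rule AE_extinct) (rule ext)
  then show ?thesis
    using 1 2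
  proof eventually_elim
    case (elim w)
    then obtain S where S: "genealogy (\<lambda>u. fst (w u)) (\<lambda>u. snd (w u)) [] S"
      unfolding extinct_def using genealogy_relabel by blast
    then have "S \<in> metric_trees \<and> size (root_edges S) \<noteq> 1"
      using elim by (intro genealogy_metric[OF S]) auto
    then show ?case
      using S elim by (auto simp: good_def metric_trees_stem)
  qed
qed

lemma tree_of_good: "good w S \<Longrightarrow> tree_of w = Node {#(snd (w []), S)#}"
  using galton_watson_tree_eq[of "\<lambda>u. fst (w u)" "\<lambda>u. snd (w u)" S]
  by (simp add: good_def tree_of_def metric_gw_tree_def)

lemma tree_of_not_good: "\<nexists>S. good w S \<Longrightarrow> tree_of w = empty_tree"
  using metric_gw_tree_iff[of "\<lambda>u. fst (w u)" "\<lambda>u. snd (w u)" "{empty_tree}"]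
  by (auto simp: tree_of_def good_def)

definition core :: "real \<Rightarrow> (nat list \<Rightarrow> nat \<times> real) \<Rightarrow> comb_tree option" where
  "core t w = stem_core (shape (prune \<phi> t (tree_of w)))"

lemma shape_prune_good:
  assumes "good w S"
  shows "shape (prune \<phi> t (tree_of w)) = (if retained \<phi> t (snd (w []), S)
    then Node {#((), core_shape \<phi> t S)#} else empty_tree)"
  unfolding tree_of_good[OF assms]
  using assms by (intro shape_prune_stem[OF mono]) (simp add: good_def)

lemma shape_prune_empty: "shape (prune \<phi> t empty_tree) = empty_tree"
  using shape_prune[OF mono, of "{#}"] empty_tree_metric
  by (simp add: empty_tree_def retained_shapes_def)

lemma core_good:
  assumes "good w S"
  shows "core t w = (if retained \<phi> t (snd (w []), S) then Some (core_shape \<phi> t S) else None)"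
  unfolding core_def shape_prune_good[OF assms] by simp

lemma core_not_good: "\<nexists>S. good w S \<Longrightarrow> core t w = None"
  by (simp add: core_def tree_of_not_good shape_prune_empty)

lemma shape_prune_eq_core:
  "shape (prune \<phi> t (tree_of w)) = (case core t w of None \<Rightarrow> empty_tree | Some y \<Rightarrow> Node {#((), y)#})"
proof (cases "\<exists>S. good w S")
  case True
  then show ?thesis using core_good shape_prune_good by fastforce
next
  case False
  then show ?thesis by (simp add: core_not_good tree_of_not_good shape_prune_empty)
qed

lemma sets_shape_prune:
  assumes "0 \<le> t"
  shows "{S \<in> metric_trees. shape (prune \<phi> t S) \<in> B} \<in> sets metric_tree_space"
proof -
  have "prune \<phi> t -` {S \<in> metric_trees. shape S \<in> B} \<inter> space metric_tree_space \<in> sets metric_tree_space"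
    by (rule measurable_sets[OF meas[OF assms] sets_shape])
  moreover have "prune \<phi> t -` {S \<in> metric_trees. shape S \<in> B} \<inter> space metric_tree_space =
      {S \<in> metric_trees. shape (prune \<phi> t S) \<in> B}"
    using measurable_space[OF meas[OF assms]] by auto
  ultimately show ?thesis by simp
qed

text \<open>Events about the pruned tree depend on the law of \<open>T\<close> alone, so every
  computation can be carried out on \<open>W\<close>.\<close>

lemma prob_shape_prune:
  assumes "0 \<le> t"
  shows "\<P>(\<omega> in M. shape (prune \<phi> t (T \<omega>)) \<in> B) = W.prob {w. shape (prune \<phi> t (tree_of w)) \<in> B}"
    and "{w. shape (prune \<phi> t (tree_of w)) \<in> B} \<in> sets W"
proof -
  let ?B = "{S \<in> metric_trees. shape (prune \<phi> t S) \<in> B}"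
  note B = sets_shape_prune[OF assms, of B]
  have 1: "T -` ?B \<inter> space M = {\<omega> \<in> space M. shape (prune \<phi> t (T \<omega>)) \<in> B}"
    using measurable_space[OF T] by auto
  have 2: "tree_of -` ?B \<inter> space W = {w. shape (prune \<phi> t (tree_of w)) \<in> B}"
    using measurable_space[OF measurable_tree_of] by auto
  show "{w. shape (prune \<phi> t (tree_of w)) \<in> B} \<in> sets W"
    using measurable_sets[OF measurable_tree_of B] 2 by simp
  have "measure M (T -` ?B \<inter> space M) = measure (distr M metric_tree_space T) ?B"
    by (rule measure_distr[OF T B, symmetric])
  also have "\<dots> = W.prob (tree_of -` ?B \<inter> space W)"
    unfolding law distr_tree_of[symmetric] by (rule measure_distr[OF measurable_tree_of B])
  finally show "\<P>(\<omega> in M. shape (prune \<phi> t (T \<omega>)) \<in> B) = W.prob {w. shape (prune \<phi> t (tree_of w)) \<in> B}"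
    unfolding 1 2 .
qed

lemma sets_core:
  assumes "0 \<le> t"
  shows "{w. core t w = y} \<in> sets W"
  using prob_shape_prune(2)[OF assms, of "{\<tau>. stem_core \<tau> = y}"] by (simp add: core_def)

lemma sets_core_neq:
  assumes "0 \<le> t"
  shows "{w. core t w \<noteq> None} \<in> sets W"
proof -
  have "{w. core t w \<noteq> None} = - {w. core t w = None}" by auto
  then show ?thesis using Compl_in_W[OF sets_core[OF assms]] by metis
qed

section \<open>The survival probability and the conditional law below the stem\<close>

definition survival :: "real \<Rightarrow> real" where
  "survival t = W.prob {w. core t w \<noteq> None}"

lemma survival_eq:
  assumes "0 \<le> t"
  shows "\<P>(\<omega> in M. prune \<phi> t (T \<omega>) \<noteq> empty_tree) = survival t"
proof -
  have "{w. shape (prune \<phi> t (tree_of w)) \<in> - {empty_tree}} = {w. core t w \<noteq> None}"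
    by (auto simp: shape_prune_eq_core empty_tree_def split: option.splits)
  then show ?thesis
    using prob_shape_prune(1)[OF assms, of "- {empty_tree}"]
    by (simp add: survival_def shape_eq_empty_tree_iff)
qed

lemma survival_pos: "0 \<le> t \<Longrightarrow> 0 < survival t"
  using pos[of t] survival_eq[of t] by simp

lemma cond_prob_shape:
  assumes "0 \<le> t"
  shows "\<P>(\<omega> in M. shape (prune \<phi> t (T \<omega>)) \<in> B \<bar> prune \<phi> t (T \<omega>) \<noteq> empty_tree) =
    W.prob {w. \<exists>y. core t w = Some y \<and> Node {#((), y)#} \<in> B} / survival t"
proof -
  have "{w. shape (prune \<phi> t (tree_of w)) \<in> B - {empty_tree}} =
      {w. \<exists>y. core t w = Some y \<and> Node {#((), y)#} \<in> B}"
    by (auto simp: shape_prune_eq_core empty_tree_def split: option.splits)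
  then show ?thesis
    using prob_shape_prune(1)[OF assms, of "B - {empty_tree}"] survival_eq[OF assms]
    by (simp add: cond_prob_def shape_eq_empty_tree_iff)
qed

text \<open>This is the hypothesis of \<open>recursion_of_core\<close>. Without surviving children
  both outcomes remain possible, since part of the edge above may still be kept; with a surviving
  child the stem is retained by \<open>retained_le\<close> and
  \<open>retained_stemI\<close>.\<close>

lemma AE_core_recursion:
  "AE w in W. (case surviving (core t) (fst (w [])) w of
        [] \<Rightarrow> core t w = None \<or> core t w = Some (Node {#})
      | [y] \<Rightarrow> core t w = Some y
      | ys \<Rightarrow> core t w = Some (Node (mset (map (Pair ()) ys))))"
  using AE_good AE_shift[OF AE_good]
proof eventually_elim
  case (elim w)
  let ?k = "fst (w [])"
  define ys where "ys = surviving (core t) ?k w"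
  obtain S where S: "good w S" using elim(1) by blast
  obtain Sf where Sf: "\<And>i. good (shift i w) (Sf i)" using elim(2) by metis
  define e where "e i = (snd (w [i]), Sf i)" for i
  have "genealogy (\<lambda>v. fst (w (i # v))) (\<lambda>v. snd (w (i # v))) [] (Sf i)" for i
    using Sf[of i] by (simp add: good_def shift_def)
  then have "genealogy (\<lambda>u. fst (w u)) (\<lambda>u. snd (w u)) [] (Node (mset (map e [0..<?k])))"
    unfolding e_def by (subst genealogy_Nil) blast
  then have SE: "S = Node (mset (map e [0..<?k]))"
    using S genealogy_unique unfolding good_def by blast
  have core: "core t (shift i w) = (if retained \<phi> t (e i) then Some (core_shape \<phi> t (Sf i)) else None)" for i
    using core_good[OF Sf[of i]] by (simp add: e_def shift_def)
  have ys: "mset (map (Pair ()) ys) = retained_shapes \<phi> t (mset (map e [0..<?k]))"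
  proof -
    have "mset (map (Pair ()) (List.map_filter (\<lambda>i. core t (shift i w)) xs)) =
        retained_shapes \<phi> t (mset (map e xs))" for xs
      by (induction xs) (auto simp: core retained_shapes_def e_def)
    then show ?thesis by (simp only: ys_def surviving_def)
  qed
  have shape: "core_shape \<phi> t S = collapse (mset (map (Pair ()) ys))"
    unfolding SE core_shape_Node ys ..
  have m: "Node {#(snd (w []), S)#} \<in> metric_trees" "S \<in> metric_trees"
    using S by (auto simp: good_def metric_trees_stem)
  have ret: "retained \<phi> t (snd (w []), S)" if "ys \<noteq> []"
  proof -
    have "retained_shapes \<phi> t (mset (map e [0..<?k])) \<noteq> {#}"
      unfolding ys[symmetric] using that by simp
    then obtain x where "x \<in># mset (map e [0..<?k])" "retained \<phi> t x"
      by (auto simp: retained_shapes_def)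
    then have "t \<le> \<phi> S"
      using retained_le[OF mono] m(2) unfolding SE by blast
    then show ?thesis
      by (rule retained_stemI[OF mono m(1)])
  qed
  have *: "core t w = (if retained \<phi> t (snd (w []), S) then Some (collapse (mset (map (Pair ()) ys))) else None)"
    using core_good[OF S] shape by simp
  show ?case
    using ret unfolding ys_def[symmetric] *
    by (auto simp: collapse_def split: list.splits)
qed

lemma survival_antimono:
  assumes "0 \<le> s" "s \<le> t"
  shows "survival t \<le> survival s"
  unfolding survival_def
proof (rule W.finite_measure_mono)
  show "{w. core t w \<noteq> None} \<subseteq> {w. core s w \<noteq> None}"
  proof
    fix w assume w: "w \<in> {w. core t w \<noteq> None}"
    then obtain S where S: "good w S" using core_not_good by fastforce
    have "retained \<phi> t (snd (w []), S)"
      using w core_good[OF S, of t] by (auto split: if_splits)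
    then have "retained \<phi> s (snd (w []), S)"
      using assms(2) by (fastforce simp: retained_def)
    then show "w \<in> {w. core s w \<noteq> None}"
      using core_good[OF S, of s] by simp
  qed
  show "{w. core s w \<noteq> None} \<in> sets W"
    by (rule sets_core_neq[OF assms(1)])
qed

lemma survival_tendsto_0: "(survival \<longlongrightarrow> 0) at_top"
proof -
  \<comment> \<open>Continuity from above concerns sequences, so integer levels come first;
    \<open>survival_antimono\<close> extends the limit to real levels.\<close>
  define E where "E n = {w. core (real n) w \<noteq> None}" for n
  have E: "E n \<in> sets W" for n
    unfolding E_def by (rule sets_core_neq) simp
  have sub: "E n \<subseteq> {w. \<exists>S. good w S \<and> real n \<le> \<phi> (Node {#(snd (w []), S)#})}" for n
  proof
    fix w assume w: "w \<in> E n"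
    then obtain S where S: "good w S" using core_not_good by (fastforce simp: E_def)
    then have "retained \<phi> n (snd (w []), S)"
      using w core_good[OF S, of n] by (auto simp: E_def split: if_splits)
    then have "real n \<le> \<phi> (Node {#(snd (w []), S)#})"
      using S by (intro retained_le[OF mono]) (auto simp: good_def)
    then show "w \<in> {w. \<exists>S. good w S \<and> real n \<le> \<phi> (Node {#(snd (w []), S)#})}"
      using S by blast
  qed
  have uniq: "S = S'" if "good w S" "good w S'" for w S S'
    using that genealogy_unique unfolding good_def by blast
  have empty: "(\<Inter>n. E n) = {}"
  proof (intro equals0I)
    fix w assume w: "w \<in> (\<Inter>n. E n)"
    have all: "\<exists>S. good w S \<and> real n \<le> \<phi> (Node {#(snd (w []), S)#})" for n
      using sub[of n] w by blast
    then obtain S where S: "good w S" by blast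
    obtain n where "\<phi> (Node {#(snd (w []), S)#}) < real n" using reals_Archimedean2 by blast
    then show False using all[of n] uniq[OF S] by fastforce
  qed
  have dec: "decseq E"
  proof (rule decseq_SucI)
    fix n
    show "E (Suc n) \<subseteq> E n"
    proof safe
      fix w assume w: "w \<in> E (Suc n)"
      then obtain S where S: "good w S" using core_not_good by (fastforce simp: E_def)
      have "retained \<phi> (Suc n) (snd (w []), S)"
        using w core_good[OF S, of "Suc n"] by (auto simp: E_def split: if_splits)
      then have "retained \<phi> n (snd (w []), S)"
        by (fastforce simp: retained_def)
      then show "w \<in> E n"
        using core_good[OF S, of n] by (simp add: E_def)
    qed
  qed
  have "(\<lambda>n. W.prob (E n)) \<longlonglongrightarrow> W.prob (\<Inter>n. E n)"
    by (rule W.finite_Lim_measure_decseq) (use E dec in auto)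
  then have "(\<lambda>n. W.prob (E n)) \<longlonglongrightarrow> 0"
    unfolding empty by simp
  then have lim: "(\<lambda>n. survival (real n)) \<longlonglongrightarrow> 0"
    unfolding E_def survival_def .
  show ?thesis
  proof (rule order_tendstoI)
    fix a :: real assume a: "0 < a"
    then have "eventually (\<lambda>n. survival (real n) < a) sequentially"
      using lim by (auto dest: order_tendstoD)
    then obtain n where n: "survival (real n) < a" by (auto simp: eventually_sequentially)
    show "eventually (\<lambda>t. survival t < a) at_top"
      using eventually_ge_at_top[of "real n"]
    proof eventually_elim
      case (elim t)
      then show ?case using survival_antimono[of "real n" t] n by simp
    qed
  next
    fix a :: real assume a: "a < 0"
    show "eventually (\<lambda>t. a < survival t) at_top"
      using eventually_ge_at_top[of "0 :: real"] 
    proof eventually_elim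
      case (elim t)
      then show ?case using survival_pos[of t] a by simp
    qed
  qed
qed

lemma survival_at_right: "filterlim survival (at_right 0) at_top"
proof -
  have "eventually (\<lambda>t. 0 < survival t) at_top"
    using eventually_ge_at_top[of "0 :: real"] by eventually_elim (rule survival_pos)
  then show ?thesis
    unfolding at_within_def using survival_tendsto_0
    by (auto simp: filterlim_inf filterlim_principal)
qed

definition core_law :: "real \<Rightarrow> comb_tree \<Rightarrow> real" where
  "core_law t y = W.prob {w. core t w = Some y} / survival t"

text \<open>This is \<open>recursion_of_core\<close> divided by \<open>p\<close>: the product over
  the children contains \<open>size F\<close> factors \<open>p\<close>, and one of them
  cancels.\<close>

lemma core_law_recursion:
  assumes "0 \<le> t" and less: "thinned q 1 (1 - survival t) < 1"
  defines "p \<equiv> survival t"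
  shows "core_law t (Node {#}) = (p - 1 + thinned q 0 (1 - p)) / (p * (1 - thinned q 1 (1 - p)))"
    and "2 \<le> size F \<Longrightarrow> core_law t (Node F) =
      p ^ (size F - 1) * thinned q (size F) (1 - p) / (1 - thinned q 1 (1 - p)) *
        (\<Sum>ys | mset ys = image_mset snd F. prod_list (map (core_law t) ys))"
proof -
  have p: "0 < p" using survival_pos[OF assms(1)] by (simp add: p_def)
  have None: "W.prob {w. core t w = None} = 1 - p"
    using W.prob_compl[OF sets_core[OF assms(1), of None]]
    by (simp add: p_def survival_def Compl_eq_Diff_UNIV[symmetric] Collect_neg_eq[symmetric])
  have ne: "W.prob {w. core t w = None} < 1" using None p by simp
  note rec = recursion_of_core[OF sets_core[OF assms(1)] AE_core_recursion ne, folded survival_def p_def]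
  have f: "W.prob {w. core t w = Some y} = p * core_law t y" for y
    using p by (simp add: core_law_def p_def)
  show "core_law t (Node {#}) = (p - 1 + thinned q 0 (1 - p)) / (p * (1 - thinned q 1 (1 - p)))"
    using rec(1) p less unfolding f by (simp add: field_simps p_def)
  assume F: "2 \<le> size F"
  have prod: "prod_list (map (\<lambda>y. p * core_law t y) ys) = p ^ length ys * prod_list (map (core_law t) ys)" for ys
    by (induction ys) auto
  have "(\<Sum>ys | mset ys = image_mset snd F. prod_list (map (\<lambda>y. p * core_law t y) ys)) =
      (\<Sum>ys | mset ys = image_mset snd F. p ^ size F * prod_list (map (core_law t) ys))"
    unfolding prod by (intro sum.cong refl) (metis mem_Collect_eq size_image_mset size_mset)
  also have "\<dots> = p * p ^ (size F - 1) * (\<Sum>ys | mset ys = image_mset snd F. prod_list (map (core_law t) ys))"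
    using F by (cases "size F") (auto simp: sum_distrib_left)
  finally have "p * core_law t (Node F) * (1 - thinned q 1 (1 - p)) = thinned q (size F) (1 - p) *
      (p * p ^ (size F - 1) * (\<Sum>ys | mset ys = image_mset snd F. prod_list (map (core_law t) ys)))"
    using rec(2)[OF F] unfolding f by simp
  then have "p * (core_law t (Node F) * (1 - thinned q 1 (1 - p))) =
      p * (p ^ (size F - 1) * thinned q (size F) (1 - p) *
        (\<Sum>ys | mset ys = image_mset snd F. prod_list (map (core_law t) ys)))"
    by (simp only: mult_ac)
  then have "core_law t (Node F) * (1 - thinned q 1 (1 - p)) =
      p ^ (size F - 1) * thinned q (size F) (1 - p) *
        (\<Sum>ys | mset ys = image_mset snd F. prod_list (map (core_law t) ys))"
    using p by (subst (asm) mult_left_cancel) auto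
  then show "core_law t (Node F) =
      p ^ (size F - 1) * thinned q (size F) (1 - p) / (1 - thinned q 1 (1 - p)) *
        (\<Sum>ys | mset ys = image_mset snd F. prod_list (map (core_law t) ys))"
    using less unfolding times_divide_eq_left by (subst eq_divide_eq) (simp add: p_def)
qed

end

section \<open>Generating functions\<close>

text \<open>Tonelli's theorem for double series, obtained through unconditional summation over
  pairs.\<close>

lemma sums_swap_nonneg:
  fixes a :: "nat \<Rightarrow> nat \<Rightarrow> real"
  assumes nonneg: "\<And>k m. 0 \<le> a k m" and row: "\<And>k. (\<lambda>m. a k m) sums b k" and tot: "b sums c"
  shows "(\<lambda>m. \<Sum>k. a k m) sums c" and "summable (\<lambda>k. a k m)"
proof -
  have row': "(a k has_sum b k) UNIV" for k
    by (rule sums_nonneg_imp_has_sum[OF row nonneg])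
  have b: "0 \<le> b k" for k
    using row nonneg by (metis sums_le sums_zero)
  have tot': "(b has_sum c) UNIV"
    by (rule sums_nonneg_imp_has_sum[OF tot b])
  have "(\<lambda>(k, m). a k m) summable_on UNIV \<times> UNIV"
    by (rule summable_on_SigmaI[where g = b])
       (use row' tot' nonneg in \<open>auto simp: summable_on_def\<close>)
  then have "((\<lambda>(k, m). a k m) has_sum c) (UNIV \<times> UNIV)"
    by (intro has_sum_SigmaI[where g = b]) (use row' tot' in auto)
  then have swap: "((\<lambda>(m, k). a k m) has_sum c) (UNIV \<times> UNIV)"
    by (subst (asm) has_sum_swap) simp
  have le: "a k m \<le> b k" for k m
    using sum_le_suminf[of "a k" "{m}"] row[of k] nonneg by (auto simp: sums_iff)
  show s: "summable (\<lambda>k. a k m)" for m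
    by (rule summable_comparison_test'[of b]) (use tot nonneg le in \<open>auto simp: sums_iff\<close>)
  have "((\<lambda>k. a k m) has_sum (\<Sum>k. a k m)) UNIV" for m
    by (rule sums_nonneg_imp_has_sum) (use nonneg s in \<open>auto simp: summable_sums\<close>)
  then have "((\<lambda>m. \<Sum>k. a k m) has_sum c) UNIV"
    by (intro has_sum_SigmaD[OF swap]) auto
  then show "(\<lambda>m. \<Sum>k. a k m) sums c"
    by (rule has_sum_imp_sums)
qed

lemma pgf_sums:
  assumes "0 \<le> x" "x \<le> 1"
  shows "(\<lambda>k. pmf q k * x ^ k) sums pgf q x"
proof -
  have "summable (\<lambda>k. pmf q k * x ^ k)"
  proof (rule summable_comparison_test')
    show "summable (pmf q)" using sums_pmf_nat by (auto simp: sums_iff)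
    show "norm (pmf q k * x ^ k) \<le> pmf q k" for k
      using assms by (simp add: abs_mult mult_left_le power_le_one)
  qed
  then show ?thesis by (simp add: pgf_def summable_sums)
qed

lemma pgf_1: "pgf q 1 = 1"
  using sums_pmf_nat[of q] by (simp add: pgf_def sums_iff)

lemma thinned_sums:
  assumes "0 \<le> x" "x < 1"
  shows "(\<lambda>k. pmf q k * real (k choose j) * x ^ (k - j)) sums thinned q j x"
  unfolding thinned_def by (rule summable_sums[OF summable_thinned[OF assms]])

lemma thinned_nonneg: "0 \<le> x \<Longrightarrow> x < 1 \<Longrightarrow> 0 \<le> thinned q j x"
  unfolding thinned_def by (intro suminf_nonneg summable_thinned) auto

lemma thinned_0_pgf: "thinned q 0 x = pgf q x"
  by (simp add: thinned_def pgf_def)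

lemma thinned_1_sums:
  assumes "0 \<le> x" "x < 1"
  shows "(\<lambda>k. pmf q k * real k * x ^ (k - 1)) sums thinned q 1 x"
  using thinned_sums[OF assms, of q 1] by simp

lemma pgf_has_deriv:
  assumes "0 \<le> x" "x < 1"
  shows "(pgf q has_real_derivative thinned q 1 x) (at x)"
proof -
  have "summable (\<lambda>k. pmf q k * 1 ^ k)"
    using pgf_sums[of 1 q] by (simp add: sums_iff)
  from termdiffs_strong[OF this, of x] have "(pgf q has_real_derivative (\<Sum>k. diffs (pmf q) k * x ^ k)) (at x)"
    using assms by (simp add: pgf_def[abs_def])
  moreover have "(\<lambda>k. diffs (pmf q) k * x ^ k) sums thinned q 1 x"
    using sums_Suc_iff[of "\<lambda>k. pmf q k * real k * x ^ (k - 1)" "thinned q 1 x"] thinned_1_sums[OF assms]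
    by (simp add: diffs_def mult_ac)
  ultimately show ?thesis by (simp add: sums_iff)
qed

text \<open>\<open>thinned q j x\<close> is the \<open>j\<close>-th Taylor coefficient of the
  generating function at \<open>x\<close>. In the binomial expansion of each power all terms are
  nonnegative, so the sums may be exchanged, including at the endpoint
  \<open>x + h = 1\<close>.\<close>

lemma pgf_taylor:
  assumes "0 \<le> x" "x < 1" "0 \<le> h" "x + h \<le> 1"
  shows "(\<lambda>j. thinned q j x * h ^ j) sums pgf q (x + h)"
proof -
  define a where "a k j = pmf q k * real (k choose j) * x ^ (k - j) * h ^ j" for k j
  have "(\<lambda>j. a k j) sums (pmf q k * (x + h) ^ k)" for k
  proof -
    have "(\<lambda>j. a k j) sums (\<Sum>j\<le>k. a k j)"
      by (rule sums_finite) (auto simp: a_def binomial_eq_0)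
    also have "(\<Sum>j\<le>k. a k j) = pmf q k * (h + x) ^ k"
      unfolding binomial_ring by (simp add: a_def sum_distrib_left mult_ac)
    finally show ?thesis by (simp add: add.commute)
  qed
  moreover have "(\<lambda>k. pmf q k * (x + h) ^ k) sums pgf q (x + h)"
    by (rule pgf_sums) (use assms in auto)
  ultimately have "(\<lambda>j. \<Sum>k. a k j) sums pgf q (x + h)"
    using assms by (intro sums_swap_nonneg(1)) (auto simp: a_def)
  moreover have "(\<Sum>k. a k j) = thinned q j x * h ^ j" for j
    using sums_mult2[OF thinned_sums[OF assms(1,2), of q j], of "h ^ j"] by (simp add: a_def sums_iff)
  ultimately show ?thesis by simp
qed

text \<open>In the geometric sum for \<open>(1 - x ^ k) / (1 - x)\<close> each term is compared with
  the largest, with the smallest, or paired with its mirror image. The pairing uses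
  \<open>(1 - x ^ i) * (1 - x ^ (k - 1 - i)) \<ge> 0\<close> and gives a trapezoidal bound.\<close>

lemma geometric_sum_bounds:
  fixes x :: real
  assumes "0 \<le> x" "x \<le> 1"
  shows "1 - x ^ k \<le> real k * (1 - x)" and "real k * x ^ (k - 1) * (1 - x) \<le> 1 - x ^ k"
    and "2 * (1 - x ^ k) \<le> real k * (1 - x) * (1 + x ^ (k - 1))"
proof -
  have g: "1 - x ^ k = (1 - x) * (\<Sum>i<k. x ^ i)"
    by (rule one_diff_power_eq)
  have "(\<Sum>i<k. x ^ i) \<le> (\<Sum>i<k. 1)"
    by (intro sum_mono) (use assms in \<open>auto simp: power_le_one\<close>)
  then have "(1 - x) * (\<Sum>i<k. x ^ i) \<le> (1 - x) * real k"
    using assms by (intro mult_left_mono) auto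
  then show "1 - x ^ k \<le> real k * (1 - x)" by (simp add: g mult_ac)
  have "(\<Sum>i<k. x ^ (k - 1)) \<le> (\<Sum>i<k. x ^ i)"
    by (intro sum_mono power_decreasing) (use assms in auto)
  then have "(1 - x) * (real k * x ^ (k - 1)) \<le> (1 - x) * (\<Sum>i<k. x ^ i)"
    using assms by (intro mult_left_mono) auto
  then show "real k * x ^ (k - 1) * (1 - x) \<le> 1 - x ^ k" by (simp add: g mult_ac)
  have "2 * (\<Sum>i<k. x ^ i) = (\<Sum>i<k. x ^ i) + (\<Sum>i<k. x ^ (k - Suc i))"
    by (subst sum.nat_diff_reindex) simp
  also have "\<dots> = (\<Sum>i<k. x ^ i + x ^ (k - Suc i))"
    by (simp add: sum.distrib)
  also have "\<dots> \<le> (\<Sum>i<k. 1 + x ^ (k - 1))"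
  proof (rule sum_mono)
    fix i assume "i \<in> {..<k}"
    then have "x ^ (k - 1) = x ^ i * x ^ (k - Suc i)"
      by (simp flip: power_add)
    moreover have "0 \<le> (1 - x ^ i) * (1 - x ^ (k - Suc i))"
      using assms by (intro mult_nonneg_nonneg) (auto simp: power_le_one)
    ultimately show "x ^ i + x ^ (k - Suc i) \<le> 1 + x ^ (k - 1)"
      by (simp add: algebra_simps)
  qed
  finally have "(1 - x) * (2 * (\<Sum>i<k. x ^ i)) \<le> (1 - x) * (real k * (1 + x ^ (k - 1)))"
    using assms by (intro mult_left_mono) auto
  then show "2 * (1 - x ^ k) \<le> real k * (1 - x) * (1 + x ^ (k - 1))" by (simp add: g mult_ac)
qed

text \<open>A fixed point below 1 gives a series of nonnegative terms with nonpositive sum, so all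
  terms vanish. For \<open>k \<ge> 2\<close> this forces \<open>pmf q k = 0\<close>, and what is
  left is the point mass at 0, whose generating function is the constant 1.\<close>

lemma extinction_of_mean_le_1:
  assumes q1: "pmf q 1 = 0" and mean: "(\<lambda>k. real k * pmf q k) sums m" "m \<le> 1"
    and e: "0 \<le> e" "e \<le> 1" "pgf q e = e"
  shows "e = 1"
proof (rule ccontr)
  assume "e \<noteq> 1"
  then have lt: "e < 1" using e by simp
  have "(\<lambda>k. pmf q k - pmf q k * e ^ k) sums (1 - e)"
    using sums_diff[OF sums_pmf_nat pgf_sums[OF e(1,2), of q]] e(3) by simp
  then have "(\<lambda>k. (real k * pmf q k) * (1 - e) - (pmf q k - pmf q k * e ^ k)) sums (m * (1 - e) - (1 - e))"
    by (rule sums_diff[OF sums_mult2[OF mean(1)]])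
  then have s: "(\<lambda>k. pmf q k * (real k * (1 - e) - (1 - e ^ k))) sums (m * (1 - e) - (1 - e))"
    by (simp add: algebra_simps)
  have nn: "0 \<le> pmf q k * (real k * (1 - e) - (1 - e ^ k))" for k
    using geometric_sum_bounds(1)[OF e(1,2), of k] by simp
  have "m * (1 - e) \<le> 1 - e"
    using mult_right_mono[OF mean(2), of "1 - e"] e by simp
  moreover have "0 \<le> m * (1 - e) - (1 - e)"
    by (rule sums_le[OF nn sums_zero s])
  ultimately have "m * (1 - e) - (1 - e) = 0" by linarith
  then have "suminf (\<lambda>k. pmf q k * (real k * (1 - e) - (1 - e ^ k))) = 0"
    using sums_unique[OF s] by simp
  then have z: "pmf q k * (real k * (1 - e) - (1 - e ^ k)) = 0" for k
    using suminf_eq_zero_iff[OF sums_summable[OF s] nn] by blast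
  have "pmf q k = 0" if "k \<ge> 1" for k
  proof (cases "k = 1")
    case False
    then have k: "k \<ge> 2" using that by simp
    have "(\<Sum>i<k. e ^ i) < (\<Sum>i<k. 1)"
      by (rule sum_strict_mono_ex1) (use k e lt in \<open>auto simp: power_le_one intro!: bexI[of _ 1]\<close>)
    then have "(1 - e) * (\<Sum>i<k. e ^ i) < (1 - e) * real k"
      using lt by (intro mult_strict_left_mono) auto
    then have "1 - e ^ k < real k * (1 - e)"
      by (simp add: one_diff_power_eq mult_ac)
    then show ?thesis using z[of k] by simp
  qed (use q1 in simp)
  then have "(\<lambda>k. pmf q k * y ^ k) = (\<lambda>k. if k = 0 then pmf q 0 else 0)" for y
    by auto
  then have c: "pgf q y = pmf q 0" for y
    unfolding pgf_def using suminf_finite[of "{0 :: nat}" "\<lambda>k. if k = 0 then pmf q 0 else 0"] by simp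
  then have "pgf q e = pgf q 1" by simp
  then show False using e(3) lt by (simp add: pgf_1)
qed

text \<open>As \<open>pmf q 1 = 0\<close>, only \<open>k \<ge> 2\<close> contributes; there
  \<open>x ^ (k - 1) \<le> x\<close>, so the derivative of the generating function is at most
  \<open>x * m\<close>.\<close>

lemma thinned_1_less:
  assumes q1: "pmf q 1 = 0" and mean: "(\<lambda>k. real k * pmf q k) sums m" "m \<le> 1"
    and x: "0 \<le> x" "x < 1"
  shows "thinned q 1 x < 1"
proof -
  have "thinned q 1 x \<le> x * m"
  proof (rule sums_le[OF _ thinned_1_sums[OF x] sums_mult[OF mean(1), of x]])
    fix k
    show "pmf q k * real k * x ^ (k - 1) \<le> x * (real k * pmf q k)"
    proof (cases "k \<le> 1")
      case True
      then have "k = 0 \<or> k = 1" by auto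
      then show ?thesis using q1 by auto
    next
      case False
      then have "x ^ (k - 1) \<le> x ^ 1"
        using x by (intro power_decreasing) auto
      then show ?thesis
        using mult_left_mono[of "x ^ (k - 1)" x "pmf q k * real k"] by (simp add: mult_ac)
    qed
  qed
  also have "\<dots> \<le> x * 1"
    using mean(2) x by (intro mult_left_mono) auto
  finally show ?thesis using x by simp
qed

section \<open>Limits at 1, and the subcritical case\<close>

lemma abel_tendsto:
  fixes a :: "nat \<Rightarrow> real"
  assumes "\<And>k. 0 \<le> a k" "summable a"
  shows "((\<lambda>x. \<Sum>k. a k * x ^ e k) \<longlongrightarrow> (\<Sum>k. a k)) (at_left 1)"
proof -
  show ?thesis
  proof (rule tannerys_theorem[where M = a, THEN conjunct2, THEN conjunct2])
    show "((\<lambda>x. a k * x ^ e k) \<longlongrightarrow> a k) (at_left 1)" for k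
      by (auto intro!: tendsto_eq_intros)
    have "eventually (\<lambda>x :: real. 0 < x) (at_left 1)"
      by (rule eventually_at_leftI[of 0]) auto
    moreover have "eventually (\<lambda>x :: real. x < 1) (at_left 1)"
      by (rule eventually_at_leftI[of 0]) auto
    ultimately have "eventually (\<lambda>x :: real. 0 < x \<and> x < 1) (at_left 1)"
      by eventually_elim simp
    then have "\<forall>\<^sub>F (k :: nat, x) in at_top \<times>\<^sub>F at_left 1. 0 < x \<and> x < (1 :: real)"
      by (subst eventually_prod2) auto
    then show "\<forall>\<^sub>F (k, x) in at_top \<times>\<^sub>F at_left 1. norm (a k * x ^ e k) \<le> a k"
      by eventually_elim (use assms in \<open>auto simp: abs_mult mult_left_le power_le_one\<close>)
  qed (use assms in auto)
qed

lemma at_left_1_to_right_0: "filterlim (\<lambda>y. 1 - y) (at_left 1) (at_right (0 :: real))"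
  by (rule filterlim_at_withinI) (auto intro!: tendsto_eq_intros eventually_at_rightI[of 0 1])

lemma at_right_0_to_left_1: "filterlim (\<lambda>x. 1 - x) (at_right (0 :: real)) (at_left 1)"
  by (rule filterlim_at_withinI) (auto intro!: tendsto_eq_intros eventually_at_leftI[of 0])

lemma eventually_01: "eventually (\<lambda>y :: real. 0 < y \<and> y < 1) (at_right 0)"
  by (rule eventually_at_rightI[of 0 1]) auto

text \<open>The difference quotient of the generating function between \<open>1 - p\<close> and 1
  lies between the derivative at \<open>1 - p\<close> and \<open>m\<close>, so both tend to
  \<open>m\<close>. After division by \<open>p\<close>, the numerator and the denominator tend to
  the same positive number \<open>1 - m\<close>.\<close>

lemma subcritical_leaf_tendsto:
  assumes mean: "(\<lambda>k. real k * pmf q k) sums m" "m < 1"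
  shows "((\<lambda>p. (p - 1 + thinned q 0 (1 - p)) / (p * (1 - thinned q 1 (1 - p)))) \<longlongrightarrow> 1) (at_right 0)"
proof -
  have ev: "eventually (\<lambda>y :: real. 0 < y \<and> y < 1) (at_right 0)" by (rule eventually_01)
  have "((\<lambda>x. \<Sum>k. real k * pmf q k * x ^ (k - 1)) \<longlongrightarrow> (\<Sum>k. real k * pmf q k)) (at_left 1)"
    by (rule abel_tendsto) (use mean in \<open>auto simp: sums_iff\<close>)
  then have "((\<lambda>p. \<Sum>k. real k * pmf q k * (1 - p) ^ (k - 1)) \<longlongrightarrow> m) (at_right 0)"
    using filterlim_compose[OF _ at_left_1_to_right_0] mean by (simp add: sums_iff)
  then have t1: "((\<lambda>p. thinned q 1 (1 - p)) \<longlongrightarrow> m) (at_right 0)"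
    by (simp add: thinned_def mult_ac)
  have t0: "((\<lambda>p. (1 - thinned q 0 (1 - p)) / p) \<longlongrightarrow> m) (at_right 0)"
  proof (rule tendsto_sandwich[OF _ _ t1 tendsto_const])
    have diff: "(\<lambda>k. pmf q k * (1 - (1 - p) ^ k)) sums (1 - thinned q 0 (1 - p))" if "0 < p \<and> p < 1" for p
      using sums_diff[OF sums_pmf_nat[of q] pgf_sums[of "1 - p" q]] that
      by (simp add: thinned_0_pgf algebra_simps)
    show "\<forall>\<^sub>F p in at_right 0. thinned q 1 (1 - p) \<le> (1 - thinned q 0 (1 - p)) / p"
      using ev
    proof eventually_elim
      case (elim p)
      have "thinned q 1 (1 - p) * p \<le> 1 - thinned q 0 (1 - p)"
      proof (rule sums_le[OF _ sums_mult2[OF thinned_1_sums] diff[OF elim]])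
        show "pmf q k * real k * (1 - p) ^ (k - 1) * p \<le> pmf q k * (1 - (1 - p) ^ k)" for k
          using mult_left_mono[OF geometric_sum_bounds(2)[of "1 - p" k], of "pmf q k"] elim
          by (simp add: mult_ac)
      qed (use elim in auto)
      then show ?case using elim by (simp add: field_simps)
    qed
    show "\<forall>\<^sub>F p in at_right 0. (1 - thinned q 0 (1 - p)) / p \<le> m"
      using ev
    proof eventually_elim
      case (elim p)
      have "1 - thinned q 0 (1 - p) \<le> m * p"
      proof (rule sums_le[OF _ diff[OF elim] sums_mult2[OF mean(1)]])
        show "pmf q k * (1 - (1 - p) ^ k) \<le> real k * pmf q k * p" for k
          using mult_left_mono[OF geometric_sum_bounds(1)[of "1 - p" k], of "pmf q k"] elim
          by (simp add: mult_ac)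
      qed
      then show ?case using elim by (simp add: field_simps)
    qed
  qed
  have "((\<lambda>p. (1 - (1 - thinned q 0 (1 - p)) / p) / (1 - thinned q 1 (1 - p))) \<longlongrightarrow> (1 - m) / (1 - m)) (at_right 0)"
    by (intro tendsto_intros t0 t1) (use mean(2) in simp)
  also have "(1 - m) / (1 - m) = 1" using mean(2) by simp
  finally show ?thesis
  proof (rule Lim_transform_eventually)
    show "\<forall>\<^sub>F p in at_right 0. (1 - (1 - thinned q 0 (1 - p)) / p) / (1 - thinned q 1 (1 - p)) =
        (p - 1 + thinned q 0 (1 - p)) / (p * (1 - thinned q 1 (1 - p)))"
      using ev
    proof eventually_elim
      case (elim p)
      then have "1 - (1 - thinned q 0 (1 - p)) / p = (p - 1 + thinned q 0 (1 - p)) / p"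
        by (simp add: diff_divide_distrib add_divide_distrib)
      then show ?case by simp
    qed
  qed
qed

text \<open>A power series with bounded coefficients determines its lowest coefficients up to an error
  that vanishes with the argument; this gives convergence of the coefficients one after the other.\<close>

lemma tendsto_coefficients:
  fixes r :: "'n \<Rightarrow> nat \<Rightarrow> real" and a :: "nat \<Rightarrow> real"
  assumes F: "F \<noteq> bot"
    and bound: "eventually (\<lambda>n. \<forall>i. \<bar>r n i\<bar> \<le> 1) F"
    and conv: "\<And>z. 0 < z \<Longrightarrow> z < 1 \<Longrightarrow> ((\<lambda>n. \<Sum>i. r n i * z ^ i) \<longlongrightarrow> f z) F"
    and a: "\<And>z. 0 < z \<Longrightarrow> z < 1 \<Longrightarrow> (\<lambda>i. a i * z ^ i) sums f z"
  shows "((\<lambda>n. r n j) \<longlongrightarrow> a j) F"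
proof (induction j rule: less_induct)
  case (less j)
  have suma: "summable (\<lambda>i. a (i + j) * (1 / 2) ^ i)"
  proof -
    have "summable (\<lambda>i. a (i + j) * (1 / 2) ^ (i + j))"
      using a[of "1 / 2"] by (subst summable_iff_shift) (auto simp: sums_iff)
    then have "summable (\<lambda>i. a (i + j) * (1 / 2) ^ (i + j) * 2 ^ j)"
      by (rule summable_mult2)
    then show ?thesis by (simp add: power_add power_one_over)
  qed
  define ta where "ta z = (\<Sum>i. a (i + j) * z ^ i)" for z :: real
  have ta0: "ta 0 = a j"
    unfolding ta_def by (simp add: powser_zero)
  have "isCont ta 0"
    unfolding ta_def[abs_def] by (rule isCont_powser[OF suma]) simp
  then have ta_lim: "(ta \<longlongrightarrow> a j) (at_right 0)"
    using ta0 by (metis continuous_at_split continuous_within isCont_def)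
  show ?case
  proof (rule tendstoI)
    fix \<epsilon> :: real assume eps: "0 < \<epsilon>"
    \<comment> \<open>\<open>z\<close> is fixed before \<open>n\<close>. The error consists of the
      continuity of \<open>ta\<close> at 0, the convergence of the shifted series at this
      \<open>z\<close>, and the tail of that series; as \<open>z < 1 / 2\<close>, the tail is at
      most \<open>z / (1 - z) \<le> 2 * z\<close>, which explains
      \<open>\<epsilon> / 6\<close>.\<close>
    have "eventually (\<lambda>z. dist (ta z) (a j) < \<epsilon> / 3 \<and> (0 < z \<and> z < 1) \<and> 2 * z < \<epsilon> / 3 \<and> z < 1 / 2) (at_right 0)"
      by (intro eventually_conj eventually_01 tendstoD[OF ta_lim]
            eventually_at_rightI[of 0 "\<epsilon> / 6"] eventually_at_rightI[of 0 "1 / 2"])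
         (use eps in auto)
    then obtain z where z: "dist (ta z) (a j) < \<epsilon> / 3" "0 < z" "z < 1" "2 * z < \<epsilon> / 3" "z < 1 / 2"
      using eventually_happens'[OF trivial_limit_at_right_real] by blast
    \<comment> \<open>The series without its first \<open>j\<close> terms, divided by
      \<open>z ^ j\<close>. Its limit is known because the coefficients removed converge by the
      induction hypothesis.\<close>
    define tr where "tr n = ((\<Sum>i. r n i * z ^ i) - (\<Sum>i<j. r n i * z ^ i)) / z ^ j" for n
    have "ta z = (f z - (\<Sum>i<j. a i * z ^ i)) / z ^ j"
    proof -
      have "(\<lambda>i. a (i + j) * z ^ (i + j)) sums (f z - (\<Sum>i<j. a i * z ^ i))"
        by (rule sums_split_initial_segment[OF a[OF z(2,3)]])
      then have "(\<lambda>i. a (i + j) * z ^ (i + j) / z ^ j) sums ((f z - (\<Sum>i<j. a i * z ^ i)) / z ^ j)"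
        by (rule sums_divide)
      then show ?thesis using z by (simp add: ta_def power_add sums_iff)
    qed
    moreover have "(tr \<longlongrightarrow> (f z - (\<Sum>i<j. a i * z ^ i)) / z ^ j) F"
      unfolding tr_def by (intro tendsto_intros conv less) (use z in auto)
    ultimately have "(tr \<longlongrightarrow> ta z) F" by simp
    then have "eventually (\<lambda>n. dist (tr n) (ta z) < \<epsilon> / 3) F"
      using eps by (intro tendstoD) auto
    then show "eventually (\<lambda>n. dist (r n j) (a j) < \<epsilon>) F"
      using bound
    proof eventually_elim
      case (elim n)
      have sr: "summable (\<lambda>i. r n i * z ^ i)"
        by (rule summable_comparison_test'[OF summable_geometric[of z]])
           (use elim z in \<open>auto simp: abs_mult mult_left_le_one_le\<close>)
      have "(\<lambda>i. r n (i + j) * z ^ (i + j)) sums ((\<Sum>i. r n i * z ^ i) - (\<Sum>i<j. r n i * z ^ i))"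
        by (rule sums_split_initial_segment[OF summable_sums[OF sr]])
      then have "(\<lambda>i. r n (i + j) * z ^ (i + j) / z ^ j) sums tr n"
        unfolding tr_def by (rule sums_divide)
      then have "(\<lambda>i. r n (i + j) * z ^ i) sums tr n"
        using z by (simp add: power_add)
      then have s: "(\<lambda>i. r n (Suc i + j) * z ^ Suc i) sums (tr n - r n j)"
        using sums_Suc_iff[of "\<lambda>i. r n (i + j) * z ^ i" "tr n - r n j"] by simp
      have g: "(\<lambda>i. z * z ^ i) sums (z * (1 / (1 - z)))"
        using z by (intro sums_mult geometric_sums) auto
      have "\<bar>r n (Suc i + j) * z ^ Suc i\<bar> \<le> z * z ^ i" for i
        using elim z by (auto simp: abs_mult mult_left_le_one_le)
      then have "tr n - r n j \<le> z * (1 / (1 - z))" "- (tr n - r n j) \<le> z * (1 / (1 - z))"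
        using sums_le[OF _ s g] sums_le[OF _ sums_minus[OF s] g] by (auto simp: abs_le_iff)
      moreover have "z * (1 / (1 - z)) \<le> 2 * z"
        using z by (simp add: field_simps)
      ultimately show ?case
        using elim(1) z unfolding dist_real_def by linarith
    qed
  qed
qed

text \<open>Uniqueness of coefficients is \<open>tendsto_coefficients\<close> for a constant
  sequence.\<close>

lemma pmf_eq_of_pgf_eq:
  assumes "\<And>z. 0 < z \<Longrightarrow> z < 1 \<Longrightarrow> pgf p z = pgf p' z"
  shows "p = p'"
proof (rule pmf_eqI)
  fix j
  have "((\<lambda>n :: nat. pmf p j) \<longlonglongrightarrow> pmf p' j)"
  proof (rule tendsto_coefficients[where f = "pgf p"])
    show "\<forall>\<^sub>F n in sequentially. \<forall>i. \<bar>pmf p i\<bar> \<le> 1" by (simp add: pmf_le_1)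
    fix z :: real assume z: "0 < z" "z < 1"
    show "(\<lambda>n. \<Sum>i. pmf p i * z ^ i) \<longlonglongrightarrow> pgf p z" by (simp add: pgf_def)
    show "(\<lambda>i. pmf p' i * z ^ i) sums pgf p z"
      using pgf_sums[of z p'] assms[OF z] z by simp
  qed simp
  then show "pmf p j = pmf p' j" by (simp add: LIMSEQ_const_iff)
qed

section \<open>The critical offspring distribution under thinning\<close>

text \<open>Passing from \<open>k\<close> to \<open>k + 1\<close> raises every coefficient by one,
  which adds a geometric sum.\<close>

lemma triangular_sum:
  fixes x :: real
  shows "(\<Sum>m<k. (real k - real m - 1) * x ^ m) * (1 - x)\<^sup>2 = x ^ k - real k * x + real k - 1"
proof (induction k)
  case (Suc k)
  have "(\<Sum>m<Suc k. (real (Suc k) - real m - 1) * x ^ m) =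
      (\<Sum>m<k. (real k - real m - 1) * x ^ m) + (\<Sum>m<k. x ^ m)"
    by (simp add: sum.distrib[symmetric] algebra_simps)
  moreover have "(\<Sum>m<k. x ^ m) * (1 - x)\<^sup>2 = (1 - x ^ k) * (1 - x)"
    by (simp add: one_diff_power_eq power2_eq_square mult_ac)
  ultimately show ?case
    using Suc by (simp add: ring_distribs algebra_simps)
qed simp

context
  fixes q :: "nat pmf"
  assumes q1: "pmf q 1 = 0" and crit: "critical q"
begin

lemma critical_sums: "(\<lambda>k. real k * pmf q k) sums 1"
  using crit by (simp add: critical_def)

text \<open>Exchanging the sums leaves \<open>triangular_sum\<close> for each \<open>k\<close>; in
  the sum over \<open>k\<close> the mean and the total mass, both equal to 1, cancel.\<close>

lemma g_fun_eq:
  assumes x: "0 < x" "x < 1"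
  shows "g_fun q x = (pgf q x - x) / (1 - x)\<^sup>2"
proof -
  define u where "u m k = (if k \<ge> m + 1 then (real k - real m - 1) * pmf q k else 0)" for m k :: nat
  define a where "a k m = u m k * x ^ m * (1 - x)\<^sup>2" for k m
  have u: "0 \<le> u m k" "u m k \<le> real k * pmf q k" for m k
    by (auto simp: u_def intro!: mult_right_mono)
  have row: "(\<lambda>m. a k m) sums (pmf q k * x ^ k - real k * pmf q k * x + real k * pmf q k - pmf q k)" for k
  proof -
    have "(\<lambda>m. a k m) sums (\<Sum>m<k. a k m)"
      by (rule sums_finite) (auto simp: a_def u_def)
    also have "(\<Sum>m<k. a k m) = pmf q k * ((\<Sum>m<k. (real k - real m - 1) * x ^ m) * (1 - x)\<^sup>2)"
      by (simp add: a_def u_def sum_distrib_left sum_distrib_right mult_ac)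
    also have "\<dots> = pmf q k * x ^ k - real k * pmf q k * x + real k * pmf q k - pmf q k"
      unfolding triangular_sum by (simp add: algebra_simps)
    finally show ?thesis .
  qed
  have tot0: "(\<lambda>k. pmf q k * x ^ k - real k * pmf q k * x + real k * pmf q k - pmf q k) sums
      (pgf q x - 1 * x + 1 - 1)"
    by (intro sums_diff sums_add sums_mult2 critical_sums sums_pmf_nat pgf_sums) (use x in auto)
  have "(\<lambda>m. \<Sum>k. a k m) sums (pgf q x - 1 * x + 1 - 1)"
    by (rule sums_swap_nonneg(1)[OF _ row tot0]) (use u x in \<open>auto simp: a_def\<close>)
  then have tot: "(\<lambda>m. \<Sum>k. a k m) sums (pgf q x - x)" by simp
  have "(\<Sum>k. a k m) = (\<Sum>k. u m k) * x ^ m * (1 - x)\<^sup>2" for m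
  proof -
    have "summable (u m)"
      by (rule summable_comparison_test'[of "\<lambda>k. real k * pmf q k"]) (use critical_sums u in \<open>auto simp: sums_iff\<close>)
    then show ?thesis
      unfolding a_def by (metis suminf_mult2 summable_mult2)
  qed
  then have "(\<lambda>m. (\<Sum>k. u m k) * x ^ m) sums ((pgf q x - x) / (1 - x)\<^sup>2)"
    using sums_divide[OF tot, of "(1 - x)\<^sup>2"] x by simp
  then show ?thesis
    unfolding g_fun_def u_def by (simp add: sums_iff)
qed

text \<open>The \<open>S\<close> of the overview, as a function of the distance \<open>y\<close>
  from 1. Its derivative is \<open>slope\<close>, by \<open>excess_deriv\<close>.\<close>

definition excess :: "real \<Rightarrow> real" where
  "excess y = pgf q (1 - y) - (1 - y)"

definition slope :: "real \<Rightarrow> real" where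
  "slope y = 1 - thinned q 1 (1 - y)"

lemma slope_pos: "0 < y \<Longrightarrow> y < 1 \<Longrightarrow> 0 < slope y"
  using thinned_1_less[OF q1 critical_sums, of "1 - y"] by (simp add: slope_def)

text \<open>\<open>slope\<close> is concave and vanishes at 0, so the area below its graph contains
  a triangle; term by term this is the trapezoidal bound in \<open>geometric_sum_bounds\<close>. In
  the limit it yields \<open>l \<ge> 1 / 2\<close>.\<close>

lemma excess_ge:
  assumes "0 < y" "y < 1"
  shows "y * slope y / 2 \<le> excess y"
proof -
  let ?x = "1 - y"
  have x: "0 \<le> ?x" "?x < 1" "?x \<le> 1" using assms by auto
  have D: "(\<lambda>k. (real k * pmf q k - pmf q k * real k * ?x ^ (k - 1)) * (y / 2)) sums (slope y * (y / 2))"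
    unfolding slope_def by (intro sums_mult2 sums_diff critical_sums thinned_1_sums x)
  have S: "(\<lambda>k. pmf q k * ?x ^ k - pmf q k + real k * pmf q k * y) sums (pgf q ?x - 1 + 1 * y)"
    by (intro sums_diff sums_add sums_mult2 critical_sums sums_pmf_nat pgf_sums x)
  have "slope y * (y / 2) \<le> pgf q ?x - 1 + 1 * y"
  proof (rule sums_le[OF _ D S])
    fix k
    have "pmf q k * (2 * (1 - ?x ^ k)) \<le> pmf q k * (real k * (1 - ?x) * (1 + ?x ^ (k - 1)))"
      by (intro mult_left_mono geometric_sum_bounds(3) x) auto
    then show "(real k * pmf q k - pmf q k * real k * ?x ^ (k - 1)) * (y / 2) \<le>
        pmf q k * ?x ^ k - pmf q k + real k * pmf q k * y"
      by (simp add: algebra_simps)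
  qed
  then show ?thesis by (simp add: excess_def mult_ac)
qed

lemma excess_pos: "0 < y \<Longrightarrow> y < 1 \<Longrightarrow> 0 < excess y"
  using excess_ge[of y] slope_pos[of y] by (smt (verit) divide_pos_pos mult_pos_pos)

lemma excess_0: "excess 0 = 0"
  by (simp add: excess_def pgf_1)

lemma excess_deriv:
  assumes "0 < y" "y < 1"
  shows "(excess has_real_derivative slope y) (at y)"
proof -
  have "((\<lambda>y. pgf q (1 - y)) has_real_derivative thinned q 1 (1 - y) * (- 1)) (at y)"
    by (rule DERIV_chain2[OF pgf_has_deriv]) (use assms in \<open>auto intro!: derivative_eq_intros\<close>)
  then show ?thesis
    unfolding excess_def[abs_def] slope_def by (auto intro!: derivative_eq_intros)
qed

text \<open>The offspring probabilities of the pruned tree, as a function of the probability \<open>p\<close>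
  that pruning leaves something.\<close>

definition pruned_offspring :: "real \<Rightarrow> nat \<Rightarrow> real" where
  "pruned_offspring p j = (if j = 1 then 0 else if j = 0 then excess p / (p * slope p)
     else p ^ (j - 1) * thinned q j (1 - p) / slope p)"

text \<open>This is the Taylor expansion at \<open>1 - p\<close> with increment
  \<open>p * z\<close>, divided by \<open>p * slope p\<close>. The correction \<open>c0\<close>
  turns the constant term into the probability of a leaf, and \<open>c1\<close> cancels the linear
  term, as merging leaves no vertex with one child.\<close>

lemma pruned_offspring_sums:
  assumes p: "0 < p" "p < 1" and z: "0 \<le> z" "z \<le> 1"
  shows "(\<lambda>j. pruned_offspring p j * z ^ j) sums (z + excess (p * (1 - z)) / (p * slope p))"
proof -
  note D = slope_pos[OF p]
  define c0 where "c0 = (p - 1) / (p * slope p)"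
  define c1 where "c1 = z * (slope p - 1) / slope p"
  have pz: "p * z \<le> p" using p z by (simp add: mult_left_le)
  have "(\<lambda>j. thinned q j (1 - p) * (p * z) ^ j / (p * slope p)) sums (pgf q (1 - p + p * z) / (p * slope p))"
    by (intro sums_divide pgf_taylor) (use p z pz in auto)
  moreover have "(\<lambda>j. if j \<in> {0, 1} then (if j = 0 then c0 else c1) else 0) sums
      (\<Sum>j\<in>{0, 1 :: nat}. if j = 0 then c0 else c1)"
    by (rule sums_If_finite_set) simp
  ultimately have "(\<lambda>j. thinned q j (1 - p) * (p * z) ^ j / (p * slope p) +
      (if j \<in> {0, 1} then (if j = 0 then c0 else c1) else 0)) sums
      (pgf q (1 - p + p * z) / (p * slope p) + (\<Sum>j\<in>{0, 1 :: nat}. if j = 0 then c0 else c1))"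
    by (rule sums_add)
  moreover have "thinned q j (1 - p) * (p * z) ^ j / (p * slope p) +
      (if j \<in> {0, 1} then (if j = 0 then c0 else c1) else 0) = pruned_offspring p j * z ^ j" for j
  proof -
    consider "j = 0" | "j = 1" | i where "j = Suc (Suc i)"
      by (metis One_nat_def nat.exhaust)
    then show ?thesis
    proof cases
      case 1
      then show ?thesis
        by (simp add: pruned_offspring_def c0_def excess_def thinned_0_pgf flip: add_divide_distrib)
    next
      case 2
      have eq: "thinned q 1 (1 - p) = 1 - slope p" by (simp add: slope_def)
      have "thinned q 1 (1 - p) * (p * z) ^ 1 / (p * slope p) + c1 = 0"
        unfolding eq c1_def using p D by (simp add: field_simps)
      then show ?thesis
        using 2 by (simp add: pruned_offspring_def)
    next
      case 3
      then show ?thesis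
        using p D by (simp add: pruned_offspring_def power_mult_distrib field_simps)
    qed
  qed
  moreover have "pgf q (1 - p + p * z) / (p * slope p) + (\<Sum>j\<in>{0, 1 :: nat}. if j = 0 then c0 else c1) =
      z + excess (p * (1 - z)) / (p * slope p)"
    using p D by (simp add: c0_def c1_def excess_def field_simps)
  ultimately show ?thesis by simp
qed

lemma pruned_offspring_nonneg:
  assumes p: "0 < p" "p < 1"
  shows "0 \<le> pruned_offspring p j"
  using slope_pos[OF p] excess_pos[OF p] thinned_nonneg[of "1 - p" q j] p
  by (auto simp: pruned_offspring_def)

lemma pruned_offspring_sums_1:
  assumes p: "0 < p" "p < 1"
  shows "pruned_offspring p sums 1"
  using pruned_offspring_sums[OF p, of 1] by (simp add: excess_0)

lemma pruned_offspring_partial_sum: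
  assumes p: "0 < p" "p < 1"
  shows "(\<Sum>j<n. pruned_offspring p j) \<le> 1"
  using sum_le_suminf[of "pruned_offspring p" "{..<n}"] pruned_offspring_sums_1[OF p]
    pruned_offspring_nonneg[OF p] by (auto simp: sums_iff)

lemma pruned_offspring_le_1:
  assumes p: "0 < p" "p < 1"
  shows "pruned_offspring p j \<le> 1"
  using sum_le_suminf[of "pruned_offspring p" "{j}"] pruned_offspring_sums_1[OF p]
    pruned_offspring_nonneg[OF p] by (auto simp: sums_iff)

section \<open>Regular variation and the limiting offspring distribution\<close>

context
  fixes l :: real
  assumes lim: "((\<lambda>x. (pgf q x - x) / ((1 - x) * (1 - deriv (pgf q) x))) \<longlongrightarrow> l) (at_left 1)"
begin

lemma excess_ratio: "((\<lambda>y. excess y / (y * slope y)) \<longlongrightarrow> l) (at_right 0)"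
proof -
  have "((\<lambda>y. (pgf q (1 - y) - (1 - y)) / ((1 - (1 - y)) * (1 - deriv (pgf q) (1 - y)))) \<longlongrightarrow> l) (at_right 0)"
    by (rule filterlim_compose[OF lim at_left_1_to_right_0])
  then show ?thesis
  proof (rule Lim_transform_eventually)
    show "\<forall>\<^sub>F y in at_right 0. (pgf q (1 - y) - (1 - y)) / ((1 - (1 - y)) * (1 - deriv (pgf q) (1 - y))) =
        excess y / (y * slope y)"
      using eventually_01
    proof eventually_elim
      case (elim y)
      then have "deriv (pgf q) (1 - y) = thinned q 1 (1 - y)"
        by (intro DERIV_imp_deriv pgf_has_deriv) auto
      then show ?case by (simp add: excess_def slope_def)
    qed
  qed
qed

lemma l_pos: "0 < l"
proof -
  have "1 / 2 \<le> l"
  proof (rule tendsto_lowerbound[OF excess_ratio])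
    show "\<forall>\<^sub>F y in at_right 0. 1 / 2 \<le> excess y / (y * slope y)"
      using eventually_01
    proof eventually_elim
      case (elim y)
      then show ?case
        using excess_ge[of y] slope_pos[of y] by (simp add: field_simps)
    qed
  qed simp
  then show ?thesis by simp
qed

lemma slope_ratio: "((\<lambda>y. y * slope y / excess y) \<longlongrightarrow> 1 / l) (at_right 0)"
  using tendsto_inverse[OF excess_ratio] l_pos by (simp add: inverse_eq_divide)

text \<open>By l'Hospital's rule at 0 from the right; the quotient of the derivatives is minus the
  ratio in \<open>slope_ratio\<close>.\<close>

lemma ln_excess_ratio: "((\<lambda>y. ln (excess y) / (- ln y)) \<longlongrightarrow> - (1 / l)) (at_right 0)"
proof (rule lhopital_right_0_at_top[where f' = "\<lambda>y. slope y / excess y" and g' = "\<lambda>y. - (1 / y)"])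
  show "LIM y at_right 0. - ln y :> (at_top :: real filter)"
    using ln_at_0 by (simp add: filterlim_uminus_at_top)
  show "\<forall>\<^sub>F y in at_right 0. - (1 / y) \<noteq> (0 :: real)"
    using eventually_01 by eventually_elim simp
  show "\<forall>\<^sub>F y in at_right 0. ((\<lambda>y. ln (excess y)) has_real_derivative slope y / excess y) (at y)"
    using eventually_01
  proof eventually_elim
    case (elim y)
    then show ?case
      using excess_pos[of y] excess_deriv[of y] by (auto intro!: derivative_eq_intros)
  qed
  show "\<forall>\<^sub>F y in at_right 0. ((\<lambda>y. - ln y) has_real_derivative - (1 / y)) (at y)"
    using eventually_01 by eventually_elim (auto intro!: derivative_eq_intros)
  show "((\<lambda>y. slope y / excess y / - (1 / y)) \<longlongrightarrow> - (1 / l)) (at_right 0)"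
    using tendsto_minus[OF slope_ratio] by (simp add: mult_ac)
qed

text \<open>The denominator \<open>(1 - x)\<^sup>2\<close> in \<open>g_fun_eq\<close> contributes
  the summand 2.\<close>

lemma ln_g_fun_ratio: "((\<lambda>x. ln (g_fun q x) / (- ln (1 - x))) \<longlongrightarrow> 2 - 1 / l) (at_left 1)"
proof -
  have "((\<lambda>x. ln (excess (1 - x)) / (- ln (1 - x)) + 2) \<longlongrightarrow> - (1 / l) + 2) (at_left 1)"
    by (intro tendsto_add tendsto_const filterlim_compose[OF ln_excess_ratio at_right_0_to_left_1])
  moreover have "\<forall>\<^sub>F x in at_left 1. ln (excess (1 - x)) / (- ln (1 - x)) + 2 = ln (g_fun q x) / (- ln (1 - x))"
  proof (rule eventually_at_leftI[of 0])
    fix x :: real assume "x \<in> {0<..<1}"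
    then have x: "0 < x" "x < 1" by auto
    have "ln (g_fun q x) = ln (excess (1 - x)) - 2 * ln (1 - x)"
      using x excess_pos[of "1 - x"]
      by (simp add: g_fun_eq excess_def ln_div ln_realpow)
    moreover have "ln (1 - x) \<noteq> 0" using x by simp
    ultimately show "ln (excess (1 - x)) / (- ln (1 - x)) + 2 = ln (g_fun q x) / (- ln (1 - x))"
      by (simp only: diff_divide_distrib) simp
  qed simp
  ultimately show ?thesis
    using Lim_transform_eventually by fastforce
qed

text \<open>The function \<open>h\<close> has derivative \<open>o(1 / u)\<close>, so its increment
  between points in the fixed ratio \<open>y\<close> tends to 0; taking exponentials gives the power
  law.\<close>

lemma excess_regularly_varying:
  assumes y: "0 < y" "y < 1"
  shows "((\<lambda>p. excess (p * y) / excess p) \<longlongrightarrow> y powr (1 / l)) (at_right 0)"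
proof -
  define h where "h u = ln (excess u) - (1 / l) * ln u" for u
  have "((\<lambda>p. h p - h (p * y)) \<longlongrightarrow> 0) (at_right 0)"
  proof (rule tendstoI)
    \<comment> \<open>The ratio is required within \<open>e * y\<close>: the intermediate point
      \<open>z\<close> of the mean value theorem is only known to exceed \<open>p * y\<close>, which
      costs a factor \<open>1 / y\<close>.\<close>
    fix e :: real assume e: "0 < e"
    have "\<forall>\<^sub>F u in at_right 0. dist (u * slope u / excess u) (1 / l) < e * y"
      using e y by (intro tendstoD[OF slope_ratio]) auto
    then obtain b where b: "0 < b" "\<And>u. 0 < u \<Longrightarrow> u < b \<Longrightarrow> dist (u * slope u / excess u) (1 / l) < e * y"
      by (auto simp: eventually_at_right_field)
    have "\<forall>\<^sub>F p in at_right 0. 0 < p \<and> p < min b 1"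
      by (rule eventually_at_rightI[of 0 "min b 1"]) (use b in auto)
    then show "\<forall>\<^sub>F p in at_right 0. dist (h p - h (p * y)) 0 < e"
    proof eventually_elim
      case (elim p)
      then have py: "0 < p * y" "p * y < p" using y by auto
      have "\<exists>z. p * y < z \<and> z < p \<and> h p - h (p * y) = (p - p * y) * (slope z / excess z - (1 / l) * (1 / z))"
      proof (rule MVT2[OF py(2)])
        fix z assume "p * y \<le> z" "z \<le> p"
        then have z: "0 < z" "z < 1" using py elim by auto
        show "(h has_real_derivative slope z / excess z - (1 / l) * (1 / z)) (at z)"
          unfolding h_def[abs_def]
          using excess_pos[OF z] excess_deriv[OF z] z l_pos by (auto intro!: derivative_eq_intros)
      qed
      then obtain z where z: "p * y < z" "z < p"
          "h p - h (p * y) = (p - p * y) * (slope z / excess z - (1 / l) * (1 / z))" by blast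
      have z0: "0 < z" "z < b" "z < 1" using z py elim by auto
      have "z * \<bar>slope z / excess z - (1 / l) * (1 / z)\<bar> = \<bar>z * slope z / excess z - 1 / l\<bar>"
        using z0 by (simp add: abs_mult_pos' algebra_simps flip: abs_mult_pos)
      also have "\<dots> < e * y" using b(2)[OF z0(1,2)] by (simp add: dist_real_def)
      finally have 1: "z * \<bar>slope z / excess z - (1 / l) * (1 / z)\<bar> < e * y" .
      have "\<bar>h p - h (p * y)\<bar> * y = (p * y) * (1 - y) * \<bar>slope z / excess z - (1 / l) * (1 / z)\<bar>"
      proof -
        have "\<bar>p - p * y\<bar> = p * (1 - y)" using py by (simp add: algebra_simps)
        then show ?thesis unfolding z(3) abs_mult by (simp add: mult_ac)
      qed
      also have "\<dots> \<le> z * 1 * \<bar>slope z / excess z - (1 / l) * (1 / z)\<bar>"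
        using z y py by (intro mult_right_mono mult_mono) auto
      also have "\<dots> < e * y" using 1 by simp
      finally show ?case using y by simp
    qed
  qed
  then have "((\<lambda>p. exp (- (h p - h (p * y)) + (1 / l) * ln y)) \<longlongrightarrow> exp (- 0 + (1 / l) * ln y)) (at_right 0)"
    by (intro tendsto_intros)
  then have "((\<lambda>p. exp (- (h p - h (p * y)) + (1 / l) * ln y)) \<longlongrightarrow> y powr (1 / l)) (at_right 0)"
    using y by (simp add: powr_def)
  then show ?thesis
  proof (rule Lim_transform_eventually)
    show "\<forall>\<^sub>F p in at_right 0. exp (- (h p - h (p * y)) + (1 / l) * ln y) = excess (p * y) / excess p"
      using eventually_01
    proof eventually_elim
      case (elim p)
      then have py: "0 < p * y" "p * y < 1" using y
        by (auto simp: mult_less_cancel_left2 intro: less_trans[OF mult_strict_left_mono[of y 1 p]])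
      have "- (h p - h (p * y)) + (1 / l) * ln y = ln (excess (p * y)) - ln (excess p)"
        using elim y by (simp add: h_def ln_mult algebra_simps)
      then show ?case
        using excess_pos[OF py] excess_pos[of p] elim by (simp add: exp_diff)
    qed
  qed
qed

text \<open>The coefficients at 0 of \<open>z + l (1 - z)^(1 / l)\<close>, by the binomial
  series.\<close>

definition igw_coeff :: "nat \<Rightarrow> real" where
  "igw_coeff j = (if j = 1 then 1 else 0) + l * ((1 / l) gchoose j) * (- 1) ^ j"

lemma igw_coeff_sums:
  assumes "0 \<le> z" "z < 1"
  shows "(\<lambda>j. igw_coeff j * z ^ j) sums (z + l * (1 - z) powr (1 / l))"
proof -
  have "(\<lambda>j. (if j = 1 then z ^ j else 0) + l * (((1 / l) gchoose j) * (- z) ^ j)) sums (z ^ 1 + l * (1 + - z) powr (1 / l))"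
    by (intro sums_add sums_mult gen_binomial_real sums_single) (use assms in auto)
  moreover have "(\<lambda>j. (if j = 1 then z ^ j else 0) + l * (((1 / l) gchoose j) * (- z) ^ j)) = (\<lambda>j. igw_coeff j * z ^ j)"
    by (auto simp: fun_eq_iff igw_coeff_def algebra_simps power_minus[of z])
  ultimately show ?thesis by simp
qed

text \<open>Apart from the summand \<open>z\<close>, the generating function is the product of
  \<open>excess p / (p * slope p)\<close> and \<open>excess (p * (1 - z)) / excess p\<close>, whose
  limits are \<open>l\<close> and a power. Boundedness by 1 carries the convergence over to the
  coefficients.\<close>

lemma pruned_offspring_tendsto: "((\<lambda>p. pruned_offspring p j) \<longlongrightarrow> igw_coeff j) (at_right 0)"
proof (rule tendsto_coefficients[where f = "\<lambda>z. z + l * (1 - z) powr (1 / l)"])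
  show "\<forall>\<^sub>F p in at_right 0. \<forall>i. \<bar>pruned_offspring p i\<bar> \<le> 1"
    using eventually_01
    by eventually_elim (use pruned_offspring_nonneg pruned_offspring_le_1 in auto)
  fix z :: real assume z: "0 < z" "z < 1"
  show "(\<lambda>i. igw_coeff i * z ^ i) sums (z + l * (1 - z) powr (1 / l))"
    using igw_coeff_sums z by simp
  have "((\<lambda>p. z + (excess p / (p * slope p)) * (excess (p * (1 - z)) / excess p)) \<longlongrightarrow>
      z + l * (1 - z) powr (1 / l)) (at_right 0)"
    by (intro tendsto_intros excess_ratio excess_regularly_varying) (use z in auto)
  then show "((\<lambda>p. \<Sum>i. pruned_offspring p i * z ^ i) \<longlongrightarrow> z + l * (1 - z) powr (1 / l)) (at_right 0)"
  proof (rule Lim_transform_eventually)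
    show "\<forall>\<^sub>F p in at_right 0. z + (excess p / (p * slope p)) * (excess (p * (1 - z)) / excess p) =
        (\<Sum>i. pruned_offspring p i * z ^ i)"
      using eventually_01
    proof eventually_elim
      case (elim p)
      then show ?case
        using pruned_offspring_sums[of p z] z excess_pos[of p] by (simp add: sums_iff)
    qed
  qed
qed simp

text \<open>Inherited from \<open>pruned_offspring\<close> in the limit, which replaces a sign
  analysis of generalized binomial coefficients.\<close>

lemma igw_coeff_nonneg: "0 \<le> igw_coeff j"
  by (rule tendsto_lowerbound[OF pruned_offspring_tendsto])
     (use eventually_01 pruned_offspring_nonneg in \<open>auto elim!: eventually_mono\<close>)

text \<open>As limits of partial sums of probabilities the partial sums are at most 1, but mass
  might escape in the limit. Abel continuity and the value of the closed form as \<open>z\<close>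
  tends to 1 exclude this.\<close>

lemma igw_coeff_sums_1: "igw_coeff sums 1"
proof -
  have "(\<Sum>j<n. igw_coeff j) \<le> 1" for n
    by (rule tendsto_upperbound[OF tendsto_sum[OF pruned_offspring_tendsto]])
       (use eventually_01 pruned_offspring_partial_sum in \<open>auto elim!: eventually_mono\<close>)
  then have s: "summable igw_coeff"
    by (intro bounded_imp_summable[of _ 1]) (simp_all only: igw_coeff_nonneg lessThan_Suc_atMost[symmetric])
  have 1: "((\<lambda>z. \<Sum>j. igw_coeff j * z ^ j) \<longlongrightarrow> (\<Sum>j. igw_coeff j)) (at_left 1)"
    by (rule abel_tendsto[OF igw_coeff_nonneg s, where e = "\<lambda>j. j"])
  have "((\<lambda>y :: real. y powr (1 / l)) \<longlongrightarrow> 0) (at_right 0)"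
    by (rule tendsto_zero_powrI[OF tendsto_ident_at tendsto_const]) (use l_pos in \<open>auto intro: eventually_mono[OF eventually_01]\<close>)
  then have "((\<lambda>y. (1 - y) + l * y powr (1 / l)) \<longlongrightarrow> (1 - 0) + l * 0) (at_right (0 :: real))"
    by (intro tendsto_intros)
  from filterlim_compose[OF this at_right_0_to_left_1]
  have "((\<lambda>z. z + l * (1 - z) powr (1 / l)) \<longlongrightarrow> 1) (at_left 1)" by simp
  then have "((\<lambda>z. \<Sum>j. igw_coeff j * z ^ j) \<longlongrightarrow> 1) (at_left 1)"
  proof (rule Lim_transform_eventually)
    show "\<forall>\<^sub>F z in at_left 1. z + l * (1 - z) powr (1 / l) = (\<Sum>j. igw_coeff j * z ^ j)"
      by (rule eventually_at_leftI[of 0]) (use igw_coeff_sums in \<open>auto simp: sums_iff\<close>)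
  qed
  then have "(\<Sum>j. igw_coeff j) = 1"
    using 1 tendsto_unique[OF _ 1] by simp
  then show ?thesis using s by (simp add: sums_iff)
qed

text \<open>The definite description is resolved by building the law from \<open>igw_coeff\<close>;
  uniqueness is \<open>pmf_eq_of_pgf_eq\<close>.\<close>

lemma pmf_IGW_offspring: "pmf (IGW_offspring l) j = igw_coeff j"
  and pgf_IGW_offspring: "0 \<le> z \<Longrightarrow> z \<le> 1 \<Longrightarrow> pgf (IGW_offspring l) z = z + l * (1 - z) powr (1 / l)"
proof -
  define p where "p = embed_pmf igw_coeff"
  have p: "pmf p j = igw_coeff j" for j
    unfolding p_def
  proof (rule pmf_embed_pmf)
    show "(\<integral>\<^sup>+ j. ennreal (igw_coeff j) \<partial>count_space UNIV) = 1"
      using igw_coeff_sums_1 igw_coeff_nonneg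
      by (simp add: nn_integral_count_space_nat suminf_ennreal2 sums_iff)
  qed (rule igw_coeff_nonneg)
  have pgf: "pgf p z = z + l * (1 - z) powr (1 / l)" if "0 \<le> z" "z \<le> 1" for z
  proof (cases "z = 1")
    case False
    then show ?thesis
      using igw_coeff_sums[of z] that by (simp add: pgf_def p sums_iff)
  qed (simp add: pgf_1)
  have "IGW_offspring l = p"
    unfolding IGW_offspring_def
  proof (rule the_equality)
    show "\<forall>z\<in>{0..1}. pgf p z = z + l * (1 - z) powr (1 / l)" using pgf by simp
    show "p' = p" if "\<forall>z\<in>{0..1}. pgf p' z = z + l * (1 - z) powr (1 / l)" for p'
      by (rule pmf_eq_of_pgf_eq) (use that pgf in auto)
  qed
  then show "pmf (IGW_offspring l) j = igw_coeff j"
    "0 \<le> z \<Longrightarrow> z \<le> 1 \<Longrightarrow> pgf (IGW_offspring l) z = z + l * (1 - z) powr (1 / l)"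
    using p pgf by auto
qed

lemma IGW_offspring_extinction:
  assumes "0 \<le> e" "e \<le> 1" "pgf (IGW_offspring l) e = e"
  shows "e = 1"
  using pgf_IGW_offspring[OF assms(1,2)] assms l_pos by auto

end

end

section \<open>Convergence\<close>

lemma tendsto_prod_list:
  fixes f :: "'a \<Rightarrow> 'b \<Rightarrow> real"
  assumes "\<And>y. y \<in> set ys \<Longrightarrow> ((\<lambda>t. f t y) \<longlongrightarrow> g y) F"
  shows "((\<lambda>t. prod_list (map (f t) ys)) \<longlongrightarrow> prod_list (map g ys)) F"
  using assms by (induction ys) (auto intro!: tendsto_mult)

lemma GW_leaf:
  assumes "\<And>e. 0 \<le> e \<Longrightarrow> e \<le> 1 \<Longrightarrow> pgf r e = e \<Longrightarrow> e = 1"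
  shows "measure (GW r) {Node {#((), Node {#})#}} = pmf r 0"
proof -
  have "{ys :: comb_tree list. mset ys = image_mset snd ({#} :: (unit \<times> comb_tree) multiset)} = {[]}"
    by auto
  then show ?thesis
    by (subst GW_stem[OF assms]) (simp_all only: size_empty sum.insert sum.empty, simp)
qed

context pruned_gw
begin

lemma survival_le_1: "survival t \<le> 1"
  by (simp add: survival_def)

text \<open>\<open>core_law_recursion\<close> and \<open>GW_stem\<close> have the same form, with
  weights given by \<open>p\<close> and by \<open>r\<close>, so convergence of the weights lifts to
  each tree by structural induction. Below the stem of a reduced tree a vertex has no children or at
  least two, which are the cases covered by \<open>conv0\<close> and \<open>conv\<close>.\<close>

lemma core_law_tendsto:
  assumes less: "\<And>x. 0 \<le> x \<Longrightarrow> x < 1 \<Longrightarrow> thinned q 1 x < 1"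
    and ext_r: "\<And>e. 0 \<le> e \<Longrightarrow> e \<le> 1 \<Longrightarrow> pgf r e = e \<Longrightarrow> e = 1"
    and conv0: "((\<lambda>p. (p - 1 + thinned q 0 (1 - p)) / (p * (1 - thinned q 1 (1 - p)))) \<longlongrightarrow> pmf r 0) (at_right 0)"
    and conv: "\<And>j. 2 \<le> j \<Longrightarrow>
      ((\<lambda>p. p ^ (j - 1) * thinned q j (1 - p) / (1 - thinned q 1 (1 - p))) \<longlongrightarrow> pmf r j) (at_right 0)"
    and \<sigma>: "reduced \<sigma>" "size (root_edges \<sigma>) \<noteq> 1"
  shows "((\<lambda>t. core_law t \<sigma>) \<longlongrightarrow> measure (GW r) {Node {#((), \<sigma>)#}}) at_top"
  using \<sigma>
proof (induction \<sigma> rule: tree.induct)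
  case (Node F)
  have less': "thinned q 1 (1 - survival t) < 1" if "0 \<le> t" for t
    using survival_pos[OF that] survival_le_1[of t] by (intro less) auto
  have ev: "eventually (\<lambda>t :: real. 0 \<le> t) at_top" by (rule eventually_ge_at_top)
  show ?case
  proof (cases "F = {#}")
    case True
    have lim: "((\<lambda>t. (survival t - 1 + thinned q 0 (1 - survival t)) /
        (survival t * (1 - thinned q 1 (1 - survival t)))) \<longlongrightarrow> pmf r 0) at_top"
      by (rule filterlim_compose[OF conv0 survival_at_right])
    have GW: "measure (GW r) {Node {#((), Node F)#}} = pmf r 0"
      unfolding True by (rule GW_leaf[OF ext_r])
    have eq: "eventually (\<lambda>t. (survival t - 1 + thinned q 0 (1 - survival t)) /
        (survival t * (1 - thinned q 1 (1 - survival t))) = core_law t (Node F)) at_top"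
      using ev
    proof eventually_elim
      case (elim t)
      show ?case unfolding True by (rule core_law_recursion(1)[OF elim less'[OF elim], symmetric])
    qed
    show ?thesis
      unfolding GW by (rule Lim_transform_eventually[OF lim eq])
  next
    case False
    then have F: "2 \<le> size F"
      using Node.prems(2) by (cases "size F") (auto simp: Suc_le_eq)
    have IH: "((\<lambda>t. core_law t y) \<longlongrightarrow> measure (GW r) {Node {#((), y)#}}) at_top"
      if "y \<in># image_mset snd F" for y
    proof -
      have y: "((), y) \<in># F" using that by auto
      have "size (root_edges y) \<noteq> 1 \<and> reduced y"
        using Node.prems(1) y unfolding reduced.simps[of "Node F"] by blast
      then show ?thesis using Node.IH[of "((), y)" y] y by (simp add: snds.simps)
    qed
    have lim: "((\<lambda>t. survival t ^ (size F - 1) * thinned q (size F) (1 - survival t) / (1 - thinned q 1 (1 - survival t)) *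
        (\<Sum>ys | mset ys = image_mset snd F. prod_list (map (core_law t) ys))) \<longlongrightarrow>
        pmf r (size F) * (\<Sum>ys | mset ys = image_mset snd F.
          prod_list (map (\<lambda>y. measure (GW r) {Node {#((), y)#}}) ys))) at_top"
    proof (intro tendsto_mult tendsto_sum tendsto_prod_list filterlim_compose[OF conv[OF F] survival_at_right])
      fix ys y assume "ys \<in> {ys. mset ys = image_mset snd F}" "y \<in> set ys"
      then have "y \<in># image_mset snd F"
        by (metis mem_Collect_eq set_mset_mset)
      then show "((\<lambda>t. core_law t y) \<longlongrightarrow> measure (GW r) {Node {#((), y)#}}) at_top"
        by (rule IH)
    qed
    have GW: "measure (GW r) {Node {#((), Node F)#}} =
        pmf r (size F) * (\<Sum>ys | mset ys = image_mset snd F.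
          prod_list (map (\<lambda>y. measure (GW r) {Node {#((), y)#}}) ys))"
      by (rule GW_stem[OF ext_r])
    have eq: "eventually (\<lambda>t. survival t ^ (size F - 1) * thinned q (size F) (1 - survival t) /
        (1 - thinned q 1 (1 - survival t)) *
        (\<Sum>ys | mset ys = image_mset snd F. prod_list (map (core_law t) ys)) = core_law t (Node F)) at_top"
      using ev
    proof eventually_elim
      case (elim t)
      show ?case by (rule core_law_recursion(2)[OF elim less'[OF elim] F, symmetric])
    qed
    show ?thesis
      unfolding GW by (rule Lim_transform_eventually[OF lim eq])
  qed
qed

lemma sets_core_shape:
  assumes "0 \<le> t"
  shows "{w. \<exists>y. core t w = Some y \<and> Node {#((), y)#} \<in> B} \<in> sets W"
proof -
  have "{w. shape (prune \<phi> t (tree_of w)) \<in> B - {empty_tree}} =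
      {w. \<exists>y. core t w = Some y \<and> Node {#((), y)#} \<in> B}"
    by (auto simp: shape_prune_eq_core empty_tree_def split: option.splits)
  then show ?thesis
    using prob_shape_prune(2)[OF assms, of "B - {empty_tree}"] by simp
qed

lemma cond_prob_shape_eq_core_law:
  assumes "0 \<le> t"
  shows "\<P>(\<omega> in M. shape (prune \<phi> t (T \<omega>)) = Node {#((), \<sigma>)#} \<bar> prune \<phi> t (T \<omega>) \<noteq> empty_tree) =
    core_law t \<sigma>"
proof -
  have "{w. \<exists>y. core t w = Some y \<and> Node {#((), y)#} \<in> {Node {#((), \<sigma>)#}}} = {w. core t w = Some \<sigma>}"
    by auto
  then show ?thesis
    using cond_prob_shape[OF assms, of "{Node {#((), \<sigma>)#}}"]
    by (simp only: core_law_def singleton_iff)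
qed

text \<open>Once a single tree carries conditional probability tending to 1, these bounds determine
  the limit for every set \<open>A\<close>, according to whether \<open>A\<close> contains that
  tree.\<close>

lemma cond_prob_shape_bounds:
  assumes t: "0 \<le> t"
  defines "P \<equiv> \<lambda>A. \<P>(\<omega> in M. shape (prune \<phi> t (T \<omega>)) \<in> A \<bar> prune \<phi> t (T \<omega>) \<noteq> empty_tree)"
  shows "P A \<le> 1" and "0 \<le> P A"
    and "Node {#((), \<sigma>)#} \<in> A \<Longrightarrow> core_law t \<sigma> \<le> P A"
    and "Node {#((), \<sigma>)#} \<notin> A \<Longrightarrow> P A \<le> 1 - core_law t \<sigma>"
proof -
  note pos = survival_pos[OF t]
  let ?E = "{w. \<exists>y. core t w = Some y \<and> Node {#((), y)#} \<in> A}"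
  have P: "P A = W.prob ?E / survival t"
    unfolding P_def by (rule cond_prob_shape[OF t])
  have "W.prob ?E \<le> survival t"
    unfolding survival_def by (rule W.finite_measure_mono) (auto intro: sets_core_neq[OF t, simplified])
  then show "P A \<le> 1" "0 \<le> P A"
    using pos by (auto simp: P)
  show "core_law t \<sigma> \<le> P A" if "Node {#((), \<sigma>)#} \<in> A"
  proof -
    have "W.prob {w. core t w = Some \<sigma>} \<le> W.prob ?E"
      by (rule W.finite_measure_mono) (use that sets_core_shape[OF t] in auto)
    then show ?thesis using pos by (simp add: P core_law_def divide_right_mono)
  qed
  show "P A \<le> 1 - core_law t \<sigma>" if "Node {#((), \<sigma>)#} \<notin> A"
  proof -
    have "W.prob ?E \<le> W.prob ({w. core t w \<noteq> None} - {w. core t w = Some \<sigma>})"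
      by (rule W.finite_measure_mono) (use that sets_core_neq[OF t] sets_core[OF t] in auto)
    also have "\<dots> = survival t - W.prob {w. core t w = Some \<sigma>}"
      unfolding survival_def
      by (rule W.finite_measure_Diff) (use sets_core_neq[OF t] sets_core[OF t] in auto)
    finally show ?thesis
      using pos by (simp add: P core_law_def field_simps)
  qed
qed

end

theorem theorem8:
  fixes q :: "nat pmf" and lam :: real and \<phi> :: "metric_tree \<Rightarrow> real"
    and M :: "'w measure" and T :: "'w \<Rightarrow> metric_tree"
  assumes q1: "pmf q 1 = 0"
    and lam: "0 < lam"
    and nonneg: "\<And>S. S \<in> metric_trees \<Longrightarrow> 0 \<le> \<phi> S"
    and mono: "monotone_nondecreasing \<phi>"
    and meas: "\<And>t. 0 \<le> t \<Longrightarrow> prune \<phi> t \<in> measurable metric_tree_space metric_tree_space"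
    and M: "prob_space M"
    and T: "T \<in> measurable M metric_tree_space"
    and law: "distr M metric_tree_space T = GW_metric q lam"
    and pos: "\<And>t. 0 \<le> t \<Longrightarrow> \<P>(\<omega> in M. prune \<phi> t (T \<omega>) \<noteq> empty_tree) > 0"
  shows
    "(critical q \<and>
      (\<exists>l. ((\<lambda>x. (pgf q x - x) / ((1 - x) * (1 - deriv (pgf q) x))) \<longlongrightarrow> l) (at_left 1)) \<longrightarrow>
        (\<exists>L. ((\<lambda>x. ln (g_fun q x) / (- ln (1 - x))) \<longlongrightarrow> L) (at_left 1) \<and>
             (\<forall>\<tau> \<in> planted_comb_trees.
                ((\<lambda>t. \<P>(\<omega> in M. shape (prune \<phi> t (T \<omega>)) = \<tau> \<bar> prune \<phi> t (T \<omega>) \<noteq> empty_tree))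
                   \<longlongrightarrow> measure (IGW (1 / (2 - L))) {\<tau>}) at_top))) \<and>
     (subcritical q \<longrightarrow>
        (\<forall>A \<subseteq> planted_comb_trees.
           ((\<lambda>t. \<P>(\<omega> in M. shape (prune \<phi> t (T \<omega>)) \<in> A \<bar> prune \<phi> t (T \<omega>) \<noteq> empty_tree))
              \<longlongrightarrow> measure (GW (return_pmf 0)) A) at_top))"
proof (intro conjI impI)
  have ev: "eventually (\<lambda>t :: real. 0 \<le> t) at_top" by (rule eventually_ge_at_top)
  {
    assume "critical q \<and>
      (\<exists>l. ((\<lambda>x. (pgf q x - x) / ((1 - x) * (1 - deriv (pgf q) x))) \<longlongrightarrow> l) (at_left 1))"
    then obtain l where crit: "critical q"
      and lim: "((\<lambda>x. (pgf q x - x) / ((1 - x) * (1 - deriv (pgf q) x))) \<longlongrightarrow> l) (at_left 1)"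
      by blast
    note mean = critical_sums[OF q1 crit]
    interpret pruned_gw q lam \<phi> M T
      by (rule pruned_gw.intro)
         (rule q1 lam mono meas M T law pos extinction_of_mean_le_1[OF q1 mean order_refl] | assumption)+
    note l_pos = l_pos[OF q1 crit lim]
    note coeff = pruned_offspring_tendsto[OF q1 crit lim,
      folded pmf_IGW_offspring[OF q1 crit lim]]
    have ext_r: "e = 1" if "0 \<le> e" "e \<le> 1" "pgf (IGW_offspring l) e = e" for e
      by (rule IGW_offspring_extinction[OF q1 crit lim that])
    show "\<exists>L. ((\<lambda>x. ln (g_fun q x) / (- ln (1 - x))) \<longlongrightarrow> L) (at_left 1) \<and>
             (\<forall>\<tau> \<in> planted_comb_trees.
                ((\<lambda>t. \<P>(\<omega> in M. shape (prune \<phi> t (T \<omega>)) = \<tau> \<bar> prune \<phi> t (T \<omega>) \<noteq> empty_tree))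
                   \<longlongrightarrow> measure (IGW (1 / (2 - L))) {\<tau>}) at_top)"
    proof (intro exI conjI ballI)
      show "((\<lambda>x. ln (g_fun q x) / (- ln (1 - x))) \<longlongrightarrow> 2 - 1 / l) (at_left 1)"
        by (rule ln_g_fun_ratio[OF q1 crit lim])
      fix \<tau> assume \<tau>: "\<tau> \<in> planted_comb_trees"
      \<comment> \<open>With \<open>L = 2 - 1 / l\<close> the parameter \<open>1 / (2 - L)\<close>
        is \<open>l\<close> itself.\<close>
      have IGW: "IGW (1 / (2 - (2 - 1 / l))) = GW (IGW_offspring l)"
        by (simp add: IGW_def)
      show "((\<lambda>t. \<P>(\<omega> in M. shape (prune \<phi> t (T \<omega>)) = \<tau> \<bar> prune \<phi> t (T \<omega>) \<noteq> empty_tree))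
                   \<longlongrightarrow> measure (IGW (1 / (2 - (2 - 1 / l)))) {\<tau>}) at_top"
      proof (cases "\<tau> = empty_tree")
        \<comment> \<open>Both sides are 0: the conditioning excludes the empty tree, and a
          Galton-Watson tree almost surely has its stem.\<close>
        case True
        have "\<P>(\<omega> in M. shape (prune \<phi> t (T \<omega>)) = \<tau> \<bar> prune \<phi> t (T \<omega>) \<noteq> empty_tree) = 0" for t
          unfolding True cond_prob_def by (simp add: shape_eq_empty_tree_iff)
        then show ?thesis
          unfolding IGW True using GW_empty_tree[OF ext_r] by simp
      next
        case False
        then have "size (root_edges \<tau>) = 1" "reduced \<tau>"
          using \<tau> by (auto simp: planted_comb_trees_def planted_def comb_trees_def)
        then obtain e where "root_edges \<tau> = {#e#}"
          using size_1_singleton_mset by blast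
        then obtain \<sigma> where \<tau>_eq: "\<tau> = Node {#((), \<sigma>)#}"
          by (cases \<tau>; cases e) auto
        have "\<forall>l S. (l, S) \<in># {#((), \<sigma>)#} \<longrightarrow> size (root_edges S) \<noteq> 1 \<and> reduced S"
          using \<open>reduced \<tau>\<close> unfolding \<tau>_eq reduced.simps[of "Node {#((), \<sigma>)#}"] by blast
        then have \<sigma>: "reduced \<sigma>" "size (root_edges \<sigma>) \<noteq> 1" by auto
        have "((\<lambda>t. core_law t \<sigma>) \<longlongrightarrow> measure (GW (IGW_offspring l)) {Node {#((), \<sigma>)#}}) at_top"
        proof (rule core_law_tendsto[OF thinned_1_less[OF q1 mean order_refl] ext_r _ _ \<sigma>])
          have eq: "pgf q (1 - p) - (1 - p) = p - 1 + thinned q 0 (1 - p)" for p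
            by (simp add: thinned_0_pgf)
          show "((\<lambda>p. (p - 1 + thinned q 0 (1 - p)) / (p * (1 - thinned q 1 (1 - p))))
              \<longlongrightarrow> pmf (IGW_offspring l) 0) (at_right 0)"
            using coeff[of 0]
            by (simp add: pruned_offspring_def[OF q1 crit] excess_def[OF q1 crit] slope_def[OF q1 crit] eq)
          show "((\<lambda>p. p ^ (j - 1) * thinned q j (1 - p) / (1 - thinned q 1 (1 - p)))
              \<longlongrightarrow> pmf (IGW_offspring l) j) (at_right 0)" if "2 \<le> j" for j
            using coeff[of j] that
            by (simp add: pruned_offspring_def[OF q1 crit] slope_def[OF q1 crit])
        qed
        then show ?thesis
          unfolding IGW \<tau>_eq
          by (rule Lim_transform_eventually)
             (rule eventually_mono[OF ev], rule cond_prob_shape_eq_core_law[symmetric])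
      qed
    qed
  next
    assume "subcritical q"
    then obtain m where m: "m < 1" and mean: "(\<lambda>k. real k * pmf q k) sums m"
      by (auto simp: subcritical_def)
    interpret pruned_gw q lam \<phi> M T
      by (rule pruned_gw.intro)
         (rule q1 lam mono meas M T law pos extinction_of_mean_le_1[OF q1 mean less_imp_le[OF m]] | assumption)+
    \<comment> \<open>The generating function is the constant 1, so a fixed point can only be
      1.\<close>
    have ext_r: "e = 1" if "pgf (return_pmf 0) e = e" for e
    proof -
      have "(\<lambda>k. pmf (return_pmf 0) k * e ^ k) = (\<lambda>k. if k = 0 then 1 else 0)"
        by (auto simp: fun_eq_iff)
      then have "pgf (return_pmf 0) e = 1"
        using sums_single[of 0 "\<lambda>_. 1 :: real"] by (simp add: pgf_def sums_iff)
      then show ?thesis using that by simp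
    qed
    interpret GW: prob_space "GW (return_pmf 0)"
      by (rule prob_space_GW) (rule ext_r)
    let ?leaf = "Node {#} :: comb_tree"
    let ?stem = "Node {#((), ?leaf)#}"
    \<comment> \<open>The limit law is the point mass at the tree consisting of a single
      edge.\<close>
    have stem: "GW.prob {?stem} = 1"
      using GW_leaf[OF ext_r] by simp
    have GW_sets: "sets (GW (return_pmf 0)) = UNIV"
      by (simp add: GW_def)
    have less: "thinned q 1 (1 - survival t) < 1" if "0 \<le> t" for t
      using survival_pos[OF that] survival_le_1[of t] m by (intro thinned_1_less[OF q1 mean]) auto
    have "((\<lambda>t. (survival t - 1 + thinned q 0 (1 - survival t)) /
        (survival t * (1 - thinned q 1 (1 - survival t)))) \<longlongrightarrow> 1) at_top"
      by (rule filterlim_compose[OF subcritical_leaf_tendsto[OF mean m] survival_at_right])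
    then have leaf: "((\<lambda>t. core_law t ?leaf) \<longlongrightarrow> 1) at_top"
      by (rule Lim_transform_eventually)
         (rule eventually_mono[OF ev], rule core_law_recursion(1)[OF _ less, symmetric])
    show "\<forall>A \<subseteq> planted_comb_trees.
           ((\<lambda>t. \<P>(\<omega> in M. shape (prune \<phi> t (T \<omega>)) \<in> A \<bar> prune \<phi> t (T \<omega>) \<noteq> empty_tree))
              \<longlongrightarrow> measure (GW (return_pmf 0)) A) at_top"
    proof (intro allI impI)
      fix A
      show "((\<lambda>t. \<P>(\<omega> in M. shape (prune \<phi> t (T \<omega>)) \<in> A \<bar> prune \<phi> t (T \<omega>) \<noteq> empty_tree))
              \<longlongrightarrow> measure (GW (return_pmf 0)) A) at_top"
      proof (cases "?stem \<in> A")
        case True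
        then have "GW.prob {?stem} \<le> GW.prob A"
          by (intro GW.finite_measure_mono) (auto simp: GW_sets)
        then have A: "GW.prob A = 1" using stem GW.prob_le_1[of A] by simp
        show ?thesis
          unfolding A
          by (rule tendsto_sandwich[OF eventually_mono[OF ev cond_prob_shape_bounds(3)[OF _ True]]
                eventually_mono[OF ev cond_prob_shape_bounds(1)] leaf tendsto_const])
      next
        case False
        have "GW.prob (A \<union> {?stem}) = GW.prob A + GW.prob {?stem}"
          by (rule GW.finite_measure_Union) (use False in \<open>auto simp: GW_sets\<close>)
        then have A: "GW.prob A = 0"
          using stem GW.prob_le_1[of "A \<union> {?stem}"] measure_nonneg[of "GW (return_pmf 0)" A] by linarith
        have lim: "((\<lambda>t. 1 - core_law t ?leaf) \<longlongrightarrow> 0) at_top"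
          using tendsto_diff[OF tendsto_const leaf, of 1] by simp
        show ?thesis
          unfolding A
          by (rule tendsto_sandwich[OF eventually_mono[OF ev cond_prob_shape_bounds(2)]
                eventually_mono[OF ev cond_prob_shape_bounds(4)[OF _ False]] tendsto_const lim])
      qed
    qed
  }
qed

end
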